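(* Let $n\ge1$, $\kappa\ge1$. Suppose that, after performing a finite number of loops of the algorithm generating bi-invariants (described in the context), one has obtained a finite list of $1+M$ mutually independent bi-invariants $f_1',\Lambda^{\ell_1},\dots,\Lambda^{\ell_M}\in UE_\kappa^n$, of weights $1,\ell_1,\dots,\ell_M$, such that the ideal of relations $$\{S\in\mathbb{C}[A_1,\dots,A_M]:\ S(\Lambda^{\ell_1}|_0,\dots,\Lambda^{\ell_M}|_0)\equiv0\}$$ between their restrictions to $\{f_1'=0\}$ has, for a certain monomial order, a reduced Gröbner basis $\langle{\sf S}_i\rangle_{1\le i\le N}$ consisting of weighted homogeneous polynomials, with the property that there are polynomials ${\sf R}_i$ with, without setting $f_1'=0$, $$0\equiv{\sf S}_i(\Lambda^{\ell_1},\dots,\Lambda^{\ell_M})-f_1'\,{\sf R}_i(f_1',\Lambda^{\ell_1},\dots,\Lambda^{\ell_M})\qquad(i=1,\dots,N)$$ (so that no new bi-invariant appears). Then the algorithm terminates, and the algebra of bi-invariants is generated by this list: $$UE_\kappa^n=\mathbb{C}\big[f_1',\Lambda^{\ell_1},\dots,\Lambda^{\ell_M}\big]\ \ \text{modulo syzygies}.$$ In addition, if $(\Lambda^{\ell_1})^{\alpha_1^i}\cdots(\Lambda^{\ell_M})^{\alpha_M^i}$ is the leading monomial of ${\sf S}_i$ and $\square_i=\alpha^i+\mathbb{N}^M$, then every bi-invariant in $UE_{\kappa,m}^n$ of weight $m$ can be written uniquely as $$\sum_{0\le a\le m}(f_1')^a\,\widetilde{\sf P}_a\big(\Lambda^{\ell_1},\dots,\Lambda^{\ell_M}\big),\qquad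 \widetilde{\sf P}_a=\sum_{\substack{(b_1,\dots,b_M)\in\mathbb{N}^M\setminus(\square_1\cup\dots\cup\square_N)\\ \ell_1b_1+\dots+\ell_Mb_M=m-a}}{\sf coeff}_{a;b_1,\dots,b_M}\,(\Lambda^{\ell_1})^{b_1}\cdots(\Lambda^{\ell_M})^{b_M},$$ with complex coefficients ${\sf coeff}_{a;b_1,\dots,b_M}$ subject to no restriction.
   Context: $\mathbb{C}[j^\kappa f]$ is the polynomial ring in the variables $f_i^{(\lambda)}$, $1\le i\le n$, $1\le\lambda\le\kappa$ (jet coordinates of germs $f:(\mathbb{C},0)\to\mathbb{C}^n$). ${\sf P}\in\mathbb{C}[j^\kappa f]$ is invariant by reparametrization of weight $m$ if ${\sf P}(j^\kappa(f\circ\phi))=(\phi')^m{\sf P}((j^\kappa f)\circ\phi)$ for all local biholomorphisms $\phi$ of $(\mathbb{C},0)$. A bi-invariant of weight $m$ is such a polynomial which moreover satisfies ${\sf P}({\sf u}\cdot j^\kappa f)={\sf P}(j^\kappa f)$ for every lower triangular unipotent matrix ${\sf u}=(u_{ij})\in GL_n(\mathbb{C})$ acting simultaneously at each jet level by $f_i^{(\lambda)}\mapsto f_i^{(\lambda)}+\sum_{j<i}u_{ij}f_j^{(\lambda)}$. $UE_{\kappa,m}^n$ is the space of bi-invariants of weight $m$, $UE_\kappa^n=\oplus_mUE_{\kappa,m}^n$. ${\sf P}|_0$ denotes ${\sf P}$ with the single variable $f_1'$ set equal to $0$. A list is mutually independent if no member is a polynomial in the others. In $\mathbb{C}[A_1,\dots,A_M]$,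 weighted homogeneity is with respect to giving $A_j$ the weight $\ell_j$. Bracket: $[{\sf P},{\sf Q}]=q\,{\sf D}{\sf P}\cdot{\sf Q}-p\,{\sf P}\cdot{\sf D}{\sf Q}$ for invariants of weights $p,q$, with ${\sf D}=\sum_{k,\lambda}f_k^{(\lambda+1)}\partial/\partial f_k^{(\lambda)}$; $\Lambda_{1,i}^3=[f_i',f_1']$ and $\Lambda_{1,i;1^{\lambda-2}}^{2\lambda-1}=[\Lambda_{1,i;1^{\lambda-3}}^{2\lambda-3},f_1']$ for $2\le i\le n$, $3\le\lambda\le\kappa$. Algorithm. Initial list: $f_1'$ together with the bi-invariants obtained by dividing, by the maximal power of $f_1'$ which factors it, each determinant $\det\big(\Lambda_{1,i;1^{\lambda_s-2}}^{2\lambda_s-1}\big)_{2\le s\le n_1,\ 2\le i\le n_1}$ for $2\le n_1\le n$ and $2\le\lambda_2<\dots<\lambda_{n_1}\le\kappa$. One loop: given the current list $f_1',L_1,\dots,L_k$, compute for some monomial order a reduced Gröbner basis, made of weighted homogeneous elements ${\sf S}_i$, of the ideal of relations between $L_1|_0,\dots,L_k|_0$; write ${\sf S}_i(L_1,\dots,L_k)=(f_1')^{\nu_i}{\sf R}_i$ in $\mathbb{C}[j^\kappa f]$ with $\nu_i\ge1$ maximal (${\sf R}_i=0$ if the left side vanishes identically); each ${\sf R}_i$ is again a bi-invariant; successively for $i=1,2,\dots$ append ${\sf R}_i$ to the list when it does not belong to the algebra generated by $f_1',L_1,\dots,L_k$ and the already appended ones. The algorithm terminates when a loop appends nothing. 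*)

theory Defs
  imports
    "HOL-Analysis.Analysis"
    "HOL-Library.Poly_Mapping"
    "Jordan_Normal_Form.Determinant"
begin

section \<open>Multivariate polynomials over the complex numbers\<close>

type_synonym 'v cpoly = "('v \<Rightarrow>\<^sub>0 nat) \<Rightarrow>\<^sub>0 complex"

definition pconst :: "complex \<Rightarrow> 'v cpoly" where
  "pconst c = Poly_Mapping.single 0 c"

definition pvar :: "'v \<Rightarrow> 'v cpoly" where
  "pvar v = Poly_Mapping.single (Poly_Mapping.single v 1) 1"

definition pvars :: "'v cpoly \<Rightarrow> 'v set" where
  "pvars P = (\<Union>m\<in>Poly_Mapping.keys P. Poly_Mapping.keys m)"

definition poly_ring :: "'v set \<Rightarrow> 'v cpoly set" where
  "poly_ring V = {P. pvars P \<subseteq> V}"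

definition peval :: "('v \<Rightarrow> complex) \<Rightarrow> 'v cpoly \<Rightarrow> complex" where
  "peval x P = (\<Sum>m\<in>Poly_Mapping.keys P. Poly_Mapping.lookup P m *
      (\<Prod>v\<in>Poly_Mapping.keys m. x v ^ Poly_Mapping.lookup m v))"

definition psubst :: "('v \<Rightarrow> 'w cpoly) \<Rightarrow> 'v cpoly \<Rightarrow> 'w cpoly" where
  "psubst \<sigma> P = (\<Sum>m\<in>Poly_Mapping.keys P. pconst (Poly_Mapping.lookup P m) *
      (\<Prod>v\<in>Poly_Mapping.keys m. \<sigma> v ^ Poly_Mapping.lookup m v))"

definition pderiv_var :: "'v \<Rightarrow> 'v cpoly \<Rightarrow> 'v cpoly" where
  "pderiv_var v P = (\<Sum>m\<in>Poly_Mapping.keys P.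
      Poly_Mapping.single (m - Poly_Mapping.single v 1)
        (of_nat (Poly_Mapping.lookup m v) * Poly_Mapping.lookup P m))"

definition generated_algebra :: "'w cpoly list \<Rightarrow> 'w cpoly set" where
  "generated_algebra L = (\<lambda>P. psubst ((!) L) P) ` poly_ring {..<length L}"

definition mutually_independent :: "'w cpoly list \<Rightarrow> bool" where
  "mutually_independent L \<longleftrightarrow>
     (\<forall>i<length L. \<not> (\<exists>P\<in>poly_ring ({..<length L} - {i}). L ! i = psubst ((!) L) P))"


section \<open>Bi-invariant jet polynomials\<close>

text \<open>The variable \<open>(i, l)\<close> is the jet coordinate \<open>f\<^sub>i\<close> of derivation order \<open>l\<close>.\<close>

type_synonym jpoly = "(nat \<times> nat) cpoly"

abbreviation jvar :: "nat \<Rightarrow> nat \<Rightarrow> jpoly" where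
  "jvar i l \<equiv> pvar (i, l)"

abbreviation f1' :: jpoly where
  "f1' \<equiv> jvar 1 1"

definition jet_ring :: "nat \<Rightarrow> nat \<Rightarrow> jpoly set" where
  "jet_ring n \<kappa> = poly_ring ({1..n} \<times> {1..\<kappa>})"

definition local_biholomorphism :: "(complex \<Rightarrow> complex) \<Rightarrow> bool" where
  "local_biholomorphism \<phi> \<longleftrightarrow> \<phi> 0 = 0 \<and>
     (\<exists>U V \<psi>. open U \<and> open V \<and> 0 \<in> U \<and> homeomorphism U V \<phi> \<psi> \<and>
        \<phi> holomorphic_on U \<and> \<psi> holomorphic_on V)"

text \<open>The defining equation is an identity between germs of functions of \<open>t\<close> at \<open>0\<close>.\<close>

definition reparam_invariant :: "nat \<Rightarrow> nat \<Rightarrow> nat \<Rightarrow> jpoly \<Rightarrow> bool" where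
  "reparam_invariant n \<kappa> m P \<longleftrightarrow> P \<in> jet_ring n \<kappa> \<and>
     (\<forall>(f :: nat \<Rightarrow> complex \<Rightarrow> complex) \<phi>.
        (\<forall>i\<in>{1..n}. f i analytic_on {0}) \<and> local_biholomorphism \<phi> \<longrightarrow>
        (\<forall>\<^sub>F t in nhds 0.
           peval (\<lambda>(i, l). (deriv ^^ l) (f i \<circ> \<phi>) t) P =
           deriv \<phi> t ^ m * peval (\<lambda>(i, l). (deriv ^^ l) (f i) (\<phi> t)) P))"

text \<open>A lower triangular unipotent matrix is given by its entries strictly below the
  diagonal, so \<open>u\<close> is arbitrary and only the \<open>u i j\<close> with \<open>1 \<le> j < i \<le> n\<close> matter.\<close>

definition unipotent_invariant :: "jpoly \<Rightarrow> bool" where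
  "unipotent_invariant P \<longleftrightarrow>
     (\<forall>u :: nat \<Rightarrow> nat \<Rightarrow> complex.
        psubst (\<lambda>(i, l). jvar i l + (\<Sum>j\<in>{1..<i}. pconst (u i j) * jvar j l)) P = P)"

definition UE_weight :: "nat \<Rightarrow> nat \<Rightarrow> nat \<Rightarrow> jpoly set" where
  "UE_weight n \<kappa> m = {P. reparam_invariant n \<kappa> m P \<and> unipotent_invariant P}"

definition UE :: "nat \<Rightarrow> nat \<Rightarrow> jpoly set" where
  "UE n \<kappa> = {(\<Sum>m\<in>W. P m) | W P. finite W \<and> (\<forall>m\<in>W. P m \<in> UE_weight n \<kappa> m)}"

definition restrict0 :: "jpoly \<Rightarrow> jpoly" where
  "restrict0 P = psubst (\<lambda>v. if v = (1, 1) then 0 else pvar v) P"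


section \<open>Monomial orders and reduced Groebner bases in \<open>\<complex>[A\<^sub>0, \<dots>, A\<^bsub>M-1\<^esub>]\<close>\<close>

definition monomials :: "nat \<Rightarrow> (nat \<Rightarrow>\<^sub>0 nat) set" where
  "monomials M = {b. Poly_Mapping.keys b \<subseteq> {..<M}}"

definition monomial_order :: "nat \<Rightarrow> ((nat \<Rightarrow>\<^sub>0 nat) \<times> (nat \<Rightarrow>\<^sub>0 nat)) set \<Rightarrow> bool" where
  "monomial_order M r \<longleftrightarrow> well_order_on (monomials M) r \<and>
     (\<forall>a b c. (a, b) \<in> r \<and> c \<in> monomials M \<longrightarrow> (a + c, b + c) \<in> r)"

definition lead_monom ::
  "((nat \<Rightarrow>\<^sub>0 nat) \<times> (nat \<Rightarrow>\<^sub>0 nat)) set \<Rightarrow> nat cpoly \<Rightarrow> (nat \<Rightarrow>\<^sub>0 nat)" where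
  "lead_monom r P =
     (THE m. m \<in> Poly_Mapping.keys P \<and> (\<forall>m'\<in>Poly_Mapping.keys P. (m', m) \<in> r))"

definition lead_term ::
  "((nat \<Rightarrow>\<^sub>0 nat) \<times> (nat \<Rightarrow>\<^sub>0 nat)) set \<Rightarrow> nat cpoly \<Rightarrow> nat cpoly" where
  "lead_term r P =
     Poly_Mapping.single (lead_monom r P) (Poly_Mapping.lookup P (lead_monom r P))"

definition generated_ideal :: "nat \<Rightarrow> nat cpoly set \<Rightarrow> nat cpoly set" where
  "generated_ideal M B = {(\<Sum>g\<in>F. q g * g) | F q.
     finite F \<and> F \<subseteq> B \<and> (\<forall>g\<in>F. q g \<in> poly_ring {..<M})}"

definition reduced_groebner_basis ::
  "nat \<Rightarrow> ((nat \<Rightarrow>\<^sub>0 nat) \<times> (nat \<Rightarrow>\<^sub>0 nat)) set \<Rightarrow> nat cpoly set \<Rightarrow> nat cpoly set \<Rightarrow> bool" where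
  "reduced_groebner_basis M r I G \<longleftrightarrow>
     finite G \<and> G \<subseteq> I - {0} \<and>
     generated_ideal M (lead_term r ` G) = generated_ideal M (lead_term r ` (I - {0})) \<and>
     (\<forall>g\<in>G. Poly_Mapping.lookup g (lead_monom r g) = 1) \<and>
     (\<forall>g\<in>G. \<forall>m\<in>Poly_Mapping.keys g.
        Poly_Mapping.single m 1 \<notin> generated_ideal M (lead_term r ` (G - {g})))"

definition monom_weight :: "nat list \<Rightarrow> (nat \<Rightarrow>\<^sub>0 nat) \<Rightarrow> nat" where
  "monom_weight ls b = (\<Sum>j<length ls. ls ! j * Poly_Mapping.lookup b j)"

definition weighted_homogeneous :: "nat list \<Rightarrow> nat cpoly \<Rightarrow> bool" where
  "weighted_homogeneous ls S \<longleftrightarrow> (\<exists>d. \<forall>b\<in>Poly_Mapping.keys S. monom_weight ls b = d)"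


section \<open>The algorithm\<close>

text \<open>\<open>\<Sum>\<^sub>k\<^sub>,\<^sub>l f\<^sub>k\<^sup>(\<^sup>l\<^sup>+\<^sup>1\<^sup>) \<partial>/\<partial>f\<^sub>k\<^sup>(\<^sup>l\<^sup>)\<close>; only the variables occurring in \<open>P\<close> contribute.\<close>

definition total_diff :: "jpoly \<Rightarrow> jpoly" where
  "total_diff P = (\<Sum>(k, l)\<in>pvars P. jvar k (Suc l) * pderiv_var (k, l) P)"

definition bracket :: "nat \<Rightarrow> nat \<Rightarrow> jpoly \<Rightarrow> jpoly \<Rightarrow> jpoly" where
  "bracket p q P Q = of_nat q * total_diff P * Q - of_nat p * P * total_diff Q"

text \<open>\<open>Lam_aux i k\<close> has weight \<open>2 * k + 3\<close>, and \<open>Lam i l\<close> is the invariant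
  \<open>\<Lambda>\<^bsub>1,i;1^(l-2)\<^esub>\<close> of weight \<open>2 * l - 1\<close>, for \<open>l \<ge> 2\<close>.\<close>

primrec Lam_aux :: "nat \<Rightarrow> nat \<Rightarrow> jpoly" where
  "Lam_aux i 0 = bracket 1 1 (jvar i 1) f1'"
| "Lam_aux i (Suc k) = bracket (2 * k + 3) 1 (Lam_aux i k) f1'"

definition Lam :: "nat \<Rightarrow> nat \<Rightarrow> jpoly" where
  "Lam i l = Lam_aux i (l - 2)"

text \<open>The list \<open>[\<lambda>\<^sub>2, \<dots>, \<lambda>\<^bsub>n1\<^esub>]\<close> is indexed from \<open>0\<close>, and so are the rows and columns.\<close>

definition Lam_det :: "nat \<Rightarrow> nat list \<Rightarrow> jpoly" where
  "Lam_det n1 lams =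
     Determinant.det (Matrix.mat (n1 - 1) (n1 - 1) (\<lambda>(i, s). Lam (i + 2) (lams ! s)))"

definition f1'_quotient :: "nat \<Rightarrow> jpoly \<Rightarrow> jpoly \<Rightarrow> bool" where
  "f1'_quotient \<nu> P Q \<longleftrightarrow> P = f1' ^ \<nu> * Q \<and> \<not> f1' dvd Q"

definition initial_invariants :: "nat \<Rightarrow> nat \<Rightarrow> jpoly set" where
  "initial_invariants n \<kappa> = {Q. \<exists>n1 lams \<nu>. n1 \<in> {2..n} \<and> length lams = n1 - 1 \<and>
     sorted_wrt (<) lams \<and> set lams \<subseteq> {2..\<kappa>} \<and> f1'_quotient \<nu> (Lam_det n1 lams) Q}"

text \<open>A state of the algorithm is the list \<open>L\<close> of the invariants other than \<open>f1'\<close>, which is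
  always present.\<close>

definition initial_list :: "nat \<Rightarrow> nat \<Rightarrow> jpoly list \<Rightarrow> bool" where
  "initial_list n \<kappa> L \<longleftrightarrow> distinct L \<and> set L = initial_invariants n \<kappa>"

definition relation_ideal :: "jpoly list \<Rightarrow> nat cpoly set" where
  "relation_ideal L =
     {S \<in> poly_ring {..<length L}. psubst (\<lambda>j. restrict0 (L ! j)) S = 0}"

definition of_weights :: "nat \<Rightarrow> nat \<Rightarrow> jpoly list \<Rightarrow> nat list \<Rightarrow> bool" where
  "of_weights n \<kappa> L ls \<longleftrightarrow> list_all2 (\<lambda>P l. P \<in> UE_weight n \<kappa> l) L ls"

definition append_new :: "jpoly \<Rightarrow> jpoly list \<Rightarrow> jpoly list" where
  "append_new R L = (if R \<in> generated_algebra (f1' # L) then L else L @ [R])"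

definition homogeneous_reduced_basis ::
  "jpoly list \<Rightarrow> nat list \<Rightarrow> ((nat \<Rightarrow>\<^sub>0 nat) \<times> (nat \<Rightarrow>\<^sub>0 nat)) set \<Rightarrow> nat cpoly list \<Rightarrow> bool" where
  "homogeneous_reduced_basis L ls r Ss \<longleftrightarrow>
     distinct Ss \<and> reduced_groebner_basis (length L) r (relation_ideal L) (set Ss) \<and>
     (\<forall>S\<in>set Ss. weighted_homogeneous ls S)"

definition algorithm_loop :: "nat \<Rightarrow> nat \<Rightarrow> jpoly list \<Rightarrow> jpoly list \<Rightarrow> bool" where
  "algorithm_loop n \<kappa> L L' \<longleftrightarrow>
     (\<exists>ls r Ss Rs. of_weights n \<kappa> L ls \<and> monomial_order (length L) r \<and>
        homogeneous_reduced_basis L ls r Ss \<and>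
        list_all2 (\<lambda>S R. if psubst ((!) L) S = 0 then R = 0
          else \<exists>\<nu>\<ge>1. f1'_quotient \<nu> (psubst ((!) L) S) R) Ss Rs \<and>
        L' = fold append_new Rs L)"

definition obtained_by_algorithm :: "nat \<Rightarrow> nat \<Rightarrow> jpoly list \<Rightarrow> bool" where
  "obtained_by_algorithm n \<kappa> L \<longleftrightarrow>
     (\<exists>L0. initial_list n \<kappa> L0 \<and> (algorithm_loop n \<kappa>)\<^sup>*\<^sup>* L0 L)"

text \<open>A loop depends on the chosen monomial order and on the order in which the basis is
  listed. Termination means that a loop can be carried out and that none appends anything.\<close>

definition algorithm_terminates_at :: "nat \<Rightarrow> nat \<Rightarrow> jpoly list \<Rightarrow> bool" where
  "algorithm_terminates_at n \<kappa> L \<longleftrightarrow>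
     algorithm_loop n \<kappa> L L \<and> (\<forall>L'. algorithm_loop n \<kappa> L L' \<longrightarrow> L' = L)"


section \<open>Normal forms\<close>

definition cone :: "nat \<Rightarrow> (nat \<Rightarrow>\<^sub>0 nat) \<Rightarrow> (nat \<Rightarrow>\<^sub>0 nat) set" where
  "cone M \<alpha> = (\<lambda>c. \<alpha> + c) ` monomials M"

definition standard_monomials ::
  "nat list \<Rightarrow> ((nat \<Rightarrow>\<^sub>0 nat) \<times> (nat \<Rightarrow>\<^sub>0 nat)) set \<Rightarrow> nat cpoly list \<Rightarrow> nat \<Rightarrow> (nat \<Rightarrow>\<^sub>0 nat) set"
  where "standard_monomials ls r Ss d =
     {b \<in> monomials (length ls) - (\<Union>S\<in>set Ss. cone (length ls) (lead_monom r S)).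
        monom_weight ls b = d}"

text \<open>Families \<open>(P\<^sub>a)\<close>, \<open>0 \<le> a \<le> m\<close>, of linear combinations of standard monomials of weight
  \<open>m - a\<close>, extended by \<open>0\<close> for \<open>a > m\<close> so that a family is one function.\<close>

definition normal_families ::
  "nat list \<Rightarrow> ((nat \<Rightarrow>\<^sub>0 nat) \<times> (nat \<Rightarrow>\<^sub>0 nat)) set \<Rightarrow> nat cpoly list \<Rightarrow> nat \<Rightarrow> (nat \<Rightarrow> nat cpoly) set"
  where "normal_families ls r Ss m =
     {Pt. (\<forall>a\<le>m. Poly_Mapping.keys (Pt a) \<subseteq> standard_monomials ls r Ss (m - a)) \<and>
          (\<forall>a>m. Pt a = 0)}"

definition normal_sum :: "jpoly list \<Rightarrow> nat \<Rightarrow> (nat \<Rightarrow> nat cpoly) \<Rightarrow> jpoly" where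
  "normal_sum L m Pt = (\<Sum>a\<le>m. f1' ^ a * psubst ((!) L) (Pt a))"

end

(*
  Idea.  Let P be a bi-invariant of weight m.  Reparametrizing by the inverse of f_1, and then
  subtracting multiples of f_1 from the other components, moves a jet with f_1' <> 0 to one with
  f_1 = t and f_i' = 0; its remaining coordinates are the quotients of the invariants Lambda_{1,i}
  by powers of f_1'.  Hence P is f_1'^m times a polynomial W in these quotients, and W is invariant
  under the unipotent group acting on the rows 2, ..., n.  By the first fundamental theorem for
  that group, W is a polynomial in the minors on the first rows, so f_1'^N P lies in the algebra A
  generated by f_1' and the list.

  The first fundamental theorem is proved on the Taylor coefficients of W, which are tensors.  The
  least word in the support of an invariant tensor is a lattice word, hence encodes a standard
  tableau; the product of the minors on the columns of this tableau is an invariant with the same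
  least word, and can be subtracted.

  The hypothesis on the Groebner basis says that S(L) lies in f_1' A for every relation S between
  the restrictions to f_1' = 0.  Hence f_1' Q in A implies Q in A, which yields P in A, and repeated
  division by the Groebner basis gives the normal form.
*)
theory Submission
  imports Defs "HOL-Complex_Analysis.Complex_Analysis" "HOL-Library.List_Lexorder"
begin

section \<open>Polynomials\<close>

text \<open>Products of minors satisfy quadratic relations, which makes them hard to compare
  directly. With Taylor coefficients the jet orders \<open>c\<close> are held fixed and only the
  word \<open>w\<close> of row indices is acted on; a product of minors becomes an antisymmetrized
  word, and lexicographic comparison of supports is enough. The price is a factor e! in degree e.

  On the rows 2, ..., n the group enters through the one-parameter subgroups that add a multiple of
  one row to the next, differentiated at the identity. The resulting operators
  \<open>raise i\<close> force the ballot condition for each pair of adjacent letters, which is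
  exactly what makes the encoded tableau standard.

  The denominators are powers of f_1' because \<open>Lam i l\<close> has weight 2l - 1, while the
  slice coordinate it determines has weight 0. They are removed one factor at a time: if f_1' Q =
  T(L) + f_1' a with a in A, then T is a relation at f_1' = 0, and there the Groebner basis applies.
  The grading of the normal form comes from the reparametrization t -> 2t, which makes a
  bi-invariant of weight m isobaric of weight m.\<close>

definition mpower :: "('v \<Rightarrow> 'b::comm_monoid_mult) \<Rightarrow> ('v \<Rightarrow>\<^sub>0 nat) \<Rightarrow> 'b" where
  "mpower x m = (\<Prod>v\<in>Poly_Mapping.keys m. x v ^ Poly_Mapping.lookup m v)"

lemma mpower_superset:
  assumes "finite S" "Poly_Mapping.keys m \<subseteq> S"
  shows "mpower x m = (\<Prod>v\<in>S. x v ^ Poly_Mapping.lookup m v)"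
  unfolding mpower_def
  by (rule prod.mono_neutral_left) (use assms in \<open>auto simp: in_keys_iff\<close>)

lemma mpower_0 [simp]: "mpower x 0 = 1"
  by (simp add: mpower_def)

lemma mpower_add: "mpower x (m + m') = mpower x m * mpower x m'"
proof -
  let ?S = "Poly_Mapping.keys m \<union> Poly_Mapping.keys m'"
  have "Poly_Mapping.keys (m + m') \<subseteq> ?S" by (rule Poly_Mapping.keys_add)
  then show ?thesis
    by (simp add: mpower_superset[of ?S] lookup_add power_add prod.distrib)
qed

lemma mpower_single [simp]: "mpower x (Poly_Mapping.single v k) = x v ^ k"
  by (simp add: mpower_def)

lemma poly_sum_single:
  assumes "finite S" "Poly_Mapping.keys P \<subseteq> S"
  shows "P = (\<Sum>m\<in>S. Poly_Mapping.single m (Poly_Mapping.lookup P m))"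
proof (rule poly_mapping_eqI)
  fix k
  have "Poly_Mapping.lookup (\<Sum>m\<in>S. Poly_Mapping.single m (Poly_Mapping.lookup P m)) k
      = (\<Sum>m\<in>S. if m = k then Poly_Mapping.lookup P k else 0)"
    unfolding lookup_sum by (intro sum.cong refl) (auto simp: lookup_single when_def)
  also have "\<dots> = Poly_Mapping.lookup P k"
    using assms by (auto simp: sum.delta' in_keys_iff)
  finally show "Poly_Mapping.lookup P k
      = Poly_Mapping.lookup (\<Sum>m\<in>S. Poly_Mapping.single m (Poly_Mapping.lookup P m)) k" ..
qed

text \<open>The case \<open>single\<close> retains that \<open>m\<close> occurs in \<open>P\<close>,
  so bounds on the variables or the degree of \<open>P\<close> apply to every monomial met in the
  induction.\<close>

lemma cpoly_single_induct [case_names zero single add]: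
  fixes P :: "'v cpoly"
  assumes "Q 0"
    and "\<And>m c. m \<in> Poly_Mapping.keys P \<Longrightarrow> Q (Poly_Mapping.single m c)"
    and "\<And>p q. Q p \<Longrightarrow> Q q \<Longrightarrow> Q (p + q)"
  shows "Q P"
proof -
  have "finite S \<Longrightarrow> S \<subseteq> Poly_Mapping.keys P
      \<Longrightarrow> Q (\<Sum>m\<in>S. Poly_Mapping.single m (Poly_Mapping.lookup P m))" for S
    by (induction S rule: finite_induct) (use assms in auto)
  from this[of "Poly_Mapping.keys P"] show ?thesis
    using poly_sum_single[of "Poly_Mapping.keys P" P] by simp
qed

lemma single_mpower:
  "Poly_Mapping.single m c = pconst c * mpower pvar (m :: 'v \<Rightarrow>\<^sub>0 nat)"
proof -
  have pw: "pvar v ^ k = Poly_Mapping.single (Poly_Mapping.single v k) 1" for v :: 'v and k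
    by (induction k) (auto simp: pvar_def mult_single single_add[symmetric])
  have "finite S \<Longrightarrow> (\<Prod>v\<in>S. Poly_Mapping.single (g v) (1::complex))
      = Poly_Mapping.single (\<Sum>v\<in>S. g v) 1" for S :: "'v set" and g :: "'v \<Rightarrow> 'v \<Rightarrow>\<^sub>0 nat"
    by (induction S rule: finite_induct) (auto simp: mult_single)
  moreover have "(\<Sum>v\<in>Poly_Mapping.keys m. Poly_Mapping.single v (Poly_Mapping.lookup m v)) = m"
    using poly_sum_single[of "Poly_Mapping.keys m" m] by simp
  ultimately have "mpower pvar m = (Poly_Mapping.single m 1 :: 'v cpoly)"
    unfolding mpower_def pw by simp
  then show ?thesis by (simp add: pconst_def mult_single)
qed

lemma pconst_simps [simp]:
  "pconst 0 = 0" "pconst 1 = 1" "pconst (a + b) = pconst a + pconst b"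
  "pconst (a * b) = pconst a * pconst b" "pconst (- a) = - pconst a"
  "pconst (a - b) = pconst a - pconst b"
  by (simp_all add: pconst_def single_add mult_single single_uminus single_diff)

lemma pconst_sum: "pconst (sum f S) = (\<Sum>x\<in>S. pconst (f x))"
  by (induction S rule: infinite_finite_induct) auto

lemma pconst_of_nat: "pconst (of_nat k) = of_nat k"
  by (induction k) auto

lemma lookup_pconst_mult [simp]: "Poly_Mapping.lookup (pconst c * P) k = c * Poly_Mapping.lookup P k"
proof (induction P rule: cpoly_single_induct)
  case (single m d)
  then show ?case by (auto simp: pconst_def mult_single lookup_single when_def)
qed (auto simp: distrib_left lookup_add)

text \<open>\<open>psubst\<close> and \<open>peval\<close> are evaluations along a ring homomorphism
  of the coefficients, namely \<open>pconst\<close> and the identity. Treating both at once gives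
  additivity and multiplicativity for each; \<open>rewrites\<close> identifies the abstract
  \<open>ev\<close> with the two given functions.\<close>

locale coeff_hom =
  fixes \<phi> :: "complex \<Rightarrow> 'b::comm_ring_1"
  assumes add: "\<phi> (a + b) = \<phi> a + \<phi> b" and mult: "\<phi> (a * b) = \<phi> a * \<phi> b" and one: "\<phi> 1 = 1"
begin

lemma zero: "\<phi> 0 = 0"
  using add[of 0 0] by simp

definition ev :: "('v \<Rightarrow> 'b) \<Rightarrow> 'v cpoly \<Rightarrow> 'b" where
  "ev x P = (\<Sum>m\<in>Poly_Mapping.keys P. \<phi> (Poly_Mapping.lookup P m) * mpower x m)"

lemma ev_superset:
  assumes "finite S" "Poly_Mapping.keys P \<subseteq> S"
  shows "ev x P = (\<Sum>m\<in>S. \<phi> (Poly_Mapping.lookup P m) * mpower x m)"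
  unfolding ev_def
  by (rule sum.mono_neutral_left) (use assms in \<open>auto simp: in_keys_iff zero\<close>)

lemma ev_single: "ev x (Poly_Mapping.single m c) = \<phi> c * mpower x m"
  by (simp add: ev_superset[of "{m}"])

lemma ev_0: "ev x 0 = 0"
  by (simp add: ev_def)

lemma ev_add: "ev x (P + Q) = ev x P + ev x Q"
proof -
  let ?S = "Poly_Mapping.keys P \<union> Poly_Mapping.keys Q"
  have "Poly_Mapping.keys (P + Q) \<subseteq> ?S" by (rule Poly_Mapping.keys_add)
  then show ?thesis
    by (simp add: ev_superset[of ?S] lookup_add add distrib_right sum.distrib)
qed

lemma ev_mult: "ev x (P * Q) = ev x P * ev x Q"
proof (induction P rule: cpoly_single_induct)
  case (single m c)
  show ?case
  proof (induction Q rule: cpoly_single_induct)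
    case (single m' c')
    then show ?case by (simp add: mult_single ev_single mpower_add mult mult_ac)
  qed (simp_all add: ev_0 ev_add distrib_left)
qed (simp_all add: ev_0 ev_add distrib_right)

end

interpretation subst: coeff_hom "pconst :: complex \<Rightarrow> 'w cpoly"
  rewrites "coeff_hom.ev (pconst :: complex \<Rightarrow> 'w cpoly) = psubst"
proof -
  show 1: "coeff_hom (pconst :: complex \<Rightarrow> 'w cpoly)" by unfold_locales simp_all
  show "coeff_hom.ev (pconst :: complex \<Rightarrow> 'w cpoly) = psubst"
    by (intro ext) (simp add: coeff_hom.ev_def[OF 1] psubst_def mpower_def)
qed

interpretation eval: coeff_hom "\<lambda>c. c"
  rewrites "coeff_hom.ev (\<lambda>c. c) = peval"
proof -
  show 1: "coeff_hom (\<lambda>c::complex. c)" by unfold_locales simp_all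
  show "coeff_hom.ev (\<lambda>c. c) = peval"
    by (intro ext) (simp add: coeff_hom.ev_def[OF 1] peval_def mpower_def)
qed

lemma psubst_pconst [simp]: "psubst \<sigma> (pconst c) = pconst c"
  using subst.ev_single[of \<sigma> 0 c] by (simp add: pconst_def)

lemma peval_pconst [simp]: "peval x (pconst c) = c"
  by (simp add: pconst_def eval.ev_single)

lemma psubst_pvar [simp]: "psubst \<sigma> (pvar v) = \<sigma> v"
  by (simp add: pvar_def subst.ev_single)

lemma peval_pvar [simp]: "peval x (pvar v) = x v"
  by (simp add: pvar_def eval.ev_single)

lemma psubst_1 [simp]: "psubst \<sigma> 1 = 1"
  using psubst_pconst[of \<sigma> 1] by simp

lemma peval_1 [simp]: "peval x 1 = 1"
  using peval_pconst[of x 1] by simp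

lemmas psubst_hom [simp] = subst.ev_0 subst.ev_add subst.ev_mult
lemmas peval_hom [simp] = eval.ev_0 eval.ev_add eval.ev_mult

lemma psubst_uminus [simp]: "psubst \<sigma> (- P) = - psubst \<sigma> P"
  by (metis add.right_inverse add_eq_0_iff psubst_hom(1,2))

lemma peval_uminus [simp]: "peval x (- P) = - peval x P"
  by (metis add.right_inverse add_eq_0_iff peval_hom(1,2))

lemma psubst_diff [simp]: "psubst \<sigma> (P - Q) = psubst \<sigma> P - psubst \<sigma> Q"
  using psubst_hom(2)[of \<sigma> P "- Q"] by simp

lemma peval_diff [simp]: "peval x (P - Q) = peval x P - peval x Q"
  using peval_hom(2)[of x P "- Q"] by simp

lemma peval_sum: "peval x (sum f S) = (\<Sum>i\<in>S. peval x (f i))"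
  by (induction S rule: infinite_finite_induct) auto

lemma peval_power [simp]: "peval x (P ^ k) = peval x P ^ k"
  by (induction k) auto

lemma peval_of_nat [simp]: "peval x (of_nat k) = of_nat k"
  by (induction k) auto

lemma pvars_subset_iff: "pvars P \<subseteq> V \<longleftrightarrow> (\<forall>m\<in>Poly_Mapping.keys P. Poly_Mapping.keys m \<subseteq> V)"
  by (auto simp: pvars_def)

lemma finite_pvars [simp]: "finite (pvars P)"
  by (simp add: pvars_def)

lemma poly_ring_pconst [simp]: "pconst c \<in> poly_ring V"
  by (auto simp: poly_ring_def pvars_def pconst_def)

lemma poly_ring_pvar: "v \<in> V \<Longrightarrow> pvar v \<in> poly_ring V"
  by (auto simp: poly_ring_def pvars_def pvar_def)

lemma poly_ring_0 [simp]: "0 \<in> poly_ring V"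
  by (auto simp: poly_ring_def pvars_def)

lemma poly_ring_1 [simp]: "1 \<in> poly_ring V"
  using poly_ring_pconst[of 1 V] by simp

lemma poly_ring_add: "P \<in> poly_ring V \<Longrightarrow> Q \<in> poly_ring V \<Longrightarrow> P + Q \<in> poly_ring V"
  using Poly_Mapping.keys_add[of P Q] by (auto simp: poly_ring_def pvars_subset_iff)

lemma poly_ring_mult:
  assumes "P \<in> poly_ring V" "Q \<in> poly_ring V"
  shows "P * Q \<in> poly_ring V"
  unfolding poly_ring_def mem_Collect_eq pvars_subset_iff
proof
  fix m assume "m \<in> Poly_Mapping.keys (P * Q)"
  then obtain a b where "m = a + b" "a \<in> Poly_Mapping.keys P" "b \<in> Poly_Mapping.keys Q"
    using keys_mult[of P Q] by auto
  then show "Poly_Mapping.keys m \<subseteq> V"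
    using assms Poly_Mapping.keys_add[of a b] unfolding poly_ring_def mem_Collect_eq pvars_subset_iff
    by blast
qed

lemma poly_ring_uminus: "P \<in> poly_ring V \<Longrightarrow> - P \<in> poly_ring V"
  using poly_ring_mult[OF poly_ring_pconst[of "-1" V], of P] by simp

lemma poly_ring_diff: "P \<in> poly_ring V \<Longrightarrow> Q \<in> poly_ring V \<Longrightarrow> P - Q \<in> poly_ring V"
  using poly_ring_add[OF _ poly_ring_uminus, of P V Q] by simp

lemma poly_ring_single:
  "Poly_Mapping.keys m \<subseteq> V \<Longrightarrow> Poly_Mapping.single m c \<in> poly_ring V"
  by (auto simp: poly_ring_def pvars_def)

lemma poly_ring_induct [consumes 1, case_names const var add mult]:
  assumes P: "P \<in> poly_ring V"
    and const: "\<And>c. Q (pconst c)"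
    and var: "\<And>v. v \<in> V \<Longrightarrow> Q (pvar v)"
    and add: "\<And>p q. Q p \<Longrightarrow> Q q \<Longrightarrow> Q (p + q)"
    and mult: "\<And>p q. Q p \<Longrightarrow> Q q \<Longrightarrow> Q (p * q)"
  shows "Q P"
proof (induction P rule: cpoly_single_induct)
  case zero
  then show ?case using const[of 0] by simp
next
  case (single m c)
  have 1: "Q 1" using const[of 1] by simp
  have pow: "v \<in> V \<Longrightarrow> Q (pvar v ^ k)" for v k
    by (induction k) (auto intro: 1 var mult)
  have "finite S \<Longrightarrow> S \<subseteq> V \<Longrightarrow> Q (\<Prod>v\<in>S. pvar v ^ Poly_Mapping.lookup m v)" for S
    by (induction S rule: finite_induct) (auto intro: 1 mult pow)
  moreover have "Poly_Mapping.keys m \<subseteq> V"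
    using P single by (auto simp: poly_ring_def pvars_def)
  ultimately show ?case
    unfolding single_mpower mpower_def by (auto intro: mult const)
qed (rule add)

lemma poly_ring_UNIV [simp]: "P \<in> poly_ring UNIV"
  by (simp add: poly_ring_def)

lemma poly_ring_pvars: "P \<in> poly_ring (pvars P)"
  by (simp add: poly_ring_def)

lemma peval_cong:
  assumes "P \<in> poly_ring V" "\<And>v. v \<in> V \<Longrightarrow> x v = y v" shows "peval x P = peval y P"
  using assms by (induction P rule: poly_ring_induct) auto

lemma peval_psubst: "peval x (psubst \<sigma> P) = peval (\<lambda>v. peval x (\<sigma> v)) P"
  using poly_ring_UNIV[of P] by (induction P rule: poly_ring_induct) auto

lemma psubst_psubst: "psubst \<tau> (psubst \<sigma> P) = psubst (\<lambda>v. psubst \<tau> (\<sigma> v)) P"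
  using poly_ring_UNIV[of P] by (induction P rule: poly_ring_induct) auto

lemma psubst_in_poly_ring:
  assumes "P \<in> poly_ring V" "\<And>v. v \<in> V \<Longrightarrow> \<sigma> v \<in> poly_ring V'"
  shows "psubst \<sigma> P \<in> poly_ring V'"
  using assms by (induction P rule: poly_ring_induct) (auto intro: poly_ring_add poly_ring_mult)

subsection \<open>Derivatives and the Taylor expansion\<close>

lemma pderiv_var_superset:
  assumes "finite S" "Poly_Mapping.keys P \<subseteq> S"
  shows "pderiv_var v P = (\<Sum>m\<in>S. Poly_Mapping.single (m - Poly_Mapping.single v 1)
        (of_nat (Poly_Mapping.lookup m v) * Poly_Mapping.lookup P m))"
  unfolding pderiv_var_def
  by (rule sum.mono_neutral_left) (use assms in \<open>auto simp: in_keys_iff\<close>)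

lemma pderiv_var_single:
  "pderiv_var v (Poly_Mapping.single m c) =
     Poly_Mapping.single (m - Poly_Mapping.single v 1) (of_nat (Poly_Mapping.lookup m v) * c)"
  by (simp add: pderiv_var_superset[of "{m}"])

lemma pderiv_var_0 [simp]: "pderiv_var v 0 = 0"
  by (simp add: pderiv_var_def)

lemma pderiv_var_add [simp]: "pderiv_var v (P + Q) = pderiv_var v P + pderiv_var v Q"
proof -
  let ?S = "Poly_Mapping.keys P \<union> Poly_Mapping.keys Q"
  have "Poly_Mapping.keys (P + Q) \<subseteq> ?S" by (rule Poly_Mapping.keys_add)
  then show ?thesis
    by (simp add: pderiv_var_superset[of ?S] lookup_add distrib_left single_add sum.distrib)
qed

lemma pderiv_var_pconst [simp]: "pderiv_var v (pconst c) = 0"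
  by (simp add: pconst_def pderiv_var_single)

lemma pderiv_var_pvar [simp]: "pderiv_var v (pvar w) = (if v = w then 1 else 0)"
  by (auto simp: pvar_def pderiv_var_single lookup_single when_def)

lemma pderiv_var_mult [simp]:
  "pderiv_var v (P * Q) = pderiv_var v P * Q + P * pderiv_var v Q"
proof -
  \<comment> \<open>Subtraction of exponents is truncated, so moving \<open>m'\<close> across it is
    wrong when \<open>v\<close> is absent from \<open>m\<close>; the coefficient is then 0 and both
    sides vanish.\<close>
  have *: "Poly_Mapping.single (m + m' - Poly_Mapping.single v 1) (of_nat (Poly_Mapping.lookup m v) * c)
      = Poly_Mapping.single (m - Poly_Mapping.single v 1 + m') (of_nat (Poly_Mapping.lookup m v) * c)"
    for m m' :: "'a \<Rightarrow>\<^sub>0 nat" and c :: complex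
  proof (cases "Poly_Mapping.lookup m v = 0")
    case False
    have "m + m' - Poly_Mapping.single v 1 = m - Poly_Mapping.single v 1 + m'"
      by (rule poly_mapping_eqI)
        (use False in \<open>auto simp: lookup_add lookup_minus lookup_single when_def\<close>)
    then show ?thesis by simp
  qed simp
  have **: "Poly_Mapping.single (m + m' - Poly_Mapping.single v 1) (of_nat (Poly_Mapping.lookup m' v) * c)
      = Poly_Mapping.single (m + (m' - Poly_Mapping.single v 1)) (of_nat (Poly_Mapping.lookup m' v) * c)"
    for m m' :: "'a \<Rightarrow>\<^sub>0 nat" and c :: complex
    using *[of m' m c] by (simp add: add.commute)
  show ?thesis
  proof (induction P rule: cpoly_single_induct)
    case (single m c)
    show ?case
    proof (induction Q rule: cpoly_single_induct)
      case (single m' c')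
      have "pderiv_var v (Poly_Mapping.single m c * Poly_Mapping.single m' c')
          = Poly_Mapping.single (m + m' - Poly_Mapping.single v 1) (of_nat (Poly_Mapping.lookup m v) * (c * c'))
          + Poly_Mapping.single (m + m' - Poly_Mapping.single v 1) (of_nat (Poly_Mapping.lookup m' v) * (c * c'))"
        by (simp add: mult_single pderiv_var_single lookup_add distrib_right single_add)
      also have "of_nat (Poly_Mapping.lookup m' v) * (c * c') = c * (of_nat (Poly_Mapping.lookup m' v) * c')"
        by simp
      finally show ?case
        using *[of m m' "c * c'"] **[of m m' "c * c'"]
        by (simp add: pderiv_var_single mult_single mult.assoc mult.left_commute)
    qed (simp_all add: algebra_simps)
  qed (simp_all add: algebra_simps)
qed

lemma pderiv_var_sum: "pderiv_var v (sum f S) = (\<Sum>i\<in>S. pderiv_var v (f i))"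
  by (induction S rule: infinite_finite_induct) auto

lemma pderiv_var_not_in: "P \<in> poly_ring V \<Longrightarrow> v \<notin> V \<Longrightarrow> pderiv_var v P = 0"
  by (induction P rule: poly_ring_induct) auto

lemma pderiv_var_in_poly_ring: "P \<in> poly_ring V \<Longrightarrow> pderiv_var v P \<in> poly_ring V"
proof -
  assume "P \<in> poly_ring V"
  then have "P \<in> poly_ring V \<and> pderiv_var v P \<in> poly_ring V"
    by (induction P rule: poly_ring_induct)
      (auto intro: poly_ring_add poly_ring_mult poly_ring_pvar)
  then show ?thesis ..
qed

lemma peval_has_field_derivative:
  assumes "P \<in> poly_ring V" "finite V"
    and "\<And>v. v \<in> V \<Longrightarrow> ((\<lambda>t. x t v) has_field_derivative x' v) (at t)"
  shows "((\<lambda>t. peval (x t) P) has_field_derivative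
           (\<Sum>v\<in>V. peval (x t) (pderiv_var v P) * x' v)) (at t)"
  using assms(1)
proof (induction P rule: poly_ring_induct)
  case (var w)
  have "(\<Sum>v\<in>V. peval (x t) (pderiv_var v (pvar w)) * x' v) = (\<Sum>v\<in>V. if w = v then x' v else 0)"
    by (intro sum.cong) auto
  then show ?case using assms(2,3) var by (simp add: sum.delta)
next
  case (add p q)
  then show ?case using DERIV_add[OF add] by (simp add: distrib_right sum.distrib)
next
  case (mult p q)
  have "(\<Sum>v\<in>V. peval (x t) (pderiv_var v (p * q)) * x' v)
      = (\<Sum>v\<in>V. peval (x t) (pderiv_var v p) * x' v) * peval (x t) q
        + (\<Sum>v\<in>V. peval (x t) (pderiv_var v q) * x' v) * peval (x t) p"
    by (simp add: sum_distrib_left sum_distrib_right sum.distrib[symmetric] algebra_simps)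
  then show ?case using DERIV_mult[OF mult] by simp
qed simp

text \<open>The fully polarized coefficient: a list of variables instead of a monomial, so that each
  position carries its own row index and positions can be permuted independently.\<close>

definition taylor_coeff :: "'v list \<Rightarrow> 'v cpoly \<Rightarrow> complex" where
  "taylor_coeff vs P = peval (\<lambda>_. 0) (fold pderiv_var vs P)"

lemma taylor_coeff_simps [simp]:
  "taylor_coeff [] P = peval (\<lambda>_. 0) P"
  "taylor_coeff (v # vs) P = taylor_coeff vs (pderiv_var v P)"
  by (simp_all add: taylor_coeff_def)

lemma taylor_coeff_add [simp]: "taylor_coeff vs (P + Q) = taylor_coeff vs P + taylor_coeff vs Q"
  by (induction vs arbitrary: P Q) auto

lemma taylor_coeff_0 [simp]: "taylor_coeff vs 0 = 0"
  by (induction vs) auto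

lemma taylor_coeff_not_in:
  "P \<in> poly_ring V \<Longrightarrow> \<not> set vs \<subseteq> V \<Longrightarrow> taylor_coeff vs P = 0"
  by (induction vs arbitrary: P) (auto simp: pderiv_var_not_in intro: pderiv_var_in_poly_ring)

definition mdegree :: "('v \<Rightarrow>\<^sub>0 nat) \<Rightarrow> nat" where
  "mdegree m = (\<Sum>v\<in>Poly_Mapping.keys m. Poly_Mapping.lookup m v)"

lemma mdegree_superset:
  assumes "finite S" "Poly_Mapping.keys m \<subseteq> S"
  shows "mdegree m = (\<Sum>v\<in>S. Poly_Mapping.lookup m v)"
  unfolding mdegree_def
  by (rule sum.mono_neutral_left) (use assms in \<open>auto simp: in_keys_iff\<close>)

lemma mdegree_minus_single:
  assumes "Poly_Mapping.lookup m v \<noteq> 0"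
  shows "Suc (mdegree (m - Poly_Mapping.single v 1)) = mdegree m"
proof -
  have v: "v \<in> Poly_Mapping.keys m" using assms by (simp add: in_keys_iff)
  have "mdegree (m - Poly_Mapping.single v 1)
      = (\<Sum>w\<in>Poly_Mapping.keys m. Poly_Mapping.lookup (m - Poly_Mapping.single v 1) w)"
    by (rule mdegree_superset) (auto simp: in_keys_iff lookup_minus)
  also have "\<dots> = Poly_Mapping.lookup m v - 1
      + (\<Sum>w\<in>Poly_Mapping.keys m - {v}. Poly_Mapping.lookup m w)"
    by (subst sum.remove[OF _ v])
      (auto simp: lookup_minus lookup_single when_def intro!: sum.cong split: if_splits)
  finally show ?thesis
    using assms by (simp add: mdegree_def sum.remove[OF _ v])
qed

definition homogeneous :: "nat \<Rightarrow> 'v cpoly \<Rightarrow> bool" where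
  "homogeneous e P \<longleftrightarrow> (\<forall>m\<in>Poly_Mapping.keys P. mdegree m = e)"

lemma homogeneous_pderiv_var:
  assumes "homogeneous (Suc e) P" shows "homogeneous e (pderiv_var v P)"
  unfolding homogeneous_def
proof
  fix k assume "k \<in> Poly_Mapping.keys (pderiv_var v P)"
  then have "(\<Sum>m\<in>Poly_Mapping.keys P. Poly_Mapping.lookup (Poly_Mapping.single
      (m - Poly_Mapping.single v 1)
      (of_nat (Poly_Mapping.lookup m v) * Poly_Mapping.lookup P m)) k) \<noteq> 0"
    by (simp add: in_keys_iff pderiv_var_def lookup_sum)
  then obtain m where "m \<in> Poly_Mapping.keys P" "Poly_Mapping.lookup m v \<noteq> 0"
    "k = m - Poly_Mapping.single v 1"
    by (rule sum.not_neutral_contains_not_neutral)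
      (auto simp: lookup_single when_def split: if_splits)
  then show "mdegree k = e"
    using assms mdegree_minus_single[of m v] by (auto simp: homogeneous_def)
qed

lemma mdegree_eq_0_iff [simp]: "mdegree m = 0 \<longleftrightarrow> m = 0"
proof
  assume "mdegree m = 0"
  then have "Poly_Mapping.lookup m v = 0" for v
    by (cases "v \<in> Poly_Mapping.keys m") (auto simp: mdegree_def in_keys_iff)
  then show "m = 0" by (auto intro: poly_mapping_eqI)
qed (simp add: mdegree_def)

lemma homogeneous_0_const:
  assumes "homogeneous 0 P" shows "P = pconst (peval x P)"
proof -
  have "P = Poly_Mapping.single 0 (Poly_Mapping.lookup P 0)"
    using poly_sum_single[of "{0}" P] assms by (auto simp: homogeneous_def)
  then show ?thesis by (metis pconst_def peval_pconst)
qed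

lemma peval_0_homogeneous:
  assumes "homogeneous (Suc e) P" shows "peval (\<lambda>_. 0) P = 0"
proof -
  have "mpower (\<lambda>_. 0) m = (0::complex)" if "m \<noteq> 0" for m :: "'a \<Rightarrow>\<^sub>0 nat"
  proof -
    from that obtain v where "v \<in> Poly_Mapping.keys m"
      by (metis mdegree_eq_0_iff mdegree_def sum.empty equals0I)
    then show ?thesis by (auto simp: mpower_def in_keys_iff)
  qed
  moreover have "m \<noteq> 0" if "m \<in> Poly_Mapping.keys P" for m
    using assms that by (metis homogeneous_def mdegree_eq_0_iff nat.distinct(1))
  ultimately show ?thesis
    by (auto simp: eval.ev_def intro!: sum.neutral)
qed

lemma taylor_coeff_homogeneous:
  "homogeneous e P \<Longrightarrow> length vs \<noteq> e \<Longrightarrow> taylor_coeff vs P = 0"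
proof (induction vs arbitrary: e P)
  case Nil
  then show ?case by (cases e) (auto intro: peval_0_homogeneous)
next
  case (Cons v vs)
  show ?case
  proof (cases e)
    case 0
    then have "pderiv_var v P = 0"
      using homogeneous_0_const[of P "\<lambda>_. 0"] Cons.prems(1) pderiv_var_pconst by metis
    then show ?thesis by simp
  next
    case (Suc e')
    then show ?thesis using Cons homogeneous_pderiv_var[of e' P v] by auto
  qed
qed

lemma euler_identity:
  assumes "P \<in> poly_ring V" "finite V" "homogeneous e P"
  shows "(\<Sum>v\<in>V. pvar v * pderiv_var v P) = of_nat e * P"
proof -
  have singles: "(\<Sum>v\<in>V. pvar v * pderiv_var v (Poly_Mapping.single m c)) = of_nat e * Poly_Mapping.single m c"
    if m: "m \<in> Poly_Mapping.keys P" for m c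
  proof -
    have "pvar v * pderiv_var v (Poly_Mapping.single m c)
        = Poly_Mapping.single m (of_nat (Poly_Mapping.lookup m v) * c)" for v
    proof (cases "Poly_Mapping.lookup m v = 0")
      case False
      then have "Poly_Mapping.single v 1 + (m - Poly_Mapping.single v 1) = m"
        by (intro poly_mapping_eqI) (auto simp: lookup_add lookup_minus lookup_single when_def)
      then show ?thesis by (simp add: pvar_def pderiv_var_single mult_single)
    qed (simp add: pderiv_var_single)
    moreover have "(\<Sum>v\<in>V. Poly_Mapping.lookup m v) = e"
      using assms m mdegree_superset[of V m]
      by (auto simp: homogeneous_def poly_ring_def pvars_subset_iff)
    moreover have "of_nat e * Poly_Mapping.single m c = Poly_Mapping.single m (of_nat e * c)"
      by (simp only: single_of_nat[symmetric] mult_single add_0)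
    moreover have "finite S \<Longrightarrow> (\<Sum>v\<in>S. Poly_Mapping.single m (of_nat (Poly_Mapping.lookup m v) * c))
        = Poly_Mapping.single m (of_nat (\<Sum>v\<in>S. Poly_Mapping.lookup m v) * c)" for S
      by (induction S rule: finite_induct) (auto simp: single_add[symmetric] distrib_right)
    ultimately show ?thesis using assms(2) by (simp del: of_nat_sum)
  qed
  show ?thesis
    by (induction P rule: cpoly_single_induct) (simp_all add: singles distrib_left sum.distrib)
qed

lemma sum_lists_Suc:
  assumes "finite V"
  shows "(\<Sum>vs\<in>{vs. set vs \<subseteq> V \<and> length vs = Suc e}. f vs)
       = (\<Sum>v\<in>V. \<Sum>vs\<in>{vs. set vs \<subseteq> V \<and> length vs = e}. f (v # vs))"
proof -
  have "{vs. set vs \<subseteq> V \<and> length vs = Suc e}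
      = (\<lambda>(v, vs). v # vs) ` (V \<times> {vs. set vs \<subseteq> V \<and> length vs = e})"
    by (auto simp: image_iff length_Suc_conv)
  then show ?thesis
    by (simp add: sum.reindex inj_on_def sum.cartesian_product case_prod_unfold)
qed

text \<open>Euler's identity writes \<open>of_nat e * P\<close> as a sum of variables times partial
  derivatives, which are homogeneous of one degree less. The degrees met on the way multiply up to
  e!, and the variables split off form the list \<open>vs\<close>.\<close>

lemma taylor_homogeneous:
  assumes "finite V"
  shows "P \<in> poly_ring V \<Longrightarrow> homogeneous e P \<Longrightarrow>
    pconst (fact e) * P = (\<Sum>vs\<in>{vs. set vs \<subseteq> V \<and> length vs = e}.
        pconst (taylor_coeff vs P) * prod_list (map pvar vs))"
proof (induction e arbitrary: P)
  case 0
  have "{vs. set vs \<subseteq> V \<and> length vs = 0} = {[]}" by auto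
  then show ?case using homogeneous_0_const[OF 0(2), of "\<lambda>_. 0"] by simp
next
  case (Suc e)
  have "pconst (fact (Suc e)) * P = pconst (fact e) * (of_nat (Suc e) * P)"
    by (simp add: pconst_of_nat[symmetric] mult.assoc mult.left_commute del: of_nat_Suc)
  also have "\<dots> = (\<Sum>v\<in>V. pvar v * (pconst (fact e) * pderiv_var v P))"
    unfolding euler_identity[OF Suc.prems(1) assms Suc.prems(2), symmetric]
    by (simp add: sum_distrib_left mult_ac)
  also have "\<dots> = (\<Sum>v\<in>V. pvar v * (\<Sum>vs\<in>{vs. set vs \<subseteq> V \<and> length vs = e}.
        pconst (taylor_coeff vs (pderiv_var v P)) * prod_list (map pvar vs)))"
    by (intro sum.cong refl arg_cong2[where f = "(*)"] Suc.IH)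
      (use Suc.prems in \<open>auto intro: pderiv_var_in_poly_ring homogeneous_pderiv_var\<close>)
  also have "\<dots> = (\<Sum>vs\<in>{vs. set vs \<subseteq> V \<and> length vs = Suc e}.
        pconst (taylor_coeff vs P) * prod_list (map pvar vs))"
    unfolding sum_lists_Suc[OF assms] by (simp add: sum_distrib_left mult_ac)
  finally show ?case .
qed

lemma taylor_expansion:
  assumes "finite V" "P \<in> poly_ring V" "\<And>m. m \<in> Poly_Mapping.keys P \<Longrightarrow> mdegree m \<le> D"
  shows "P = (\<Sum>e\<le>D. pconst (1 / fact e) * (\<Sum>vs\<in>{vs. set vs \<subseteq> V \<and> length vs = e}.
        pconst (taylor_coeff vs P) * prod_list (map pvar vs)))" (is "P = ?T P")
proof (induction P rule: cpoly_single_induct)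
  case (single m c)
  let ?P = "Poly_Mapping.single m c" and ?d = "mdegree m"
  have h: "homogeneous ?d ?P" by (auto simp: homogeneous_def)
  have m: "?P \<in> poly_ring V" "?d \<le> D"
    using single assms by (auto simp: poly_ring_def pvars_subset_iff intro!: poly_ring_single)
  have "?T ?P = (\<Sum>e\<le>D. if e = ?d then ?P else 0)"
  proof (intro sum.cong refl)
    fix e
    show "pconst (1 / fact e) * (\<Sum>vs\<in>{vs. set vs \<subseteq> V \<and> length vs = e}.
        pconst (taylor_coeff vs ?P) * prod_list (map pvar vs)) = (if e = ?d then ?P else 0)"
    proof (cases "e = ?d")
      case True
      have "pconst (1 / fact e) * (pconst (fact e) * ?P) = ?P"
        by (simp add: mult.assoc[symmetric] pconst_simps(4)[symmetric] del: pconst_simps(4))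
      then show ?thesis
        using taylor_homogeneous[OF assms(1) m(1) h] True by simp
    next
      case False
      then show ?thesis
        using taylor_coeff_homogeneous[OF h] by (auto intro!: sum.neutral)
    qed
  qed
  then show ?case using m(2) by simp
next
  case (add p q)
  have "?T (p + q) = ?T p + ?T q"
    by (simp add: distrib_right distrib_left sum.distrib)
  then show ?case using add by simp
qed simp

lemma exists_mdegree_bound: "\<exists>D. \<forall>m\<in>Poly_Mapping.keys P. mdegree m \<le> D"
  by (rule exI[of _ "Max (mdegree ` Poly_Mapping.keys P)"]) auto

text \<open>A polynomial function that vanishes identically has vanishing derivatives, hence vanishing
  Taylor coefficients.\<close>

lemma peval_eq_0_imp:
  assumes "\<And>x. peval x P = 0" shows "P = 0"
proof -
  have d: "peval x (pderiv_var v Q) = 0" if "\<And>x. peval x Q = 0" for Q :: "'a cpoly" and v x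
  proof -
    let ?V = "insert v (pvars Q)"
    have "((\<lambda>t. peval (x(v := t)) Q) has_field_derivative
        (\<Sum>w\<in>?V. peval (x(v := x v)) (pderiv_var w Q) * (if w = v then 1 else 0))) (at (x v))"
      by (rule peval_has_field_derivative) (auto simp: poly_ring_def)
    moreover have "((\<lambda>t. peval (x(v := t)) Q) has_field_derivative 0) (at (x v))"
      using that by simp
    ultimately have "(\<Sum>w\<in>?V. peval (x(v := x v)) (pderiv_var w Q) * (if w = v then 1 else 0)) = 0"
      by (rule DERIV_unique)
    moreover have "(\<Sum>w\<in>?V. peval (x(v := x v)) (pderiv_var w Q) * (if w = v then 1 else 0))
        = (\<Sum>w\<in>?V. if w = v then peval x (pderiv_var w Q) else 0)"
      by (intro sum.cong) auto
    ultimately show ?thesis by simp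
  qed
  have "taylor_coeff vs P = 0" for vs
    using assms by (induction vs arbitrary: P) (auto intro: d)
  moreover obtain D where "\<And>m. m \<in> Poly_Mapping.keys P \<Longrightarrow> mdegree m \<le> D"
    using exists_mdegree_bound by metis
  ultimately show ?thesis
    using taylor_expansion[OF finite_pvars poly_ring_pvars, of P D] by simp
qed

text \<open>Points with finite support are the jets of polynomial curves, at which reparametrization
  invariance is tested below. They suffice because a polynomial involves finitely many
  variables.\<close>

lemma peval_ext_finite:
  assumes "\<And>x. finite {v. x v \<noteq> 0} \<Longrightarrow> peval x P = peval x Q" shows "P = Q"
proof -
  have "peval x (P - Q) = 0" for x
  proof -
    let ?V = "pvars P \<union> pvars Q"
    let ?y = "\<lambda>v. if v \<in> ?V then x v else 0"
    have "peval x R = peval ?y R" if "R \<in> {P, Q}" for R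
      by (rule peval_cong[of _ "?V"]) (use that in \<open>auto simp: poly_ring_def\<close>)
    moreover have "finite {v. ?y v \<noteq> 0}"
      by (rule finite_subset[of _ ?V]) auto
    ultimately show ?thesis using assms[of ?y] by simp
  qed
  from peval_eq_0_imp[OF this] show ?thesis by simp
qed

section \<open>Tensors invariant under the unipotent group\<close>

definition subalgebra :: "'v cpoly set \<Rightarrow> bool" where
  "subalgebra A \<longleftrightarrow> (\<forall>c. pconst c \<in> A) \<and> (\<forall>p\<in>A. \<forall>q\<in>A. p + q \<in> A \<and> p * q \<in> A)"

lemma subalgebra_closed:
  assumes "subalgebra A"
  shows "pconst c \<in> A" "0 \<in> A" "1 \<in> A" "p \<in> A \<Longrightarrow> q \<in> A \<Longrightarrow> p + q \<in> A"
    "p \<in> A \<Longrightarrow> q \<in> A \<Longrightarrow> p * q \<in> A" "p \<in> A \<Longrightarrow> - p \<in> A"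
    "p \<in> A \<Longrightarrow> q \<in> A \<Longrightarrow> p - q \<in> A" "p \<in> A \<Longrightarrow> p ^ k \<in> A"
proof -
  show c: "pconst c \<in> A" for c using assms by (simp add: subalgebra_def)
  show "0 \<in> A" "1 \<in> A" using c[of 0] c[of 1] by simp_all
  show m: "p * q \<in> A" if "p \<in> A" "q \<in> A" for p q using assms that by (simp add: subalgebra_def)
  show a: "p + q \<in> A" if "p \<in> A" "q \<in> A" for p q using assms that by (simp add: subalgebra_def)
  show u: "- p \<in> A" if "p \<in> A" for p using m[OF c[of "-1"] that] by simp
  show "p - q \<in> A" if "p \<in> A" "q \<in> A" using a[OF that(1) u[OF that(2)]] by simp
  show "p ^ k \<in> A" if "p \<in> A" using that \<open>1 \<in> A\<close> by (induction k) (auto intro: m)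
qed

lemma subalgebra_sum: "subalgebra A \<Longrightarrow> (\<And>i. i \<in> S \<Longrightarrow> f i \<in> A) \<Longrightarrow> sum f S \<in> A"
  by (induction S rule: infinite_finite_induct) (auto intro: subalgebra_closed)

text \<open>A word \<open>w\<close> stands for the basis tensor \<open>e\<^bsub>w ! 0\<^esub> \<otimes> e\<^bsub>w ! 1\<^esub> \<otimes> \<dots>\<close>. The operator below is
  the action of the elementary matrix that maps \<open>e\<^bsub>i + 1\<^esub>\<close> to \<open>e\<^sub>i\<close>.\<close>

definition raise :: "nat \<Rightarrow> (nat list \<Rightarrow> complex) \<Rightarrow> nat list \<Rightarrow> complex" where
  "raise i F w = (\<Sum>q | q < length w \<and> w ! q = i. F (w[q := Suc i]))"

lemma raise_Cons:
  "raise i F (a # w) = (if a = i then F (Suc i # w) else 0) + raise i (\<lambda>v. F (a # v)) w"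
proof -
  have eq: "{q. q < length (a # w) \<and> (a # w) ! q = i}
      = (if a = i then {0} else {}) \<union> Suc ` {q. q < length w \<and> w ! q = i}"
    by (auto simp: less_Suc_eq_0_disj)
  then show ?thesis
    unfolding raise_def by (subst eq, subst sum.union_disjoint) (auto simp: sum.reindex)
qed

lemma raise_linear:
  "raise i (\<lambda>v. F v + c * G v) w = raise i F w + c * raise i G w"
  by (simp add: raise_def sum.distrib sum_distrib_left)

lemma raise_cong:
  assumes "\<And>v. length v = length w \<Longrightarrow> F v = G v" shows "raise i F w = raise i G w"
  using assms by (simp add: raise_def)

lemma raise_pow_cong:
  assumes "\<And>v. length v = length w \<Longrightarrow> F v = G v"
  shows "(raise i ^^ j) F w = (raise i ^^ j) G w"
  using assms
proof (induction j arbitrary: w)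
  case (Suc j)
  then show ?case by (auto intro!: raise_cong)
qed simp

lemma raise_pow_0: "(raise i ^^ j) (\<lambda>_. 0) w = 0"
proof (induction j arbitrary: w)
  case (Suc j)
  then show ?case by (simp add: raise_def)
qed simp

text \<open>\<open>raise i\<close> is a derivation of the tensor product whose square is zero on a
  single factor. In the Leibniz formula for its \<open>j\<close>-th power only the terms with at
  most one application to the first letter survive, hence the factor \<open>j\<close>.\<close>

lemma raise_pow_Cons:
  "(raise i ^^ j) F (a # w) = (raise i ^^ j) (\<lambda>v. F (a # v)) w
     + (if a = i then of_nat j * (raise i ^^ (j - 1)) (\<lambda>v. F (Suc i # v)) w else 0)"
proof (induction j arbitrary: a w)
  case (Suc j)
  let ?G = "(raise i ^^ j) F"
  have "(raise i ^^ Suc j) F (a # w)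
      = (if a = i then ?G (Suc i # w) else 0) + raise i (\<lambda>v. ?G (a # v)) w"
    by (simp add: raise_Cons)
  also have "(\<lambda>v. ?G (a # v)) = (\<lambda>v. (raise i ^^ j) (\<lambda>v. F (a # v)) v
     + (if a = i then of_nat j else 0) * (raise i ^^ (j - 1)) (\<lambda>v. F (Suc i # v)) v)"
    using Suc by auto
  also have "raise i \<dots> w = (raise i ^^ Suc j) (\<lambda>v. F (a # v)) w
     + (if a = i then of_nat j else 0) * raise i ((raise i ^^ (j - 1)) (\<lambda>v. F (Suc i # v))) w"
    by (simp only: raise_linear) simp
  also have "?G (Suc i # w) = (raise i ^^ j) (\<lambda>v. F (Suc i # v)) w"
    using Suc[of "Suc i" w] by simp
  finally show ?case
    by (cases j) (auto simp: algebra_simps)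
qed simp

text \<open>For \<open>h = 0\<close> the conclusion says that the least word in the support of a tensor killed by
  \<open>raise i\<close> is a ballot sequence in the letters \<open>i\<close> and \<open>i + 1\<close>; general \<open>h\<close> makes the
  induction on the length of the words work.\<close>

lemma least_word_ballot:
  assumes "\<And>w. length w = N \<Longrightarrow> (raise i ^^ Suc h) F w = 0"
    and "length w0 = N" "F w0 \<noteq> 0" "\<And>v. length v = N \<Longrightarrow> F v \<noteq> 0 \<Longrightarrow> w0 \<le> v"
  shows "count_list (take k w0) (Suc i) \<le> count_list (take k w0) i + h"
  using assms
proof (induction N arbitrary: F h w0 k)
  case (Suc N)
  obtain a w where w0: "w0 = a # w" "length w = N"
    using Suc.prems(2) by (cases w0) auto
  show ?case
  proof (cases k)
    case (Suc k')
    let ?F = "\<lambda>b v. F (b # v)"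
    have Fw: "?F a w \<noteq> 0" and least: "\<And>v. length v = N \<Longrightarrow> ?F a v \<noteq> 0 \<Longrightarrow> w \<le> v"
      using Suc.prems(3) Suc.prems(4)[of "a # _"] w0 by auto
    have low: "?F b v = 0" if "b < a" "length v = N" for b v
      using Suc.prems(4)[of "b # v"] that w0 by force
    have kill: "(raise i ^^ Suc h) F (b # v) = 0" if "length v = N" for b v
      using Suc.prems(1) that by simp
    have IH: "count_list (take k' w) (Suc i) \<le> count_list (take k' w) i + j"
      if "\<And>v. length v = N \<Longrightarrow> (raise i ^^ Suc j) (?F a) v = 0" for j
      by (rule Suc.IH[OF that w0(2) Fw least])
    consider "a = i" | "a = Suc i" | "a \<noteq> i" "a \<noteq> Suc i" by blast
    then show ?thesis
    proof cases
      case 1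
      \<comment> \<open>A leading \<open>i\<close> is a credit for one more \<open>Suc i\<close>.
        The part of \<open>F\<close> with first letter \<open>Suc i\<close> dies under the power
        \<open>Suc h\<close>, which removes the extra term from the power \<open>Suc (Suc h)\<close>
        at \<open>i\<close>; the induction continues with \<open>Suc h\<close>.\<close>
      have F1: "(raise i ^^ Suc h) (?F (Suc i)) v = 0" if "length v = N" for v
        using kill[OF that, of "Suc i"] by (simp add: raise_pow_Cons del: funpow.simps)
      have F2: "(raise i ^^ Suc (Suc h)) F (i # v) = 0" if "length v = N" for v
      proof -
        have "(raise i ^^ Suc (Suc h)) F (i # v) = raise i ((raise i ^^ Suc h) F) (i # v)"
          by simp
        also have "\<dots> = raise i (\<lambda>_. 0) (i # v)"
          by (rule raise_cong) (use Suc.prems(1) that in auto)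
        finally show ?thesis by (simp add: raise_def)
      qed
      have "(raise i ^^ Suc (Suc h)) (?F i) v = 0" if "length v = N" for v
        using F1[OF that] F2[OF that] by (simp add: raise_pow_Cons del: funpow.simps)
      then have "count_list (take k' w) (Suc i) \<le> count_list (take k' w) i + Suc h"
        using IH[of "Suc h"] 1 by blast
      then show ?thesis using 1 w0 Suc by simp
    next
      case 2
      \<comment> \<open>A leading \<open>Suc i\<close> uses up one unit of \<open>h\<close>. By
        minimality the part of \<open>F\<close> with first letter \<open>i\<close> is zero, so at
        the words \<open>i # v\<close> only the extra term is left, and its factor
        \<open>Suc h\<close> is nonzero.\<close>
      have "(raise i ^^ h) (?F (Suc i)) v = 0" if "length v = N" for v
      proof -
        have "(raise i ^^ Suc h) (?F i) v = (raise i ^^ Suc h) (\<lambda>_. 0) v"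
          by (rule raise_pow_cong) (use low 2 that in auto)
        then have "(raise i ^^ Suc h) (?F i) v = 0" by (simp only: raise_pow_0)
        then have "of_nat (Suc h) * (raise i ^^ h) (?F (Suc i)) v = 0"
          using kill[OF that, of i] by (simp add: raise_pow_Cons del: funpow.simps of_nat_Suc)
        then show ?thesis by (simp del: of_nat_Suc)
      qed
      note z = this
      \<comment> \<open>For \<open>h = 0\<close> the power is the identity, and \<open>F\<close>
        itself would vanish at \<open>w0\<close>.\<close>
      then obtain h' where h: "h = Suc h'"
        using Fw w0 2 by (cases h) auto
      have "count_list (take k' w) (Suc i) \<le> count_list (take k' w) i + h'"
        by (rule IH[of h']) (use z 2 h in auto)
      then show ?thesis using 2 w0 Suc h by simp
    next
      case 3
      have "(raise i ^^ Suc h) (?F a) v = 0" if "length v = N" for v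
        using kill[OF that, of a] 3 by (simp add: raise_pow_Cons del: funpow.simps)
      then have "count_list (take k' w) (Suc i) \<le> count_list (take k' w) i + h"
        using IH[of h] by blast
      then show ?thesis using 3 w0 Suc by simp
    qed
  qed simp
qed simp

section \<open>Ballot sequences as standard tableaux\<close>

definition lattice_word :: "nat list \<Rightarrow> bool" where
  "lattice_word w \<longleftrightarrow> (\<forall>i k. count_list (take k w) (Suc i) \<le> count_list (take k w) i)"

text \<open>A lattice word encodes a standard tableau: position \<open>q\<close> is the entry in row \<open>w ! q\<close> and
  column \<open>wcol w q\<close>.\<close>

definition wcol :: "nat list \<Rightarrow> nat \<Rightarrow> nat" where
  "wcol w q = count_list (take q w) (w ! q)"

lemma count_list_take_Suc:
  "q < length w \<Longrightarrow>
    count_list (take (Suc q) w) a = count_list (take q w) a + (if w ! q = a then 1 else 0)"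
  by (simp add: take_Suc_conv_app_nth)

lemma count_list_take_mono: "k \<le> k' \<Longrightarrow> count_list (take k w) a \<le> count_list (take k' w) a"
  by (metis count_list_append le_add1 min.absorb1 take_add le_add_diff_inverse)

lemma exists_position:
  assumes "m < count_list (take k w) a"
  obtains y where "y < k" "y < length w" "w ! y = a" "wcol w y = m"
proof -
  have "\<exists>y<k. y < length w \<and> w ! y = a \<and> wcol w y = m"
    using assms
  proof (induction k)
    case (Suc k)
    show ?case
    proof (cases "k < length w \<and> w ! k = a \<and> count_list (take k w) a = m")
      case True
      then show ?thesis by (auto simp: wcol_def)
    next
      case False
      then have "m < count_list (take k w) a"
        using Suc.prems by (cases "k < length w") (auto simp: count_list_take_Suc split: if_splits)
      then show ?thesis using Suc.IH by (auto intro: less_SucI)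
    qed
  qed simp
  then show ?thesis using that by blast
qed

lemma wcol_less:
  assumes "q < q'" "q' < length w" "w ! q = w ! q'" shows "wcol w q < wcol w q'"
proof -
  have "wcol w q < count_list (take (Suc q) w) (w ! q)"
    using assms by (simp add: wcol_def count_list_take_Suc)
  also have "\<dots> \<le> wcol w q'"
    unfolding wcol_def assms(3) by (rule count_list_take_mono) (use assms in auto)
  finally show ?thesis .
qed

lemma letter_wcol_inj:
  assumes "q < length w" "q' < length w" "w ! q = w ! q'" "wcol w q = wcol w q'"
  shows "q = q'"
  using wcol_less[of q q' w] wcol_less[of q' q w] assms by (cases q q' rule: linorder_cases) auto

lemma lattice_word_antimono:
  assumes "lattice_word w" "a \<le> b" shows "count_list (take k w) b \<le> count_list (take k w) a"
  using assms(2)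
proof (induction b rule: dec_induct)
  case (step b)
  then show ?case using assms(1) unfolding lattice_word_def by (meson le_trans)
qed simp

text \<open>Columns have no gaps: the prefix ending at \<open>y\<close> contains
  \<open>wcol w y + 1\<close> copies of the letter at \<open>y\<close>, and by the ballot condition
  at least as many of each smaller letter.\<close>

lemma lattice_word_above:
  assumes "lattice_word w" "y < length w" "a \<le> w ! y"
  obtains y' where "y' < length w" "w ! y' = a" "wcol w y' = wcol w y"
proof -
  have "wcol w y < count_list (take (Suc y) w) (w ! y)"
    using assms by (simp add: wcol_def count_list_take_Suc)
  also have "\<dots> \<le> count_list (take (Suc y) w) a"
    using assms by (intro lattice_word_antimono)
  finally show ?thesis using that by (elim exists_position) auto
qed

text \<open>Columns increase downwards: if the upper cell came later, the prefix before it would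
  contain more copies of the larger letter than of the smaller one.\<close>

lemma lattice_word_order:
  assumes "lattice_word w" "q < length w" "q'' < length w" "wcol w q'' = wcol w q" "w ! q'' < w ! q"
  shows "q'' < q"
proof (rule ccontr)
  assume "\<not> q'' < q"
  then have "Suc q \<le> q''" using assms(5) by (cases "q = q''") auto
  then have "wcol w q < count_list (take q'' w) (w ! q)"
    using count_list_take_mono[of "Suc q" q'' w "w ! q"] assms(2)
    by (simp add: wcol_def count_list_take_Suc)
  also have "\<dots> \<le> count_list (take q'' w) (w ! q'')"
    using assms by (intro lattice_word_antimono) auto
  finally show False using assms(4) by (simp add: wcol_def)
qed

section \<open>Column antisymmetrizers\<close>

definition column_group :: "nat list \<Rightarrow> (nat \<Rightarrow> nat) set" where
  "column_group w = {\<tau>. \<tau> permutes {..<length w} \<and> (\<forall>q<length w. wcol w (\<tau> q) = wcol w q)}"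

definition permute_word :: "nat list \<Rightarrow> (nat \<Rightarrow> nat) \<Rightarrow> nat list" where
  "permute_word w \<tau> = map (\<lambda>q. w ! \<tau> q) [0..<length w]"

text \<open>The column antisymmetrizer of the tableau applied to the basis tensor of
  \<open>w\<close>. For a lattice word it is, up to the order of the tensor factors, a product of
  wedges of the first basis vectors, one for each column.\<close>

definition column_sym :: "nat list \<Rightarrow> nat list \<Rightarrow> complex" where
  "column_sym w v = (\<Sum>\<tau>\<in>column_group w. if v = permute_word w \<tau> then of_int (sign \<tau>) else 0)"

lemma length_permute_word [simp]: "length (permute_word w \<tau>) = length w"
  by (simp add: permute_word_def)

lemma nth_permute_word [simp]: "q < length w \<Longrightarrow> permute_word w \<tau> ! q = w ! \<tau> q"
  by (simp add: permute_word_def)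

lemma finite_column_group [simp]: "finite (column_group w)"
  by (rule finite_subset[OF _ finite_permutations[of "{..<length w}"]])
    (auto simp: column_group_def)

lemma column_group_less: "\<tau> \<in> column_group w \<Longrightarrow> q < length w \<Longrightarrow> \<tau> q < length w"
  by (auto simp: column_group_def dest: permutes_in_image)

text \<open>Within a column the letters are pairwise distinct, so the words of the antisymmetrizer
  do not collide. Its coefficient at \<open>w\<close> is therefore 1, and subtracting a multiple of
  it can remove \<open>w\<close>.\<close>

lemma permute_word_inj:
  assumes "\<tau> \<in> column_group w" "\<tau>' \<in> column_group w" "permute_word w \<tau> = permute_word w \<tau>'"
  shows "\<tau> = \<tau>'"
proof
  fix q
  show "\<tau> q = \<tau>' q"
  proof (cases "q < length w")
    case True
    then have "w ! \<tau> q = w ! \<tau>' q" using assms(3) by (metis nth_permute_word)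
    then show ?thesis
      using True assms(1,2) column_group_less[OF assms(1) True] column_group_less[OF assms(2) True]
      by - (rule letter_wcol_inj[of _ w], auto simp: column_group_def)
  next
    case False
    then show ?thesis using assms(1,2) by (auto simp: column_group_def permutes_def)
  qed
qed

lemma id_in_column_group [simp]: "id \<in> column_group w"
  by (simp add: column_group_def permutes_id)

lemma permute_word_id [simp]: "permute_word w id = w"
  by (rule nth_equalityI) auto

lemma column_sym_self [simp]: "column_sym w w = 1"
proof -
  have "column_sym w w = (\<Sum>\<tau>\<in>column_group w. if \<tau> = id then 1 else 0)"
    unfolding column_sym_def
    by (intro sum.cong refl) (metis permute_word_inj id_in_column_group permute_word_id of_int_1 sign_id)
  then show ?thesis by simp
qed

lemma column_symE:
  assumes "column_sym w v \<noteq> 0"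
  obtains \<tau> where "\<tau> \<in> column_group w" "v = permute_word w \<tau>"
  using assms[unfolded column_sym_def]
  by (elim sum.not_neutral_contains_not_neutral) (auto split: if_splits)

lemma word_le_first_difference:
  assumes "length v = length w" "q < length w" "\<And>k. k < q \<Longrightarrow> w ! k = v ! k" "w ! q < v ! q"
  shows "w \<le> (v :: nat list)"
  using assms
proof (induction v w arbitrary: q rule: list_induct2)
  case (Cons y ys x xs)
  show ?case
  proof (cases q)
    case (Suc q')
    have "x = y" using Cons.prems(2)[of 0] Suc by simp
    moreover have "xs \<le> ys"
      using Cons.prems(1) Cons.prems(2)[of "Suc _"] Cons.prems(3) Suc by (intro Cons.IH[of q']) auto
    ultimately show ?thesis by simp
  qed (use Cons in simp)
qed simp

text \<open>Before the first changed letter every position is fixed, since a letter and a column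
  determine a position. A smaller letter at the first change would come from an earlier position of
  the same column, which is already the image of itself.\<close>

lemma permute_word_ge:
  assumes "lattice_word w" "\<tau> \<in> column_group w"
  shows "w \<le> permute_word w \<tau>"
proof (cases "permute_word w \<tau> = w")
  case False
  define q where "q = (LEAST q. q < length w \<and> w ! \<tau> q \<noteq> w ! q)"
  have "\<exists>q. q < length w \<and> w ! \<tau> q \<noteq> w ! q"
    using False by (metis nth_equalityI length_permute_word nth_permute_word)
  from LeastI_ex[OF this] have q: "q < length w" "w ! \<tau> q \<noteq> w ! q" by (auto simp: q_def)
  have eq: "w ! \<tau> k = w ! k" if "k < q" for k
    using not_less_Least[of k "\<lambda>q. q < length w \<and> w ! \<tau> q \<noteq> w ! q"] that q(1)
    by (auto simp: q_def[symmetric])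
  have fixed: "\<tau> k = k" if "k < q" for k
    using that q(1) eq[OF that] assms(2) column_group_less[OF assms(2), of k]
    by - (rule letter_wcol_inj[of _ w], auto simp: column_group_def)
  have inj: "inj \<tau>" using assms(2) by (auto simp: column_group_def permutes_inj)
  have "\<not> w ! \<tau> q < w ! q"
  proof
    assume "w ! \<tau> q < w ! q"
    then have "\<tau> q < q"
      using assms q column_group_less[OF assms(2) q(1)]
      by - (rule lattice_word_order[of w], auto simp: column_group_def)
    then show False using fixed[of "\<tau> q"] inj by (metis injD less_irrefl)
  qed
  then show ?thesis
    using q eq by (intro word_le_first_difference[of _ _ q]) auto
qed simp

lemma column_group_transpose:
  assumes "\<tau> \<in> column_group w" "q < length w" "q' < length w" "wcol w q = wcol w q'"
  shows "\<tau> \<circ> Transposition.transpose q q' \<in> column_group w"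
  using assms unfolding column_group_def
  by (auto intro!: permutes_compose permutes_swap_id simp: Transposition.transpose_def)

text \<open>Interchanging the values of \<open>\<tau>\<close> at the two positions of a column that carry the letters
  \<open>i\<close> and \<open>i + 1\<close> is a sign reversing involution on the terms of the sum.\<close>

lemma raise_column_sym:
  assumes "lattice_word w" shows "raise i (column_sym w) v = 0"
proof -
  define X where "X = {(q, \<tau>). q < length v \<and> v ! q = i \<and> \<tau> \<in> column_group w \<and>
    v[q := Suc i] = permute_word w \<tau>}"
  define partner where "partner q \<tau> = (THE q'. q' < length w \<and> w ! \<tau> q' = i \<and> wcol w q' = wcol w q)"
    for q \<tau>
  have fin: "finite X"
    by (rule finite_subset[of _ "{..<length v} \<times> column_group w"]) (auto simp: X_def)
  have uniq: "q' = q''" if "\<tau> \<in> column_group w" "q' < length w" "q'' < length w"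
    "w ! \<tau> q' = w ! \<tau> q''" "wcol w q' = wcol w q''" for q' q'' \<tau>
  proof -
    have "\<tau> q' = \<tau> q''"
      by (rule letter_wcol_inj[of _ w]) (use that column_group_less in \<open>auto simp: column_group_def\<close>)
    moreover have "inj \<tau>" using that(1) by (auto simp: column_group_def permutes_inj)
    ultimately show ?thesis by (simp add: injD)
  qed
  have partnerI: "partner q \<tau> = q'" if "\<tau> \<in> column_group w" "q' < length w" "w ! \<tau> q' = i"
    "wcol w q' = wcol w q" for q q' \<tau>
    unfolding partner_def using that by (intro the_equality) (auto intro: uniq[of \<tau>])
  have main: "(partner q \<tau>, \<tau> \<circ> Transposition.transpose q (partner q \<tau>)) \<in> X \<and>
      partner (partner q \<tau>) (\<tau> \<circ> Transposition.transpose q (partner q \<tau>)) = q \<and>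
      sign (\<tau> \<circ> Transposition.transpose q (partner q \<tau>)) = - sign \<tau>" if "(q, \<tau>) \<in> X" for q \<tau>
  proof -
    from that have q: "q < length v" "v ! q = i" "\<tau> \<in> column_group w"
      and eq: "v[q := Suc i] = permute_word w \<tau>" by (auto simp: X_def)
    have len: "length v = length w" using arg_cong[OF eq, of length] by simp
    have nth: "w ! \<tau> k = (if k = q then Suc i else v ! k)" if "k < length w" for k
      using arg_cong[OF eq, of "\<lambda>u. u ! k"] that len q by (auto simp: nth_list_update split: if_splits)
    have \<tau>: "\<tau> permutes {..<length w}" and colq: "wcol w (\<tau> k) = wcol w k" if "k < length w" for k
      using q(3) that by (auto simp: column_group_def)
    have perm: "\<tau> permutes {..<length w}" using q(3) by (auto simp: column_group_def)
    have ql: "q < length w" using q len by simp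
    \<comment> \<open>The raised position \<open>q\<close> receives the letter \<open>Suc i\<close>
      from \<tau> \<open>q\<close>. As columns have no gaps, the cell directly above \<tau>
      \<open>q\<close> carries \<open>i\<close>; its preimage under \<tau> is the partner of
      \<open>q\<close>.\<close>
    obtain y where y: "y < length w" "w ! y = i" "wcol w y = wcol w q"
      using lattice_word_above[OF assms column_group_less[OF q(3) ql], of i] nth[OF ql] colq[OF ql]
      by auto
    obtain q' where \<tau>q': "y = \<tau> q'" "q' < length w"
      using y(1) permutes_image[OF perm] by (metis imageE lessThan_iff)
    have q': "w ! \<tau> q' = i" "wcol w q' = wcol w q" using y \<tau>q' colq by auto
    have p: "partner q \<tau> = q'" using q' \<tau>q' q by (intro partnerI) auto
    have ne: "q' \<noteq> q" using q' nth[OF ql] by auto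
    let ?t = "\<tau> \<circ> Transposition.transpose q q'"
    have t: "?t \<in> column_group w"
      using q ql \<tau>q' q' by (intro column_group_transpose) auto
    have "v[q' := Suc i] = permute_word w ?t"
    proof (rule nth_equalityI)
      fix k assume "k < length (v[q' := Suc i])"
      then have k: "k < length w" using len by simp
      then show "v[q' := Suc i] ! k = permute_word w ?t ! k"
        using nth[OF k] nth[OF ql] nth[OF \<tau>q'(2)] q' q ne len
        by (auto simp: nth_list_update Transposition.transpose_def split: if_splits)
    qed (use len in simp)
    moreover have "v ! q' = i" using nth[OF \<tau>q'(2)] ne q' by simp
    ultimately have X: "(q', ?t) \<in> X" using t \<tau>q' len by (simp add: X_def)
    have "partner q' ?t = q"
      using t ql q' by (intro partnerI) (auto simp: Transposition.transpose_def)
    moreover have "sign ?t = - sign \<tau>"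
      using ne perm permutes_imp_permutation[of "{..<length w}" \<tau>]
      by (subst sign_compose) (auto simp: sign_swap_id permutation_swap_id)
    ultimately show ?thesis using X p by simp
  qed
  define s where "s = (\<Sum>(q, \<tau>)\<in>X. complex_of_int (sign \<tau>))"
  have "raise i (column_sym w) v = s"
  proof -
    have "raise i (column_sym w) v = (\<Sum>(q, \<tau>)\<in>{q. q < length v \<and> v ! q = i} \<times> column_group w.
        if v[q := Suc i] = permute_word w \<tau> then of_int (sign \<tau>) else 0)"
      by (simp add: raise_def column_sym_def sum.cartesian_product)
    also have "\<dots> = (\<Sum>(q, \<tau>)\<in>X. of_int (sign \<tau>))"
      by (rule sum.mono_neutral_cong_right) (auto simp: X_def split: if_splits)
    finally show ?thesis by (simp add: s_def)
  qed
  moreover have "s = (\<Sum>(q, \<tau>)\<in>X. - of_int (sign \<tau>))"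
  proof -
    let ?j = "\<lambda>(q, \<tau>). (partner q \<tau>, \<tau> \<circ> Transposition.transpose q (partner q \<tau>))"
    have "?j (?j x) = x \<and> ?j x \<in> X" if "x \<in> X" for x
    proof -
      obtain q \<tau> where x: "x = (q, \<tau>)" by (cases x)
      show ?thesis using main[of q \<tau>] that by (auto simp: x Transposition.transpose_commute comp_assoc)
    qed
    then show ?thesis
      unfolding s_def using main by (intro sum.reindex_bij_witness[of X ?j ?j]) force+
  qed
  then have "s = - s" by (simp add: s_def sum_negf case_prod_unfold)
  then have "2 * s = 0" by (simp only: mult_2 eq_neg_iff_add_eq_0)
  ultimately show ?thesis by simp
qed

section \<open>The first fundamental theorem for the unipotent group\<close>

lemma permutes_restrict_image:
  assumes "\<tau> permutes S" "finite S" "Q \<subseteq> S" "\<And>q. q \<in> Q \<Longrightarrow> \<tau> q \<in> Q"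
  shows "(\<lambda>q. if q \<in> Q then \<tau> q else q) permutes Q"
proof (rule bij_imp_permutes)
  have "inj_on \<tau> Q" using assms(1) permutes_inj inj_on_subset by blast
  moreover from this have "\<tau> ` Q = Q"
    using assms by (intro endo_inj_surj) (auto intro: finite_subset)
  ultimately show "bij_betw (\<lambda>q. if q \<in> Q then \<tau> q else q) Q Q"
    by (subst bij_betw_cong[of _ _ \<tau>]) (auto simp: bij_betw_def)
qed auto

text \<open>With \<open>C\<close> all permutations of \<open>Q\<close> this is the Leibniz formula
  of a determinant indexed by \<open>Q\<close>; with \<open>C\<close> the column group of a tableau
  it is a product of such determinants.\<close>

definition alternating_sum :: "('a \<Rightarrow> 'a) set \<Rightarrow> 'a set \<Rightarrow> ('a \<Rightarrow> 'a \<Rightarrow> 'b::comm_ring_1) \<Rightarrow> 'b" where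
  "alternating_sum C Q G = (\<Sum>\<tau>\<in>C. of_int (sign \<tau>) * (\<Prod>q\<in>Q. G (\<tau> q) q))"

text \<open>The permutations preserving \<open>col\<close> form the direct product of the symmetric
  groups of the blocks, and both the sign and the product over positions split accordingly. The
  induction adds the blocks in the order of \<open>col\<close>.\<close>

lemma alternating_sum_blocks:
  fixes col :: "'a \<Rightarrow> nat" and G :: "'a \<Rightarrow> 'a \<Rightarrow> 'v cpoly"
  assumes A: "subalgebra A" and fin: "finite Q"
    and blocks: "\<And>m. alternating_sum {\<tau>. \<tau> permutes {q\<in>Q. col q = m}} {q\<in>Q. col q = m} G \<in> A"
  shows "alternating_sum {\<tau>. \<tau> permutes Q \<and> (\<forall>q\<in>Q. col (\<tau> q) = col q)} Q G \<in> A"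
proof -
  define R where "R K = {q\<in>Q. col q < K}" for K
  define C where "C K = {\<tau>. \<tau> permutes R K \<and> (\<forall>q\<in>R K. col (\<tau> q) = col q)}" for K
  have in_A: "alternating_sum (C K) (R K) G \<in> A" for K
  proof (induction K)
    case 0
    have "C 0 = {id}" "R 0 = {}" by (auto simp: C_def R_def)
    then show ?case using subalgebra_closed(3)[OF A] by (simp add: alternating_sum_def)
  next
    case (Suc K)
    define B where "B = {q\<in>Q. col q = K}"
    have R: "R (Suc K) = R K \<union> B" "R K \<inter> B = {}" by (auto simp: R_def B_def)
    have finR: "finite (R K)" "finite B" "finite (R (Suc K))" using fin by (auto simp: R_def B_def)
    let ?i = "\<lambda>(\<sigma>, \<rho>). \<sigma> \<circ> \<rho>"
    let ?j = "\<lambda>\<tau>. (\<lambda>q. if q \<in> R K then \<tau> q else q, \<lambda>q. if q \<in> B then \<tau> q else q)"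
    have "alternating_sum (C (Suc K)) (R (Suc K)) G
        = (\<Sum>(\<sigma>, \<rho>)\<in>C K \<times> {\<rho>. \<rho> permutes B}. (of_int (sign \<sigma>) * (\<Prod>q\<in>R K. G (\<sigma> q) q))
            * (of_int (sign \<rho>) * (\<Prod>q\<in>B. G (\<rho> q) q)))"
      unfolding alternating_sum_def
    proof (rule sum.reindex_bij_witness[of _ ?i ?j])
      fix \<tau> assume "\<tau> \<in> C (Suc K)"
      then have \<tau>: "\<tau> permutes R (Suc K)" and col: "\<And>q. q \<in> R (Suc K) \<Longrightarrow> col (\<tau> q) = col q"
        by (auto simp: C_def)
      have in': "\<tau> q \<in> R (Suc K) \<longleftrightarrow> q \<in> R (Suc K)" for q using permutes_in_image[OF \<tau>] .
      have RK: "\<tau> q \<in> R K" if "q \<in> R K" for q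
        using that col[of q] in'[of q] by (auto simp: R_def)
      have BK: "\<tau> q \<in> B" if "q \<in> B" for q
        using that col[of q] in'[of q] by (auto simp: R_def B_def)
      have p: "(\<lambda>q. if q \<in> R K then \<tau> q else q) permutes R K"
          "(\<lambda>q. if q \<in> B then \<tau> q else q) permutes B"
        by (rule permutes_restrict_image[OF \<tau> finR(3)]; use R RK BK in auto)+
      show eq: "?i (?j \<tau>) = \<tau>"
        using R BK permutes_not_in[OF \<tau>] by (auto simp: fun_eq_iff)
      show "?j \<tau> \<in> C K \<times> {\<rho>. \<rho> permutes B}"
        using p col R by (auto simp: C_def)
      have "sign \<tau> = sign (fst (?j \<tau>)) * sign (snd (?j \<tau>))"
        using p permutes_imp_permutation finR
        by (subst eq[symmetric], unfold case_prod_unfold, subst sign_compose) auto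
      moreover have "(\<Prod>q\<in>R (Suc K). G (\<tau> q) q) = (\<Prod>q\<in>R K. G (\<tau> q) q) * (\<Prod>q\<in>B. G (\<tau> q) q)"
        unfolding R(1) by (rule prod.union_disjoint) (use finR R in auto)
      ultimately show "(case ?j \<tau> of (\<sigma>, \<rho>) \<Rightarrow> (of_int (sign \<sigma>) * (\<Prod>q\<in>R K. G (\<sigma> q) q))
            * (of_int (sign \<rho>) * (\<Prod>q\<in>B. G (\<rho> q) q)))
          = of_int (sign \<tau>) * (\<Prod>q\<in>R (Suc K). G (\<tau> q) q)"
        by (simp add: mult_ac)
    next
      fix x assume "x \<in> C K \<times> {\<rho>. \<rho> permutes B}"
      then obtain \<sigma> \<rho> where x: "x = (\<sigma>, \<rho>)" and \<sigma>: "\<sigma> permutes R K" and \<rho>: "\<rho> permutes B"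
        and col: "\<And>q. q \<in> R K \<Longrightarrow> col (\<sigma> q) = col q" by (auto simp: C_def)
      have f: "\<rho> q = q" if "q \<in> R K" for q using \<rho> R that by (auto simp: permutes_def)
      have g: "\<sigma> (\<rho> q) = \<rho> q" if "q \<in> B" for q
      proof -
        have "\<rho> q \<in> B" using \<rho> that by (simp add: permutes_in_image)
        then show ?thesis using \<sigma> R by (auto simp: permutes_def)
      qed
      show "?i x \<in> C (Suc K)"
      proof -
        have "\<sigma> \<circ> \<rho> permutes R (Suc K)"
          using R \<sigma> \<rho> by (intro permutes_compose) (auto intro: permutes_subset)
        moreover have "col (\<rho> q) = col q" if "q \<in> B" for q
          using \<rho> that permutes_in_image[OF \<rho>, of q] by (auto simp: B_def)
        ultimately show ?thesis using R col f g by (auto simp: x C_def)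
      qed
      show "?j (?i x) = x"
        using f g \<sigma> \<rho> by (auto simp: x fun_eq_iff permutes_def)
    qed
    also have "\<dots> = alternating_sum (C K) (R K) G * alternating_sum {\<rho>. \<rho> permutes B} B G"
      by (simp add: alternating_sum_def sum_product sum.cartesian_product case_prod_unfold)
    also have "\<dots> \<in> A"
      using Suc blocks[of K] by (auto simp: B_def intro: subalgebra_closed[OF A])
    finally show ?case .
  qed
  \<comment> \<open>Beyond the largest value of \<open>col\<close> nothing is cut off;
    \<open>insert 0\<close> provides for an empty \<open>Q\<close>.\<close>
  have "R (Suc (Max (insert 0 (col ` Q)))) = Q"
    using fin by (auto simp: R_def less_Suc_eq_le)
  with in_A[of "Suc (Max (insert 0 (col ` Q)))"] show ?thesis by (simp only: C_def)
qed

text \<open>\<open>g a q\<close> is what replaces the basis vector e_a in tensor position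
  \<open>q\<close>. Leaving it arbitrary lets the theorem, a statement on tensors, be applied
  directly to the invariants \<open>Lam\<close>.\<close>

lemma tensor_invariants_generated_by_minors:
  fixes g :: "nat \<Rightarrow> nat \<Rightarrow> 'v cpoly"
  assumes A: "subalgebra A"
    and minors: "\<And>S b p. S \<subseteq> {..<N} \<Longrightarrow> bij_betw b S {..<p} \<Longrightarrow> p \<le> r \<Longrightarrow>
      alternating_sum {\<tau>. \<tau> permutes S} S (\<lambda>y q. g (b y) q) \<in> A"
    and "\<And>i w. length w = N \<Longrightarrow> raise i F w = 0"
    and "\<And>w. F w \<noteq> 0 \<Longrightarrow> length w = N \<and> set w \<subseteq> {..<r}"
  shows "(\<Sum>w | set w \<subseteq> {..<r} \<and> length w = N. pconst (F w) * (\<Prod>q<N. g (w ! q) q)) \<in> A"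
  using assms(3,4)
\<comment> \<open>Subtracting an antisymmetrizer may enlarge the support, but only above the word it
  removes. Hence the measure counts all words lying above some word of the support.\<close>
proof (induction "card {v. set v \<subseteq> {..<r} \<and> length v = N \<and> (\<exists>u. F u \<noteq> 0 \<and> u \<le> v)}"
    arbitrary: F rule: less_induct)
  case less
  let ?W = "{w. set w \<subseteq> {..<r} \<and> length w = N}"
  have finW: "finite ?W" by (rule finite_lists_length_eq) simp
  show ?case
  proof (cases "\<exists>w\<in>?W. F w \<noteq> 0")
    case False
    then have "(\<Sum>w\<in>?W. pconst (F w) * (\<Prod>q<N. g (w ! q) q)) = 0" by (intro sum.neutral) auto
    then show ?thesis using subalgebra_closed(2)[OF A] by simp
  next
    case True
    define w where "w = Min {w\<in>?W. F w \<noteq> 0}"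
    have finW': "finite {w\<in>?W. F w \<noteq> 0}" by (rule finite_subset[OF _ finW]) auto
    have "w \<in> {w\<in>?W. F w \<noteq> 0}"
      unfolding w_def by (rule Min_in[OF finW']) (use True in auto)
    then have w: "set w \<subseteq> {..<r}" "length w = N" "F w \<noteq> 0" by auto
    have least: "w \<le> v" if "F v \<noteq> 0" for v
      unfolding w_def by (rule Min_le[OF finW']) (use that less.prems(2)[OF that] in auto)
    have lat: "lattice_word w"
      unfolding lattice_word_def
    proof (intro allI)
      fix i k
      show "count_list (take k w) (Suc i) \<le> count_list (take k w) i"
        using least_word_ballot[of N 0 i F w k] less.prems(1) w least by auto
    qed
    let ?F = "\<lambda>v. F v - F w * column_sym w v"
    have supp: "length v = N \<and> set v \<subseteq> {..<r} \<and> w \<le> v" if ne: "column_sym w v \<noteq> 0" for v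
    proof -
      obtain \<tau> where \<tau>: "\<tau> \<in> column_group w" "v = permute_word w \<tau>"
        using ne by (rule column_symE)
      have "set v \<subseteq> set w"
        using column_group_less[OF \<tau>(1)] by (auto simp: \<tau>(2) permute_word_def)
      then show ?thesis using \<tau> w permute_word_ge[OF lat \<tau>(1)] by auto
    qed
    have supp': "length v = N \<and> set v \<subseteq> {..<r} \<and> w \<le> v \<and> v \<noteq> w" if "?F v \<noteq> 0" for v
    proof -
      have "F v \<noteq> 0 \<or> column_sym w v \<noteq> 0" using that by auto
      moreover have "v \<noteq> w" using that by auto
      ultimately show ?thesis using supp[of v] less.prems(2)[of v] least[of v] by blast
    qed
    have IH: "(\<Sum>v\<in>?W. pconst (?F v) * (\<Prod>q<N. g (v ! q) q)) \<in> A"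
    proof (rule less.hyps)
      have "{v. set v \<subseteq> {..<r} \<and> length v = N \<and> (\<exists>u. ?F u \<noteq> 0 \<and> u \<le> v)}
          \<subset> {v. set v \<subseteq> {..<r} \<and> length v = N \<and> (\<exists>u. F u \<noteq> 0 \<and> u \<le> v)}" (is "?L \<subset> ?R")
      proof
        show "?L \<subseteq> ?R" using supp' w(3) by (blast intro: order.trans)
        have "w \<in> ?R" using w by blast
        moreover have "w \<notin> ?L" using supp' by (auto dest!: order.antisym)
        ultimately show "?L \<noteq> ?R" by blast
      qed
      then show "card ?L < card ?R"
        by (rule psubset_card_mono[rotated]) (rule finite_subset[OF _ finW], auto)
      show "raise i ?F v = 0" if "length v = N" for i v
        using raise_linear[of i F "- F w" "column_sym w" v] raise_column_sym[OF lat]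
          less.prems(1)[OF that] by simp
    qed (use supp' in blast)
    have "(\<Sum>v\<in>?W. pconst (column_sym w v) * (\<Prod>q<N. g (v ! q) q))
        = (\<Sum>\<tau>\<in>column_group w. \<Sum>v\<in>?W. if v = permute_word w \<tau>
            then pconst (of_int (sign \<tau>)) * (\<Prod>q<N. g (v ! q) q) else 0)"
      unfolding column_sym_def pconst_sum sum_distrib_right
      by (subst sum.swap) (auto intro!: sum.cong)
    also have "\<dots> = alternating_sum (column_group w) {..<N} (\<lambda>y q. g (w ! y) q)"
      unfolding alternating_sum_def
    proof (rule sum.cong)
      fix \<tau> assume \<tau>: "\<tau> \<in> column_group w"
      have "permute_word w \<tau> \<in> ?W"
        using column_group_less[OF \<tau>] w by (force simp: permute_word_def)
      moreover have "pconst (of_int (sign \<tau>)) = (of_int (sign \<tau>) :: 'v cpoly)"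
        by (simp add: sign_def)
      moreover have "(\<Prod>q<N. g (permute_word w \<tau> ! q) q) = (\<Prod>q<N. g (w ! \<tau> q) q)"
        using w by (intro prod.cong) auto
      ultimately show "(\<Sum>v\<in>?W. if v = permute_word w \<tau>
            then pconst (of_int (sign \<tau>)) * (\<Prod>q<N. g (v ! q) q) else 0)
          = of_int (sign \<tau>) * (\<Prod>q<N. g (w ! \<tau> q) q)"
        using finW by simp
    qed simp
    also have "\<dots> \<in> A"
    proof -
      have cg: "column_group w = {\<tau>. \<tau> permutes {..<N} \<and> (\<forall>q\<in>{..<N}. wcol w (\<tau> q) = wcol w q)}"
        using w by (auto simp: column_group_def)
      show ?thesis unfolding cg
      proof (rule alternating_sum_blocks[OF A])
        fix m
        let ?S = "{q\<in>{..<N}. wcol w q = m}"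
        let ?I = "(\<lambda>q. w ! q) ` ?S"
        have inj: "inj_on (\<lambda>q. w ! q) ?S"
          using w letter_wcol_inj[of _ w] by (auto intro!: inj_onI)
        \<comment> \<open>A column has no gap, so its letters are an initial segment
          \<open>{..<p}\<close>: only minors on the first rows occur.\<close>
        have down: "a \<in> ?I" if ab: "a \<le> b" "b \<in> ?I" for a b
        proof -
          obtain y where y: "y < N" "wcol w y = m" "w ! y = b" using ab(2) by blast
          obtain y' where "y' < length w" "w ! y' = a" "wcol w y' = wcol w y"
            using lattice_word_above[OF lat, of y a] y ab(1) w by blast
          then show ?thesis using w y by auto
        qed
        obtain p where p: "?I = {..<p}" "p \<le> r"
        proof (cases "?I = {}")
          case False
          have fI: "finite ?I" by simp
          have M: "Max ?I \<in> ?I" by (rule Max_in[OF fI False])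
          have "?I = {..<Suc (Max ?I)}"
            using down[OF _ M] Max_ge[OF fI] by (auto simp del: Max_ge_iff simp: less_Suc_eq_le)
          moreover have "Max ?I < r" using M w by auto (metis nth_mem subsetD lessThan_iff)
          ultimately show ?thesis using that[of "Suc (Max ?I)"] by simp
        qed (use that[of 0] in simp)
        show "alternating_sum {\<tau>. \<tau> permutes ?S} ?S (\<lambda>y q. g (w ! y) q) \<in> A"
          by (rule minors[of ?S "\<lambda>q. w ! q" p]) (use inj p in \<open>auto simp: bij_betw_def\<close>)
      qed simp
    qed
    finally have sym: "(\<Sum>v\<in>?W. pconst (column_sym w v) * (\<Prod>q<N. g (v ! q) q)) \<in> A" .
    have "(\<Sum>v\<in>?W. pconst (F v) * (\<Prod>q<N. g (v ! q) q))
        = (\<Sum>v\<in>?W. pconst (?F v) * (\<Prod>q<N. g (v ! q) q))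
          + pconst (F w) * (\<Sum>v\<in>?W. pconst (column_sym w v) * (\<Prod>q<N. g (v ! q) q))"
      by (simp add: sum_distrib_left sum.distrib[symmetric] algebra_simps)
    then show ?thesis using IH sym by (simp add: subalgebra_closed[OF A])
  qed
qed

text \<open>Otherwise the simplifier rewrites the index \<open>(1, 1)\<close> hidden in \<open>f1'\<close>.\<close>

declare One_nat_def [simp del]

section \<open>Subalgebras and restriction to \<open>f\<^sub>1' = 0\<close>\<close>

lemma subalgebra_generated: "subalgebra (generated_algebra L)"
  unfolding subalgebra_def generated_algebra_def
proof (intro conjI allI ballI; (elim imageE)?)
  fix c show "pconst c \<in> psubst ((!) L) ` poly_ring {..<length L}"
    by (rule image_eqI[of _ _ "pconst c"]) auto
next
  fix p q x y assume "p = psubst ((!) L) x" "q = psubst ((!) L) y"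
    "x \<in> poly_ring {..<length L}" "y \<in> poly_ring {..<length L}"
  then show "p + q \<in> psubst ((!) L) ` poly_ring {..<length L}"
    by (intro image_eqI[of _ _ "x + y"]) (auto intro: poly_ring_add)
next
  fix p q x y assume "p = psubst ((!) L) x" "q = psubst ((!) L) y"
    "x \<in> poly_ring {..<length L}" "y \<in> poly_ring {..<length L}"
  then show "p * q \<in> psubst ((!) L) ` poly_ring {..<length L}"
    by (intro image_eqI[of _ _ "x * y"]) (auto intro: poly_ring_mult)
qed

lemma generator_in_generated_algebra: "P \<in> set L \<Longrightarrow> P \<in> generated_algebra L"
  unfolding generated_algebra_def in_set_conv_nth
  by (auto intro!: image_eqI[of _ _ "pvar _"] poly_ring_pvar)

lemma psubst_in_subalgebra:
  assumes "subalgebra A" "T \<in> poly_ring V" "\<And>v. v \<in> V \<Longrightarrow> \<sigma> v \<in> A"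
  shows "psubst \<sigma> T \<in> A"
  using assms(2,3) by (induction T rule: poly_ring_induct) (auto intro: subalgebra_closed[OF assms(1)])

lemma generated_algebra_subset:
  assumes "subalgebra A" "set L \<subseteq> A" shows "generated_algebra L \<subseteq> A"
  using assms by (auto simp: generated_algebra_def intro!: psubst_in_subalgebra)

lemma lookup_single_mult:
  fixes P :: "'v cpoly"
  shows "Poly_Mapping.lookup (Poly_Mapping.single k c * P) (k + m) = c * Poly_Mapping.lookup P m"
proof (induction P rule: cpoly_single_induct)
  case (single m' c')
  then show ?case by (auto simp: mult_single lookup_single when_def)
qed (simp_all add: distrib_left lookup_add)

lemma pvar_mult_cancel:
  assumes "pvar v * P = pvar v * Q" shows "P = Q"
proof (rule poly_mapping_eqI)
  fix m
  have "Poly_Mapping.lookup (pvar v * P) (Poly_Mapping.single v 1 + m)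
      = Poly_Mapping.lookup (pvar v * Q) (Poly_Mapping.single v 1 + m)"
    using assms by simp
  then show "Poly_Mapping.lookup P m = Poly_Mapping.lookup Q m"
    unfolding pvar_def lookup_single_mult by simp
qed

lemma restrict0_hom [simp]:
  "restrict0 0 = 0" "restrict0 (P + Q) = restrict0 P + restrict0 Q" "restrict0 f1' = 0"
  "restrict0 (P * Q) = restrict0 P * restrict0 Q" "restrict0 (P - Q) = restrict0 P - restrict0 Q"
  by (simp_all add: restrict0_def)

lemma restrict0_psubst: "restrict0 (psubst \<sigma> T) = psubst (\<lambda>j. restrict0 (\<sigma> j)) T"
  by (simp add: restrict0_def psubst_psubst)

lemma restrict0_remainder: "\<exists>Q. P = restrict0 P + f1' * Q"
  using poly_ring_UNIV[of P]
proof (induction P rule: poly_ring_induct)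
  case (const c)
  then show ?case by (intro exI[of _ 0]) (simp add: restrict0_def)
next
  case (var v)
  have "pvar v = restrict0 (pvar v) + f1' * (if v = (1, 1) then 1 else 0)"
    by (simp add: restrict0_def)
  then show ?case by blast
next
  case (add p q)
  then obtain a b where 1: "p = restrict0 p + f1' * a" "q = restrict0 q + f1' * b" by blast
  have "p + q = (restrict0 p + f1' * a) + (restrict0 q + f1' * b)"
    using 1 by (rule arg_cong2)
  also have "\<dots> = restrict0 (p + q) + f1' * (a + b)" by (simp add: algebra_simps)
  finally show ?case by blast
next
  case (mult p q)
  then obtain a b where 1: "p = restrict0 p + f1' * a" "q = restrict0 q + f1' * b" by blast
  have "p * q = (restrict0 p + f1' * a) * (restrict0 q + f1' * b)"
    using 1 by (rule arg_cong2)
  also have "\<dots> = restrict0 (p * q) + f1' * (a * restrict0 q + restrict0 p * b + f1' * a * b)"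
    by (simp add: algebra_simps)
  finally show ?case by blast
qed

text \<open>Division by \<open>f1'\<close> must stop, since every step lowers the exponent of
  \<open>f1'\<close> in one chosen monomial of \<open>P\<close>.\<close>

lemma f1'_quotient_exists:
  assumes "P \<noteq> 0" obtains \<nu> Q where "f1'_quotient \<nu> P Q"
proof -
  have "\<exists>\<nu> Q. f1'_quotient \<nu> P Q" if "m \<in> Poly_Mapping.keys P" for m
    using that
  proof (induction "Poly_Mapping.lookup m (1, 1)" arbitrary: m P rule: less_induct)
    case less
    show ?case
    proof (cases "f1' dvd P")
      case False
      then have "f1'_quotient 0 P P" by (simp add: f1'_quotient_def)
      then show ?thesis by blast
    next
      case True
      then obtain Q where Q: "P = f1' * Q" by auto
      have "\<exists>a b. m = a + b \<and> a \<in> Poly_Mapping.keys f1' \<and> b \<in> Poly_Mapping.keys Q"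
        using less.prems keys_mult[of f1' Q] by (auto simp: Q)
      then obtain b where b: "m = Poly_Mapping.single (1, 1) 1 + b" "b \<in> Poly_Mapping.keys Q"
        by (auto simp: pvar_def)
      obtain \<nu> R where "f1'_quotient \<nu> Q R"
        using less.hyps[OF _ b(2)] b by (auto simp: lookup_add)
      then have "f1'_quotient (Suc \<nu>) P R" by (simp add: f1'_quotient_def Q mult.assoc)
      then show ?thesis by blast
    qed
  qed
  moreover have "Poly_Mapping.keys P \<noteq> {}"
    using assms poly_sum_single[of "{}" P] by auto
  ultimately show ?thesis using that by blast
qed

section \<open>Division by a Groebner basis\<close>

lemma keys_in_monomials:
  "P \<in> poly_ring {..<M} \<longleftrightarrow> Poly_Mapping.keys P \<subseteq> monomials M"
  by (auto simp: poly_ring_def pvars_subset_iff monomials_def)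

lemma keys_single_mult:
  assumes "m \<in> Poly_Mapping.keys (Poly_Mapping.single k c * P)"
  obtains m' where "m = k + m'" "m' \<in> Poly_Mapping.keys P"
  using assms keys_mult[of "Poly_Mapping.single k c" P] by (auto split: if_splits)

lemma keys_minus_subset:
  "Poly_Mapping.keys (P - Q :: 'v cpoly) \<subseteq> Poly_Mapping.keys P \<union> Poly_Mapping.keys Q"
  by (auto simp: in_keys_iff lookup_minus)

lemma monomial_order_Max:
  assumes "monomial_order M r" "finite S" "S \<noteq> {}" "S \<subseteq> monomials M"
  obtains m where "m \<in> S" "\<And>m'. m' \<in> S \<Longrightarrow> (m', m) \<in> r"
proof -
  have r: "refl_on (monomials M) r" "trans r" "total_on (monomials M) r"
    using assms(1)
    by (auto simp: monomial_order_def well_order_on_def linear_order_on_def partial_order_on_def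
        preorder_on_def)
  have "\<exists>m\<in>S. \<forall>m'\<in>S. (m', m) \<in> r"
    using assms(2-4)
  proof (induction S rule: finite_ne_induct)
    case (singleton x)
    then show ?case using r(1) by (auto simp: refl_on_def)
  next
    case (insert x S)
    then obtain m where m: "m \<in> S" "\<forall>m'\<in>S. (m', m) \<in> r" by auto
    have "x \<noteq> m" using m insert.hyps by blast
    then have "(x, m) \<in> r \<or> (m, x) \<in> r"
      using r(3) m insert.prems by (auto simp: total_on_def)
    moreover have "(x, x) \<in> r" using r(1) insert.prems by (auto simp: refl_on_def)
    ultimately show ?case using m transD[OF r(2)] by blast
  qed
  then show ?thesis using that by blast
qed

lemma lead_monom_greatest:
  assumes "monomial_order M r" "P \<in> poly_ring {..<M}" "P \<noteq> 0"
  shows "lead_monom r P \<in> Poly_Mapping.keys P"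
    and "\<And>m. m \<in> Poly_Mapping.keys P \<Longrightarrow> (m, lead_monom r P) \<in> r"
proof -
  have ne: "Poly_Mapping.keys P \<noteq> {}" using assms(3) poly_sum_single[of "{}" P] by auto
  obtain m where m: "m \<in> Poly_Mapping.keys P" "\<And>m'. m' \<in> Poly_Mapping.keys P \<Longrightarrow> (m', m) \<in> r"
    using monomial_order_Max[OF assms(1) finite_keys ne] assms(2) keys_in_monomials by blast
  have "antisym r"
    using assms(1)
    by (auto simp: monomial_order_def well_order_on_def linear_order_on_def partial_order_on_def)
  then have "lead_monom r P = m"
    unfolding lead_monom_def using m by (intro the_equality) (auto dest: antisymD)
  then show "lead_monom r P \<in> Poly_Mapping.keys P"
    "\<And>m. m \<in> Poly_Mapping.keys P \<Longrightarrow> (m, lead_monom r P) \<in> r"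
    using m by auto
qed

definition standard_set ::
  "nat \<Rightarrow> ((nat \<Rightarrow>\<^sub>0 nat) \<times> (nat \<Rightarrow>\<^sub>0 nat)) set \<Rightarrow> nat cpoly set \<Rightarrow> (nat \<Rightarrow>\<^sub>0 nat) set" where
  "standard_set M r G = monomials M - (\<Union>g\<in>G. cone M (lead_monom r g))"

text \<open>The lead term lies in the monomial ideal of the lead terms of \<open>G\<close>. Reading
  off the coefficient at the lead monomial, one summand of the representation must contribute, and
  its generator divides.\<close>

lemma lead_monom_in_cone:
  assumes G: "reduced_groebner_basis M r I G" and S: "S \<in> I" "S \<noteq> 0"
    and lm: "lead_monom r S \<in> Poly_Mapping.keys S"
  obtains g where "g \<in> G" "lead_monom r S \<in> cone M (lead_monom r g)"
proof -
  let ?m = "lead_monom r S"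
  have "lead_term r S \<in> generated_ideal M (lead_term r ` (I - {0}))"
    unfolding generated_ideal_def using S
    by (intro CollectI exI[of _ "{lead_term r S}"] exI[of _ "\<lambda>_. 1"]) auto
  then have "lead_term r S \<in> generated_ideal M (lead_term r ` G)"
    using G by (simp add: reduced_groebner_basis_def)
  then obtain F q where F: "F \<subseteq> lead_term r ` G" "\<And>g. g \<in> F \<Longrightarrow> q g \<in> poly_ring {..<M}"
    and eq: "lead_term r S = (\<Sum>g\<in>F. q g * g)"
    by (auto simp: generated_ideal_def)
  have "Poly_Mapping.lookup (lead_term r S) ?m \<noteq> 0"
    using lm by (simp add: lead_term_def in_keys_iff)
  then have "(\<Sum>g\<in>F. Poly_Mapping.lookup (q g * g) ?m) \<noteq> 0"
    unfolding eq lookup_sum .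
  then obtain t where t: "t \<in> F" "Poly_Mapping.lookup (q t * t) ?m \<noteq> 0"
    by (rule sum.not_neutral_contains_not_neutral)
  then obtain g where g: "g \<in> G" "t = lead_term r g" using F by auto
  have "?m \<in> Poly_Mapping.keys (Poly_Mapping.single (lead_monom r g)
      (Poly_Mapping.lookup g (lead_monom r g)) * q t)"
    using t by (simp add: in_keys_iff g lead_term_def mult.commute)
  then obtain k where "?m = lead_monom r g + k" "k \<in> Poly_Mapping.keys (q t)"
    by (rule keys_single_mult)
  moreover from this have "k \<in> monomials M"
    using F(2)[OF t(1)] by (auto simp: keys_in_monomials)
  ultimately show ?thesis using g by (auto simp: cone_def intro!: that)
qed

text \<open>Its lead monomial would lie in the cone of a basis element, hence outside the standard
  set. So standard monomials are linearly independent modulo the relations; this gives the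
  uniqueness of the normal form and extends the syzygies from the basis to all relations.\<close>

lemma standard_relation_eq_0:
  assumes "monomial_order M r" "reduced_groebner_basis M r I G" "I \<subseteq> poly_ring {..<M}"
    and "S \<in> I" "Poly_Mapping.keys S \<subseteq> standard_set M r G"
  shows "S = 0"
proof (rule ccontr)
  assume "S \<noteq> 0"
  then have lm: "lead_monom r S \<in> Poly_Mapping.keys S"
    using assms by (intro lead_monom_greatest(1)) auto
  obtain g where "g \<in> G" "lead_monom r S \<in> cone M (lead_monom r g)"
    using lead_monom_in_cone[OF assms(2,4) \<open>S \<noteq> 0\<close> lm] .
  then show False using assms(5) lm by (auto simp: standard_set_def)
qed

text \<open>The difference from the remainder is controlled by any additive set \<open>J\<close>
  that contains the multiples of the basis elements; below, \<open>J\<close> consists of relations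
  that carry a divisibility statement along. Termination is well-founded induction on a monomial
  \<open>b\<close> bounding \<open>T\<close>.\<close>

lemma groebner_division:
  assumes ord: "monomial_order M r" and G: "G \<subseteq> poly_ring {..<M}"
    and monic: "\<And>g. g \<in> G \<Longrightarrow> Poly_Mapping.lookup g (lead_monom r g) = 1"
    and J: "0 \<in> J" "\<And>p q. p \<in> J \<Longrightarrow> q \<in> J \<Longrightarrow> p + q \<in> J"
      "\<And>p q. p \<in> poly_ring {..<M} \<Longrightarrow> q \<in> G \<Longrightarrow> p * q \<in> J"
    and T: "T \<in> poly_ring {..<M}"
  obtains N where "Poly_Mapping.keys N \<subseteq> standard_set M r G" "T - N \<in> J"
proof -
  have r: "wf (r - Id)" "refl_on (monomials M) r"
    and rM: "r \<subseteq> monomials M \<times> monomials M"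
    and mono: "\<And>a b c. (a, b) \<in> r \<Longrightarrow> c \<in> monomials M \<Longrightarrow> (a + c, b + c) \<in> r"
    using ord
    by (auto simp: monomial_order_def well_order_on_def linear_order_on_def partial_order_on_def
        preorder_on_def refl_on_def)
  have claim: "\<exists>N. Poly_Mapping.keys N \<subseteq> standard_set M r G \<and> T - N \<in> J"
    if "Poly_Mapping.keys T \<subseteq> {b'. (b', b) \<in> r}" "b \<in> monomials M" for b T
    using r(1) that
  proof (induction b arbitrary: T rule: wf_induct_rule)
    case (less b)
    let ?c = "Poly_Mapping.lookup T b"
    \<comment> \<open>In both cases the monomial \<open>b\<close> disappears from \<open>T\<close>:
      it is kept in the remainder if it is standard, and otherwise cancelled by a multiple of a
      monic basis element whose lead monomial divides it.\<close>
    have "\<exists>N D. Poly_Mapping.keys N \<subseteq> standard_set M r G \<and> D \<in> J \<and>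
        Poly_Mapping.lookup (N + D) b = ?c \<and> Poly_Mapping.keys (N + D) \<subseteq> {b'. (b', b) \<in> r}"
    proof (cases "b \<in> standard_set M r G")
      case True
      have "(b, b) \<in> r" using r(2) less.prems by (auto simp: refl_on_def)
      then show ?thesis
        using True J(1) by (intro exI[of _ "Poly_Mapping.single b ?c"] exI[of _ 0]) auto
    next
      case False
      then obtain g k where g: "g \<in> G" "b = lead_monom r g + k" "k \<in> monomials M"
        using less.prems(2) by (auto simp: standard_set_def cone_def)
      let ?D = "Poly_Mapping.single k ?c * g"
      have "g \<noteq> 0" using monic[OF g(1)] by auto
      have "Poly_Mapping.keys ?D \<subseteq> {b'. (b', b) \<in> r}"
      proof
        fix m assume "m \<in> Poly_Mapping.keys ?D"
        then obtain m' where "m = k + m'" "m' \<in> Poly_Mapping.keys g" by (rule keys_single_mult)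
        moreover from this have "(m', lead_monom r g) \<in> r"
          using g G \<open>g \<noteq> 0\<close> by (intro lead_monom_greatest(2)[OF ord]) auto
        ultimately show "m \<in> {b'. (b', b) \<in> r}"
          using mono[of m' "lead_monom r g" k] g by (simp add: add.commute)
      qed
      moreover have "Poly_Mapping.lookup ?D b = ?c"
        using lookup_single_mult[of k ?c g "lead_monom r g"] monic[OF g(1)]
        by (simp add: g(2) add.commute)
      moreover have "?D \<in> J"
        using g by (intro J(3) poly_ring_single) (auto simp: monomials_def)
      ultimately show ?thesis by (intro exI[of _ 0] exI[of _ ?D]) auto
    qed
    then obtain N D where ND: "Poly_Mapping.keys N \<subseteq> standard_set M r G" "D \<in> J"
      "Poly_Mapping.lookup (N + D) b = ?c" "Poly_Mapping.keys (N + D) \<subseteq> {b'. (b', b) \<in> r}"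
      by blast
    let ?T = "T - (N + D)"
    have keys: "Poly_Mapping.keys ?T \<subseteq> {b'. (b', b) \<in> r} - {b}"
      using ND less.prems keys_minus_subset[of T "N + D"] by (auto simp: in_keys_iff lookup_minus)
    show ?case
    proof (cases "?T = 0")
      case True
      then have "T - N = D" by (simp add: algebra_simps)
      then show ?thesis using ND by blast
    next
      case False
      then have ne: "Poly_Mapping.keys ?T \<noteq> {}" using poly_sum_single[of "{}" ?T] by auto
      have "Poly_Mapping.keys ?T \<subseteq> monomials M" using keys rM by auto
      from monomial_order_Max[OF ord finite_keys ne this] obtain b' where
        b': "b' \<in> Poly_Mapping.keys ?T" "\<And>m. m \<in> Poly_Mapping.keys ?T \<Longrightarrow> (m, b') \<in> r" by metis
      obtain N' where "Poly_Mapping.keys N' \<subseteq> standard_set M r G" "?T - N' \<in> J"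
        using less.IH[of b' ?T] b' keys rM by auto
      then have "Poly_Mapping.keys (N + N') \<subseteq> standard_set M r G" "T - (N + N') \<in> J"
        using ND Poly_Mapping.keys_add[of N N'] J(2)[of "?T - N'" D] by (auto simp: algebra_simps)
      then show ?thesis by blast
    qed
  qed
  show ?thesis
  proof (cases "T = 0")
    case True
    then show ?thesis using J(1) that[of 0] by simp
  next
    case False
    have "Poly_Mapping.keys T \<subseteq> {b'. (b', lead_monom r T) \<in> r}" "lead_monom r T \<in> monomials M"
      using lead_monom_greatest[OF ord T False] T by (auto simp: keys_in_monomials)
    then show ?thesis using claim that by blast
  qed
qed

section \<open>Weights\<close>

text \<open>The weight is a parameter because the same projection serves for jet weights of
  differential polynomials and for monomial weights in the abstract variables.\<close>

definition component :: "(('v \<Rightarrow>\<^sub>0 nat) \<Rightarrow> nat) \<Rightarrow> nat \<Rightarrow> 'v cpoly \<Rightarrow> 'v cpoly" where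
  "component wt d P = Poly_Mapping.mapp (\<lambda>m c. if wt m = d then c else 0) P"

lemma lookup_component:
  "Poly_Mapping.lookup (component wt d P) m = (if wt m = d then Poly_Mapping.lookup P m else 0)"
  by (auto simp: component_def lookup_mapp when_def in_keys_iff)

lemma component_simps [simp]:
  "component wt d 0 = 0" "component wt d (P + Q) = component wt d P + component wt d Q"
  "component wt d (P - Q) = component wt d P - component wt d Q"
  "component wt d (Poly_Mapping.single m c) = (if wt m = d then Poly_Mapping.single m c else 0)"
  by (auto intro!: poly_mapping_eqI simp: lookup_component lookup_add lookup_minus lookup_single when_def)

lemma keys_component: "Poly_Mapping.keys (component wt d P) = {m\<in>Poly_Mapping.keys P. wt m = d}"
  by (auto simp: in_keys_iff lookup_component split: if_splits)

definition jet_weight :: "(nat \<times> nat \<Rightarrow>\<^sub>0 nat) \<Rightarrow> nat" where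
  "jet_weight m = (\<Sum>v\<in>Poly_Mapping.keys m. snd v * Poly_Mapping.lookup m v)"

definition isobaric :: "nat \<Rightarrow> jpoly \<Rightarrow> bool" where
  "isobaric d P \<longleftrightarrow> (\<forall>m\<in>Poly_Mapping.keys P. jet_weight m = d)"

lemma jet_weight_superset:
  assumes "finite S" "Poly_Mapping.keys m \<subseteq> S"
  shows "jet_weight m = (\<Sum>v\<in>S. snd v * Poly_Mapping.lookup m v)"
  unfolding jet_weight_def
  by (rule sum.mono_neutral_left) (use assms in \<open>auto simp: in_keys_iff\<close>)

lemma jet_weight_add: "jet_weight (m + m') = jet_weight m + jet_weight m'"
proof -
  let ?S = "Poly_Mapping.keys m \<union> Poly_Mapping.keys m'"
  have "Poly_Mapping.keys (m + m') \<subseteq> ?S" by (rule Poly_Mapping.keys_add)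
  then show ?thesis
    by (simp add: jet_weight_superset[of ?S] lookup_add distrib_left sum.distrib)
qed

lemma isobaric_pconst [simp]: "isobaric 0 (pconst c)"
  by (simp add: isobaric_def pconst_def jet_weight_def)

lemma isobaric_mult: "isobaric a P \<Longrightarrow> isobaric b Q \<Longrightarrow> isobaric (a + b) (P * Q)"
  using keys_mult[of P Q] by (fastforce simp: isobaric_def jet_weight_add)

lemma isobaric_power: "isobaric a P \<Longrightarrow> isobaric (a * k) (P ^ k)"
  using isobaric_pconst[of 1] by (induction k) (auto intro: isobaric_mult)

lemma isobaric_prod:
  "(\<And>i. i \<in> S \<Longrightarrow> isobaric (a i) (f i)) \<Longrightarrow> isobaric (\<Sum>i\<in>S. a i) (\<Prod>i\<in>S. f i)"
  using isobaric_pconst[of 1]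
  by (induction S rule: infinite_finite_induct) (auto intro: isobaric_mult)

lemma component_isobaric: "isobaric e P \<Longrightarrow> component jet_weight d P = (if e = d then P else 0)"
  by (intro poly_mapping_eqI) (auto simp: lookup_component isobaric_def in_keys_iff)

lemma isobaric_component [simp]: "isobaric d (component jet_weight d P)"
  by (auto simp: isobaric_def keys_component)

lemma component_f1'_mult:
  "component jet_weight d (f1' * P) = (if d = 0 then 0 else f1' * component jet_weight (d - 1) P)"
proof (induction P rule: cpoly_single_induct)
  case (single m c)
  have "jet_weight (Poly_Mapping.single (1, 1) 1 + m) = Suc (jet_weight m)"
    by (simp add: jet_weight_add) (simp add: jet_weight_def)
  then show ?case by (auto simp: pvar_def mult_single)
qed (simp_all add: distrib_left)

lemma psubst_monomial:
  "psubst \<sigma> (Poly_Mapping.single m c) = pconst c * mpower \<sigma> m"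
  by (rule subst.ev_single)

lemma isobaric_monomial:
  assumes "list_all2 (\<lambda>P l. isobaric l P) L ls" "m \<in> monomials (length L)"
  shows "isobaric (monom_weight ls m) (mpower ((!) L) m)"
proof -
  have len: "length ls = length L" using assms(1) by (simp add: list_all2_lengthD)
  have "mpower ((!) L) m = (\<Prod>j<length L. L ! j ^ Poly_Mapping.lookup m j)"
    by (rule mpower_superset) (use assms in \<open>auto simp: monomials_def\<close>)
  moreover have "isobaric (\<Sum>j<length L. ls ! j * Poly_Mapping.lookup m j)
      (\<Prod>j<length L. L ! j ^ Poly_Mapping.lookup m j)"
    by (intro isobaric_prod isobaric_power) (use assms in \<open>auto simp: list_all2_conv_all_nth\<close>)
  ultimately show ?thesis by (simp add: monom_weight_def len)
qed

lemma component_psubst: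
  assumes L: "list_all2 (\<lambda>P l. isobaric l P) L ls" and T: "T \<in> poly_ring {..<length L}"
  shows "component jet_weight d (psubst ((!) L) T) = psubst ((!) L) (component (monom_weight ls) d T)"
proof (induction T rule: cpoly_single_induct)
  case (single m c)
  then have "m \<in> monomials (length L)" using T by (auto simp: keys_in_monomials)
  then have "isobaric (monom_weight ls m) (psubst ((!) L) (Poly_Mapping.single m c))"
    using isobaric_mult[OF isobaric_pconst isobaric_monomial[OF L]] by (simp add: psubst_monomial)
  then show ?case by (simp add: component_isobaric)
qed simp_all

section \<open>Lists whose relations do not produce new invariants\<close>

lemma of_weights_length: "of_weights n \<kappa> L ls \<Longrightarrow> length ls = length L"
  by (simp add: of_weights_def list_all2_lengthD)

lemma relation_ideal_closed:
  "0 \<in> relation_ideal L"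
  "p \<in> relation_ideal L \<Longrightarrow> q \<in> relation_ideal L \<Longrightarrow> p + q \<in> relation_ideal L"
  "p \<in> relation_ideal L \<Longrightarrow> q \<in> relation_ideal L \<Longrightarrow> p - q \<in> relation_ideal L"
  "p \<in> poly_ring {..<length L} \<Longrightarrow> q \<in> relation_ideal L \<Longrightarrow> p * q \<in> relation_ideal L"
  by (auto simp: relation_ideal_def intro: poly_ring_add poly_ring_diff poly_ring_mult)

lemma relation_ideal_iff:
  "S \<in> relation_ideal L \<longleftrightarrow> S \<in> poly_ring {..<length L} \<and> restrict0 (psubst ((!) L) S) = 0"
  by (simp add: relation_ideal_def restrict0_psubst)

locale closed_list =
  fixes L :: "jpoly list" and r :: "((nat \<Rightarrow>\<^sub>0 nat) \<times> (nat \<Rightarrow>\<^sub>0 nat)) set"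
    and Ss :: "nat cpoly list"
  assumes ord: "monomial_order (length L) r"
    and basis: "reduced_groebner_basis (length L) r (relation_ideal L) (set Ss)"
    and syzygy: "\<forall>S\<in>set Ss. \<exists>R\<in>poly_ring {..<Suc (length L)}.
           0 = psubst ((!) L) S - f1' * psubst ((!) (f1' # L)) R"
begin

abbreviation alg :: "jpoly set" where
  "alg \<equiv> generated_algebra (f1' # L)"

lemmas alg_closed = subalgebra_closed[OF subalgebra_generated[of "f1' # L"]]

lemma f1'_in_alg: "f1' \<in> alg" and L_in_alg: "P \<in> set L \<Longrightarrow> P \<in> alg"
  by (auto intro: generator_in_generated_algebra)

lemma psubst_in_alg: "T \<in> poly_ring {..<length L} \<Longrightarrow> psubst ((!) L) T \<in> alg"
  by (rule psubst_in_subalgebra[OF subalgebra_generated]) (auto intro: L_in_alg)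

lemma division:
  assumes "T \<in> poly_ring {..<length L}"
  obtains N a where "Poly_Mapping.keys N \<subseteq> standard_set (length L) r (set Ss)" "a \<in> alg"
    "T - N \<in> relation_ideal L" "psubst ((!) L) T = psubst ((!) L) N + f1' * a"
proof -
  \<comment> \<open>The syzygies put all multiples of basis elements into this set, so a single
    division yields both a relation and a value divisible by \<open>f1'\<close> inside
    \<open>alg\<close>.\<close>
  let ?J = "{S \<in> relation_ideal L. \<exists>a\<in>alg. psubst ((!) L) S = f1' * a}"
  have Ss: "set Ss \<subseteq> relation_ideal L" "\<And>g. g \<in> set Ss \<Longrightarrow> Poly_Mapping.lookup g (lead_monom r g) = 1"
    using basis by (auto simp: reduced_groebner_basis_def)
  obtain N where N: "Poly_Mapping.keys N \<subseteq> standard_set (length L) r (set Ss)" "T - N \<in> ?J"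
  proof (rule groebner_division[OF ord _ Ss(2) _ _ _ assms, where J = ?J])
    show "set Ss \<subseteq> poly_ring {..<length L}" using Ss(1) by (auto simp: relation_ideal_def)
    show "0 \<in> ?J"
      using relation_ideal_closed(1) alg_closed(2) by (auto intro!: bexI[of _ 0])
    show "p + q \<in> ?J" if pq: "p \<in> ?J" "q \<in> ?J" for p q
    proof -
      obtain a b where "a \<in> alg" "psubst ((!) L) p = f1' * a" "b \<in> alg" "psubst ((!) L) q = f1' * b"
        using pq by auto
      then have "a + b \<in> alg" "psubst ((!) L) (p + q) = f1' * (a + b)"
        by (auto simp: distrib_left intro: alg_closed)
      then show ?thesis using pq relation_ideal_closed(2) by auto
    qed
    show "p * q \<in> ?J" if p: "p \<in> poly_ring {..<length L}" and q: "q \<in> set Ss" for p q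
    proof -
      obtain R where R: "R \<in> poly_ring {..<Suc (length L)}"
        "psubst ((!) L) q = f1' * psubst ((!) (f1' # L)) R" using syzygy q by auto
      have "psubst ((!) (f1' # L)) R \<in> alg"
        using R by (auto simp: generated_algebra_def)
      then have "psubst ((!) L) p * psubst ((!) (f1' # L)) R \<in> alg"
        using psubst_in_alg[OF p] by (rule alg_closed(5)[rotated])
      moreover have "psubst ((!) L) (p * q) = f1' * (psubst ((!) L) p * psubst ((!) (f1' # L)) R)"
        by (simp add: R mult_ac)
      ultimately show ?thesis using relation_ideal_closed(4)[OF p] q Ss(1) by auto
    qed
  qed
  then obtain a where "a \<in> alg" "psubst ((!) L) (T - N) = f1' * a" by auto
  then show ?thesis using N that[of N a] by (auto simp: algebra_simps)
qed

text \<open>The remainder of a relation is again a relation, supported on standard monomials, hence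
  zero.\<close>

lemma relation_divisible:
  assumes "S \<in> relation_ideal L" obtains a where "a \<in> alg" "psubst ((!) L) S = f1' * a"
proof -
  have S: "S \<in> poly_ring {..<length L}" using assms by (simp add: relation_ideal_def)
  from division[OF S] obtain N a where N: "Poly_Mapping.keys N \<subseteq> standard_set (length L) r (set Ss)"
    "a \<in> alg" "S - N \<in> relation_ideal L" "psubst ((!) L) S = psubst ((!) L) N + f1' * a" by metis
  have "N \<in> relation_ideal L" using relation_ideal_closed(3)[OF assms N(3)] by simp
  then have "N = 0"
    using standard_relation_eq_0[OF ord basis] N(1) by (auto simp: relation_ideal_def)
  then show ?thesis using N that by simp
qed

text \<open>Separates the part that survives at \<open>f1' = 0\<close>. Writing it as a polynomial
  in \<open>L\<close> alone is what makes it eligible for the relation ideal.\<close>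

lemma alg_split:
  assumes "P \<in> alg"
  obtains T a where "T \<in> poly_ring {..<length L}" "a \<in> alg" "P = psubst ((!) L) T + f1' * a"
proof -
  let ?B = "{P. \<exists>T\<in>poly_ring {..<length L}. \<exists>a\<in>alg. P = psubst ((!) L) T + f1' * a}"
  have "alg \<subseteq> ?B"
  proof (rule generated_algebra_subset)
    show "subalgebra ?B"
      unfolding subalgebra_def
    proof (intro conjI allI ballI)
      fix c show "pconst c \<in> ?B"
        using alg_closed(2) by (intro CollectI bexI[of _ "pconst c"] bexI[of _ 0]) simp_all
    next
      fix p q assume "p \<in> ?B" "q \<in> ?B"
      then obtain T a U b where p: "T \<in> poly_ring {..<length L}" "a \<in> alg" "p = psubst ((!) L) T + f1' * a"
        and q: "U \<in> poly_ring {..<length L}" "b \<in> alg" "q = psubst ((!) L) U + f1' * b" by auto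
      have "p + q = psubst ((!) L) (T + U) + f1' * (a + b)" by (simp add: p q algebra_simps)
      moreover have "a + b \<in> alg" using p q by (auto intro: alg_closed)
      ultimately show "p + q \<in> ?B" using poly_ring_add[OF p(1) q(1)] by blast
      have "p * q = psubst ((!) L) (T * U)
          + f1' * (psubst ((!) L) T * b + a * psubst ((!) L) U + f1' * a * b)"
        by (simp add: p q algebra_simps)
      moreover have "psubst ((!) L) T * b + a * psubst ((!) L) U + f1' * a * b \<in> alg"
        using p q f1'_in_alg psubst_in_alg by (intro alg_closed) auto
      ultimately show "p * q \<in> ?B" using poly_ring_mult[OF p(1) q(1)] by blast
    qed
    show "set (f1' # L) \<subseteq> ?B"
    proof
      fix P assume "P \<in> set (f1' # L)"
      then consider "P = f1'" | j where "j < length L" "P = L ! j" by (auto simp: in_set_conv_nth)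
      then show "P \<in> ?B"
      proof cases
        case 1
        then show ?thesis
          using alg_closed(3) by (intro CollectI bexI[of _ 0] bexI[of _ 1]) simp_all
      next
        case 2
        then show ?thesis
          using alg_closed(2)
          by (intro CollectI bexI[of _ "pvar j"] bexI[of _ 0]) (simp_all add: poly_ring_pvar)
      qed
    qed
  qed
  then show ?thesis using assms that by blast
qed

text \<open>Setting \<open>f1' = 0\<close> in the splitting of \<open>f1' * Q\<close> shows that its
  first part comes from a relation, hence is itself \<open>f1'\<close> times an element of
  \<open>alg\<close>; then \<open>f1'\<close> cancels. All later uses of the syzygies go through
  this saturation of \<open>alg\<close>.\<close>

lemma f1'_mult_in_alg:
  assumes "f1' * Q \<in> alg" shows "Q \<in> alg"
proof -
  obtain T a where T: "T \<in> poly_ring {..<length L}" "a \<in> alg" "f1' * Q = psubst ((!) L) T + f1' * a"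
    using alg_split[OF assms] .
  have "restrict0 (psubst ((!) L) T) = restrict0 (f1' * Q - f1' * a)" using T by simp
  then have "T \<in> relation_ideal L" using T(1) by (simp add: relation_ideal_iff)
  then obtain b where b: "b \<in> alg" "psubst ((!) L) T = f1' * b" by (rule relation_divisible)
  have "f1' * Q = f1' * (b + a)" by (simp add: T(3) b distrib_left)
  then have "Q = b + a" by (rule pvar_mult_cancel)
  then show ?thesis using b T by (auto intro: alg_closed)
qed

lemma f1'_power_mult_in_alg: "f1' ^ k * Q \<in> alg \<Longrightarrow> Q \<in> alg"
  by (induction k) (auto simp: mult.assoc dest: f1'_mult_in_alg)

text \<open>The loop may choose another monomial order and another basis. Each candidate is still an
  element of \<open>alg\<close> divided by a power of \<open>f1'\<close>, and saturation is
  independent of these choices.\<close>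

lemma algorithm_loop_eq:
  assumes "algorithm_loop n \<kappa> L L'" shows "L' = L"
proof -
  obtain ls r' Ss' Rs where *: "homogeneous_reduced_basis L ls r' Ss'"
    "list_all2 (\<lambda>S R. if psubst ((!) L) S = 0 then R = 0
          else \<exists>\<nu>\<ge>1. f1'_quotient \<nu> (psubst ((!) L) S) R) Ss' Rs" "L' = fold append_new Rs L"
    using assms by (auto simp: algorithm_loop_def)
  have "R \<in> alg" if R: "R \<in> set Rs" for R
  proof -
    obtain i where i: "i < length Rs" "R = Rs ! i" using R by (auto simp: in_set_conv_nth)
    define S where "S = Ss' ! i"
    have S: "S \<in> set Ss'" "if psubst ((!) L) S = 0 then R = 0
          else \<exists>\<nu>\<ge>1. f1'_quotient \<nu> (psubst ((!) L) S) R"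
      using *(2) i unfolding list_all2_conv_all_nth S_def by auto
    have "S \<in> poly_ring {..<length L}"
      using *(1) S(1) by (auto simp: homogeneous_reduced_basis_def reduced_groebner_basis_def
          relation_ideal_def)
    then have "psubst ((!) L) S \<in> alg" by (rule psubst_in_alg)
    then show ?thesis
      using S(2) alg_closed(2) f1'_power_mult_in_alg
      by (auto simp: f1'_quotient_def split: if_splits)
  qed
  then have "fold append_new Rs L = L"
    by (induction Rs) (auto simp: append_new_def)
  then show ?thesis using *(3) by simp
qed

lemma algorithm_loop_possible:
  assumes "of_weights n \<kappa> L ls" "homogeneous_reduced_basis L ls r Ss"
  shows "\<exists>L'. algorithm_loop n \<kappa> L L'"
proof -
  have "\<exists>R. if psubst ((!) L) S = 0 then R = 0
      else \<exists>\<nu>\<ge>1. f1'_quotient \<nu> (psubst ((!) L) S) R" if S: "S \<in> set Ss" for S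
  proof (cases "psubst ((!) L) S = 0")
    case False
    then obtain \<nu> R where R: "f1'_quotient \<nu> (psubst ((!) L) S) R" by (rule f1'_quotient_exists)
    \<comment> \<open>The algorithm asks for an exponent of at least 1; the syzygy supplies the
      divisibility.\<close>
    have "f1' dvd psubst ((!) L) S" using syzygy S by auto
    then have "\<nu> \<noteq> 0" using R by (cases \<nu>) (auto simp: f1'_quotient_def)
    then have "\<nu> \<ge> 1" by simp
    then show ?thesis using R False by (intro exI[of _ R]) (auto intro!: exI[of _ \<nu>])
  qed auto
  then obtain R where "\<And>S. S \<in> set Ss \<Longrightarrow> if psubst ((!) L) S = 0 then R S = 0
      else \<exists>\<nu>\<ge>1. f1'_quotient \<nu> (psubst ((!) L) S) (R S)" by metis
  then have "list_all2 (\<lambda>S R. if psubst ((!) L) S = 0 then R = 0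
          else \<exists>\<nu>\<ge>1. f1'_quotient \<nu> (psubst ((!) L) S) R) Ss (map R Ss)"
    by (auto simp: list_all2_conv_all_nth)
  then show ?thesis using assms ord unfolding algorithm_loop_def by blast
qed

section \<open>Existence and uniqueness of normal forms\<close>

lemma standard_monomials_eq:
  "length ls = length L \<Longrightarrow>
    standard_monomials ls r Ss d = {b \<in> standard_set (length L) r (set Ss). monom_weight ls b = d}"
  by (simp add: standard_monomials_def standard_set_def)

lemma normal_family_Suc:
  assumes "Poly_Mapping.keys N \<subseteq> standard_monomials ls r Ss (Suc m)"
    "Pt \<in> normal_families ls r Ss m"
  shows "case_nat N Pt \<in> normal_families ls r Ss (Suc m)"
  using assms by (auto simp: normal_families_def split: nat.splits)

lemma normal_sum_Suc:
  "normal_sum L (Suc m) Pt = psubst ((!) L) (Pt 0) + f1' * normal_sum L m (\<lambda>a. Pt (Suc a))"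
  by (simp add: normal_sum_def sum.atMost_Suc_shift sum_distrib_left mult.assoc del: sum.atMost_Suc)

text \<open>Split off the part free of \<open>f1'\<close>, reduce it by the basis and project to
  weight \<open>m\<close>. What remains is \<open>f1'\<close> times a polynomial of weight
  \<open>m - 1\<close>, and in weight 0 it vanishes.\<close>

lemma normal_sum_exists:
  assumes L: "list_all2 (\<lambda>P l. isobaric l P) L ls" and "P \<in> alg" "isobaric m P"
  shows "\<exists>Pt\<in>normal_families ls r Ss m. P = normal_sum L m Pt"
  using assms(2,3)
proof (induction m arbitrary: P)
  have len: "length ls = length L" using L by (simp add: list_all2_lengthD)
  have step: "\<exists>N a. Poly_Mapping.keys N \<subseteq> standard_monomials ls r Ss m \<and>
      P = psubst ((!) L) N + component jet_weight m (f1' * a)"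
    if P: "P \<in> alg" "isobaric m P" for P m
  proof -
    obtain T a where T: "T \<in> poly_ring {..<length L}" "P = psubst ((!) L) T + f1' * a"
      using alg_split[OF P(1)] by metis
    obtain N b where N: "Poly_Mapping.keys N \<subseteq> standard_set (length L) r (set Ss)"
      "psubst ((!) L) T = psubst ((!) L) N + f1' * b"
      using division[OF T(1)] by metis
    have "P = component jet_weight m P" using P(2) by (simp add: component_isobaric)
    also have "\<dots> = psubst ((!) L) (component (monom_weight ls) m N)
        + component jet_weight m (f1' * (b + a))"
      using N by (subst component_psubst[OF L, symmetric])
        (auto simp: T N(2) distrib_left keys_in_monomials standard_set_def)
    finally show ?thesis
      using N(1) by (intro exI[of _ "component (monom_weight ls) m N"] exI[of _ "b + a"])
        (auto simp: standard_monomials_eq[OF len] keys_component)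
  qed
  {
    case 0
    then obtain N a where "Poly_Mapping.keys N \<subseteq> standard_monomials ls r Ss 0"
      "P = psubst ((!) L) N + component jet_weight 0 (f1' * a)" using step by blast
    then show ?case
      by (intro bexI[of _ "\<lambda>a. if a = 0 then N else 0"])
        (auto simp: normal_sum_def normal_families_def component_f1'_mult)
  next
    case (Suc m)
    then obtain N a where N: "Poly_Mapping.keys N \<subseteq> standard_monomials ls r Ss (Suc m)"
      "P = psubst ((!) L) N + component jet_weight (Suc m) (f1' * a)" using step by blast
    let ?a = "component jet_weight m a"
    have P: "P = psubst ((!) L) N + f1' * ?a" using N(2) by (simp add: component_f1'_mult)
    have "N \<in> poly_ring {..<length L}"
      using N(1) by (auto simp: standard_monomials_eq[OF len] standard_set_def keys_in_monomials)
    \<comment> \<open>That the projection \<open>?a\<close> lies in \<open>alg\<close> is not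
      visible from \<open>a\<close>; it follows by saturation from
      \<open>f1' * ?a = P - psubst ((!) L) N\<close>.\<close>
    then have "P - psubst ((!) L) N \<in> alg"
      using Suc.prems(1) psubst_in_alg by (intro alg_closed) auto
    moreover have "P - psubst ((!) L) N = f1' * ?a" unfolding P by simp
    ultimately have "?a \<in> alg" using f1'_mult_in_alg by simp
    then obtain Pt where Pt: "Pt \<in> normal_families ls r Ss m" "?a = normal_sum L m Pt"
      using Suc.IH[of ?a] by auto
    then show ?case
      using normal_family_Suc[OF N(1) Pt(1)]
      by (intro bexI[of _ "case_nat N Pt"]) (simp_all add: normal_sum_Suc P)
  }
qed

text \<open>At \<open>f1' = 0\<close> only the terms with \<open>a = 0\<close> are left; their
  difference is a relation between standard monomials, hence zero. Then \<open>f1'\<close> is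
  cancelled and the weight drops by one.\<close>

lemma normal_sum_unique:
  assumes len: "length ls = length L"
    and "Pt \<in> normal_families ls r Ss m" "Qt \<in> normal_families ls r Ss m"
    and "normal_sum L m Pt = normal_sum L m Qt"
  shows "Pt = Qt"
  using assms(2-4)
proof (induction m arbitrary: Pt Qt)
  have first: "p = q" if pq: "Poly_Mapping.keys p \<subseteq> standard_monomials ls r Ss d"
    "Poly_Mapping.keys q \<subseteq> standard_monomials ls r Ss d"
    "restrict0 (psubst ((!) L) p) = restrict0 (psubst ((!) L) q)" for p q d
  proof -
    have keys: "Poly_Mapping.keys (p - q) \<subseteq> standard_set (length L) r (set Ss)"
      using keys_minus_subset[of p q] pq(1,2) by (auto simp: standard_monomials_eq[OF len])
    then have "p - q \<in> relation_ideal L"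
      using pq(3) by (auto simp: relation_ideal_iff keys_in_monomials standard_set_def)
    then have "p - q = 0"
      using keys by (intro standard_relation_eq_0[OF ord basis]) (auto simp: relation_ideal_def)
    then show ?thesis by simp
  qed
  {
    case 0
    then have "Pt 0 = Qt 0" by (intro first[of _ 0]) (auto simp: normal_families_def normal_sum_def)
    moreover have "Pt a = Qt a" if "a > 0" for a
      using 0 that by (simp add: normal_families_def)
    ultimately show ?case by (metis ext gr0I)
  next
    case (Suc m)
    have "restrict0 (normal_sum L (Suc m) Pt) = restrict0 (normal_sum L (Suc m) Qt)"
      using Suc.prems by simp
    then have eq0: "Pt 0 = Qt 0"
      using Suc.prems by (intro first[of _ "Suc m"])
        (auto simp: normal_families_def normal_sum_Suc dest!: spec[of _ 0])
    then have "normal_sum L m (\<lambda>a. Pt (Suc a)) = normal_sum L m (\<lambda>a. Qt (Suc a))"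
      using Suc.prems(3) by (auto simp: normal_sum_Suc dest: pvar_mult_cancel)
    moreover have "(\<lambda>a. Rt (Suc a)) \<in> normal_families ls r Ss m"
      if "Rt \<in> normal_families ls r Ss (Suc m)" for Rt
      using that by (auto simp: normal_families_def dest!: spec[of _ "Suc _"])
    ultimately have "(\<lambda>a. Pt (Suc a)) = (\<lambda>a. Qt (Suc a))"
      using Suc.prems by (intro Suc.IH) auto
    then show ?case using eq0 by (metis ext not0_implies_Suc)
  }
qed

end

section \<open>Normalisation of jets by reparametrization\<close>

text \<open>Realizes a finitely supported jet at 0 by an entire function, so that invariance, an
  identity between germs, can be read at any such point.\<close>

definition jet_poly :: "(nat \<Rightarrow> complex) \<Rightarrow> nat \<Rightarrow> complex \<Rightarrow> complex" where
  "jet_poly c K t = (\<Sum>j\<le>K. c j * t ^ j / fact j)"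

lemma jet_poly_0 [simp]: "jet_poly c K 0 = c 0"
proof -
  have "jet_poly c K 0 = (\<Sum>j\<le>K. if j = 0 then c 0 else 0)"
    unfolding jet_poly_def by (intro sum.cong) auto
  then show ?thesis by simp
qed

lemma jet_poly_has_field_derivative:
  assumes "\<And>j. j > K \<Longrightarrow> c j = 0"
  shows "(jet_poly c K has_field_derivative jet_poly (\<lambda>j. c (Suc j)) K t) (at t)"
proof -
  have "((\<lambda>t. \<Sum>j\<le>K. c j * t ^ j / fact j) has_field_derivative
      (\<Sum>j\<le>K. c j * (of_nat j * t ^ (j - 1)) / fact j)) (at t)"
    by (rule DERIV_sum) (auto intro!: derivative_eq_intros simp: One_nat_def)
  also have "(\<Sum>j\<le>K. c j * (of_nat j * t ^ (j - 1)) / fact j) = jet_poly (\<lambda>j. c (Suc j)) K t"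
  proof (cases K)
    case (Suc K')
    have "(\<Sum>j\<le>K. c j * (of_nat j * t ^ (j - 1)) / fact j)
        = (\<Sum>j\<le>K'. c (Suc j) * (of_nat (Suc j) * t ^ j) / fact (Suc j))"
      unfolding Suc by (subst sum.atMost_Suc_shift) simp
    also have "\<dots> = (\<Sum>j\<le>K'. c (Suc j) * t ^ j / fact j)"
      by (intro sum.cong refl) (simp del: of_nat_Suc)
    finally show ?thesis using assms Suc by (simp add: jet_poly_def)
  qed (use assms in \<open>simp add: jet_poly_def\<close>)
  finally show ?thesis by (simp add: jet_poly_def[abs_def])
qed

lemma higher_deriv_jet_poly:
  assumes "\<And>j. j > K \<Longrightarrow> c j = 0"
  shows "(deriv ^^ l) (jet_poly c K) = jet_poly (\<lambda>j. c (j + l)) K"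
proof (induction l)
  case (Suc l)
  have "deriv (jet_poly (\<lambda>j. c (j + l)) K) = jet_poly (\<lambda>j. c (Suc j + l)) K"
    by (intro ext DERIV_imp_deriv jet_poly_has_field_derivative) (use assms in auto)
  then show ?case using Suc by simp
qed simp

lemma jet_poly_holomorphic:
  assumes "\<And>j. j > K \<Longrightarrow> c j = 0" shows "jet_poly c K holomorphic_on S"
  using jet_poly_has_field_derivative[OF assms] by (meson holomorphic_onI
      field_differentiable_at_within field_differentiable_def)

lemma finite_support_bound:
  fixes x :: "nat \<times> nat \<Rightarrow> complex"
  assumes "finite {v. x v \<noteq> 0}" obtains K where "\<And>i l. l > K \<Longrightarrow> x (i, l) = 0"
proof
  fix i l assume l: "l > Max (insert 0 (snd ` {v. x v \<noteq> 0}))"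
  show "x (i, l) = 0"
  proof (rule ccontr)
    assume "x (i, l) \<noteq> 0"
    then have "l \<in> insert 0 (snd ` {v. x v \<noteq> 0})" by force
    then have "l \<le> Max (insert 0 (snd ` {v. x v \<noteq> 0}))" using assms by (intro Max_ge) auto
    then show False using l by simp
  qed
qed

lemma peval_total_diff:
  assumes "\<And>k l. ((\<lambda>t. X t (k, l)) has_field_derivative X t (k, Suc l)) (at t)"
  shows "((\<lambda>t. peval (X t) Q) has_field_derivative peval (X t) (total_diff Q)) (at t)"
proof -
  have "((\<lambda>t. peval (X t) Q) has_field_derivative
      (\<Sum>v\<in>pvars Q. peval (X t) (pderiv_var v Q) * X t (fst v, Suc (snd v)))) (at t)"
    by (rule peval_has_field_derivative[OF poly_ring_pvars finite_pvars]) (metis assms prod.collapse)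
  also have "(\<Sum>v\<in>pvars Q. peval (X t) (pderiv_var v Q) * X t (fst v, Suc (snd v)))
      = peval (X t) (total_diff Q)"
    by (simp add: total_diff_def peval_sum case_prod_unfold mult.commute)
  finally show ?thesis .
qed

lemma total_diff_f1': "total_diff f1' = jvar 1 2"
proof -
  have "pvars f1' = {(1, 1)}" by (simp add: pvars_def pvar_def)
  then show ?thesis by (simp add: total_diff_def numeral_2_eq_2 One_nat_def)
qed

text \<open>The brackets with \<open>f\<^sub>1'\<close> follow the derivatives of \<open>F = f\<^sub>i \<circ> \<phi>\<inverse>\<close>, where \<open>\<phi>\<close> is a primitive
  of \<open>f\<^sub>1'\<close>.\<close>

lemma peval_bracket_f1':
  assumes U: "open U" and \<phi>: "\<phi> holomorphic_on U" and V: "open V" "\<phi> ` U \<subseteq> V"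
    and X: "\<And>t k l. t \<in> U \<Longrightarrow> ((\<lambda>t. X t (k, l)) has_field_derivative X t (k, Suc l)) (at t)"
    and X1: "\<And>t. t \<in> U \<Longrightarrow> X t (1, 1) = deriv \<phi> t"
    and G: "G holomorphic_on V"
    and Q: "\<And>t. t \<in> U \<Longrightarrow> peval (X t) Q = deriv \<phi> t ^ p * G (\<phi> t)"
    and t: "t \<in> U"
  shows "peval (X t) (bracket p 1 Q f1') = deriv \<phi> t ^ (p + 2) * deriv G (\<phi> t)"
proof -
  have 1: "((\<lambda>t. peval (X t) Q) has_field_derivative peval (X t) (total_diff Q)) (at t)"
    by (rule peval_total_diff) (rule X[OF t])
  have d\<phi>: "(\<phi> has_field_derivative deriv \<phi> t) (at t)"
    by (rule holomorphic_derivI[OF \<phi> U t])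
  have "((\<lambda>t. X t (1, 1)) has_field_derivative X t (1, 2)) (at t)"
    using X[OF t, of 1 1] by (simp add: numeral_2_eq_2 One_nat_def)
  then have d2\<phi>: "(deriv \<phi> has_field_derivative X t (1, 2)) (at t)"
    by (rule has_field_derivative_transform_within_open[OF _ U t]) (simp add: X1)
  have dG: "(G has_field_derivative deriv G (\<phi> t)) (at (\<phi> t))"
    by (rule holomorphic_derivI[OF G V(1)]) (use V(2) t in auto)
  have "((\<lambda>t. deriv \<phi> t ^ p * G (\<phi> t)) has_field_derivative
      (of_nat p * (X t (1, 2) * deriv \<phi> t ^ (p - Suc 0))) * G (\<phi> t)
        + (deriv G (\<phi> t) * deriv \<phi> t) * deriv \<phi> t ^ p) (at t)"
    by (rule DERIV_mult[OF DERIV_power[OF d2\<phi>] DERIV_chain2[OF dG d\<phi>]])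
  then have "((\<lambda>t. peval (X t) Q) has_field_derivative
      (of_nat p * (X t (1, 2) * deriv \<phi> t ^ (p - Suc 0))) * G (\<phi> t)
        + (deriv G (\<phi> t) * deriv \<phi> t) * deriv \<phi> t ^ p) (at t)"
    by (rule has_field_derivative_transform_within_open[OF _ U t]) (simp add: Q)
  from DERIV_unique[OF 1 this] have D: "peval (X t) (total_diff Q) =
      (of_nat p * (X t (1, 2) * deriv \<phi> t ^ (p - Suc 0))) * G (\<phi> t)
        + (deriv G (\<phi> t) * deriv \<phi> t) * deriv \<phi> t ^ p" .
  \<comment> \<open>The bracket cancels the term in which the power of the derivative of \<phi> was
    differentiated, leaving \<open>deriv G\<close> with two more factors of that derivative.\<close>
  have "peval (X t) (bracket p 1 Q f1')
      = peval (X t) (total_diff Q) * deriv \<phi> t - of_nat p * (deriv \<phi> t ^ p * G (\<phi> t)) * X t (1, 2)"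
    by (simp add: bracket_def total_diff_f1' X1[OF t] Q[OF t])
  then show ?thesis
    unfolding D by (cases p) (simp_all add: algebra_simps power2_eq_square)
qed

text \<open>The new parameter is the first component itself, so the first row of the new jet becomes
  1, 0, 0, and so on. The iterated brackets turn into the higher derivatives of the other components
  in this parameter.\<close>

lemma reparam_normalization:
  assumes P: "reparam_invariant n \<kappa> m P" and fin: "finite {v. x v \<noteq> 0}" and x11: "x (1, 1) \<noteq> 0"
  obtains y where "peval x P = x (1, 1) ^ m * peval y P" "y (1, 1) = 1"
    "\<And>l. l \<ge> 2 \<Longrightarrow> y (1, l) = 0"
    "\<And>i l. l \<ge> 2 \<Longrightarrow> peval x (Lam i l) = x (1, 1) ^ (2 * l - 1) * y (i, l)"
proof -
  obtain K where K: "\<And>i l. l > K \<Longrightarrow> x (i, l) = 0"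
    using finite_support_bound[OF fin] by metis
  define h where "h i = jet_poly (\<lambda>l. x (i, l)) K" for i
  define X where "X t = (\<lambda>(i, l). (deriv ^^ l) (h i) t)" for t
  have hol_h: "h i holomorphic_on S" for i S
    unfolding h_def by (rule jet_poly_holomorphic) (rule K)
  have X0: "X 0 = x"
    by (auto simp: X_def h_def higher_deriv_jet_poly[OF K] fun_eq_iff)
  have X: "((\<lambda>t. X t (k, l)) has_field_derivative X t (k, Suc l)) (at t)" for k l t
    using holomorphic_derivI[OF holomorphic_higher_deriv[OF hol_h open_UNIV] open_UNIV]
    by (simp add: X_def)
  \<comment> \<open>The constant is subtracted because a local biholomorphism must fix 0.\<close>
  define \<phi> where "\<phi> t = h 1 t - x (1, 0)" for t
  have hol_\<phi>: "\<phi> holomorphic_on S" for S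
    unfolding \<phi>_def by (intro holomorphic_intros hol_h)
  have deriv_\<phi>: "deriv \<phi> t = X t (1, 1)" for t
    using X[of 1 0 t] unfolding \<phi>_def
    by (intro DERIV_imp_deriv) (auto intro!: derivative_eq_intros simp: X_def One_nat_def)
  have \<phi>0: "\<phi> 0 = 0" by (simp add: \<phi>_def h_def)
  obtain \<rho> where \<rho>: "\<rho> > 0" "inj_on \<phi> (ball 0 \<rho>)"
    using has_complex_derivative_locally_injective[OF hol_\<phi>[of UNIV], of 0] x11
    by (auto simp: deriv_\<phi> X0)
  define U V where "U = ball (0::complex) \<rho>" and "V = \<phi> ` U"
  have U: "open U" "0 \<in> U" using \<rho> by (auto simp: U_def)
  have V: "open V" "0 \<in> V"
    using open_mapping_thm3[OF hol_\<phi> U(1)] \<rho> U(2) \<phi>0 by (auto simp: U_def V_def intro!: image_eqI[of _ _ 0])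
  obtain \<psi> where \<psi>: "\<psi> holomorphic_on V" "\<And>z. z \<in> U \<Longrightarrow> \<psi> (\<phi> z) = z"
    using holomorphic_has_inverse[OF hol_\<phi> U(1)] \<rho>(2) unfolding U_def V_def by metis
  have "homeomorphism U V \<phi> \<psi>"
    unfolding homeomorphism_def V_def
    using \<psi> hol_\<phi>[of U] by (auto simp: V_def image_image holomorphic_on_imp_continuous_on)
  then have loc: "local_biholomorphism \<phi>"
    unfolding local_biholomorphism_def using U V \<psi> \<phi>0 hol_\<phi> by blast
  define f where "f i = h i \<circ> \<psi>" for i
  have hol_f: "f i holomorphic_on V" for i
    unfolding f_def by (rule holomorphic_on_compose[OF \<psi>(1) hol_h])
  have f\<phi>: "f i (\<phi> t) = h i t" if "t \<in> U" for i t
    using \<psi>(2)[OF that] by (simp add: f_def)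
  have ana: "f i analytic_on {0}" for i
    using hol_f V analytic_at by blast
  \<comment> \<open>Proved on all of \<open>U\<close> and not only at 0, because each bracket
    differentiates the preceding identity. The exponent is the weight of \<open>Lam_aux i k\<close>,
    which grows by 2 with every bracket.\<close>
  have Lam: "peval (X t) (Lam_aux i k) = deriv \<phi> t ^ (2 * k + 3) * (deriv ^^ (k + 2)) (f i) (\<phi> t)"
    if "t \<in> U" for t i k
    using that
  proof (induction k arbitrary: t)
    case 0
    have "peval (X t) (jvar i 1) = deriv \<phi> t ^ 1 * deriv (f i) (\<phi> t)" if t: "t \<in> U" for t
    proof -
      have "((\<lambda>t. f i (\<phi> t)) has_field_derivative deriv (f i) (\<phi> t) * deriv \<phi> t) (at t)"
        by (rule DERIV_chain2[OF holomorphic_derivI[OF hol_f V(1)] holomorphic_derivI[OF hol_\<phi> U(1) t]])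
          (use t in \<open>auto simp: V_def\<close>)
      then have "(h i has_field_derivative deriv (f i) (\<phi> t) * deriv \<phi> t) (at t)"
        by (rule has_field_derivative_transform_within_open[OF _ U(1) t]) (simp add: f\<phi>)
      then show ?thesis by (simp add: X_def One_nat_def DERIV_imp_deriv)
    qed
    from peval_bracket_f1'[OF U(1) hol_\<phi> V(1) _ X _ holomorphic_deriv[OF hol_f V(1)] this 0]
    show ?case by (simp add: deriv_\<phi> V_def numeral_2_eq_2 numeral_3_eq_3 One_nat_def)
  next
    case (Suc k)
    from peval_bracket_f1'[OF U(1) hol_\<phi> V(1) _ X _ holomorphic_higher_deriv[OF hol_f V(1)]
        Suc.IH Suc.prems]
    show ?case by (simp add: deriv_\<phi> V_def numeral_2_eq_2 numeral_3_eq_3 One_nat_def)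
  qed
  define y where "y = (\<lambda>(i, l). (deriv ^^ l) (f i) 0)"
  show ?thesis
  proof
    have "peval (\<lambda>(i, l). (deriv ^^ l) (f i \<circ> \<phi>) 0) P =
        deriv \<phi> 0 ^ m * peval (\<lambda>(i, l). (deriv ^^ l) (f i) (\<phi> 0)) P"
      using P ana loc unfolding reparam_invariant_def by (blast dest: eventually_nhds_x_imp_x)
    moreover have "(deriv ^^ l) (f i \<circ> \<phi>) 0 = (deriv ^^ l) (h i) 0" for i l
      by (rule higher_deriv_cong_ev) (use U f\<phi> in \<open>auto simp: eventually_nhds\<close>)
    ultimately show "peval x P = x (1, 1) ^ m * peval y P"
      by (simp add: \<phi>0 y_def deriv_\<phi> X0[symmetric]) (simp add: X_def)
    have "(deriv ^^ l) (f 1) 0 = (deriv ^^ l) (\<lambda>w. w + x (1, 0)) 0" for l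
    proof (rule higher_deriv_cong_ev)
      have "f 1 w = w + x (1, 0)" if "w \<in> V" for w
        using that f\<phi>[of _ 1] by (auto simp: V_def \<phi>_def)
      then show "\<forall>\<^sub>F w in nhds 0. f 1 w = w + x (1, 0)"
        using V by (auto simp: eventually_nhds)
    qed simp
    moreover have "deriv (\<lambda>w. w + x (1, 0)) = (\<lambda>_. 1)"
      by (intro ext DERIV_imp_deriv) (auto intro!: derivative_eq_intros)
    then have "(deriv ^^ Suc l) (\<lambda>w. w + x (1, 0)) = (deriv ^^ l) (\<lambda>_. 1)" for l
      by (simp add: funpow_Suc_right del: funpow.simps)
    moreover have "(deriv ^^ Suc l) (\<lambda>_. 1 :: complex) = (\<lambda>_. 0)" for l
      by (induction l) auto
    ultimately have y: "y (1, Suc l) = (if l = 0 then 1 else 0)" for l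
      by (cases l) (simp_all add: y_def del: funpow.simps(2))
    show "y (1, 1) = 1" using y[of 0] by (simp add: One_nat_def)
    show "y (1, l) = 0" if "l \<ge> 2" for l using y[of "l - 1"] that by simp
    show "peval x (Lam i l) = x (1, 1) ^ (2 * l - 1) * y (i, l)" if "l \<ge> 2" for i l
    proof -
      have "l - 2 + 2 = l" "2 * (l - 2) + 3 = 2 * l - 1" using that by auto
      then show ?thesis
        using Lam[OF U(2), of i "l - 2"] by (simp add: Lam_def X0 \<phi>0 deriv_\<phi> y_def)
    qed
  qed
qed

lemma lookup_psubst_scale:
  "Poly_Mapping.lookup (psubst (\<lambda>(i, l). pconst (2 ^ l) * jvar i l) P) k
     = 2 ^ jet_weight k * Poly_Mapping.lookup P k"
proof (induction P rule: cpoly_single_induct)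
  case (single m c)
  have eq: "mpower (\<lambda>(i, l). pconst (2 ^ l) * jvar i l) m = pconst (2 ^ jet_weight m) * mpower pvar m"
  proof -
    have pow: "pconst (2 ^ a) = pconst 2 ^ a" for a by (induction a) auto
    show ?thesis
      by (simp only: pow) (simp add: mpower_def case_prod_unfold power_mult_distrib prod.distrib
          jet_weight_def power_mult[symmetric] power_sum)
  qed
  then have "psubst (\<lambda>(i, l). pconst (2 ^ l) * jvar i l) (Poly_Mapping.single m c)
      = pconst (2 ^ jet_weight m) * Poly_Mapping.single m c"
    by (subst psubst_monomial, subst eq, subst single_mpower) (rule mult.left_commute)
  then show ?case by (simp add: lookup_single when_def)
qed (simp_all add: lookup_add distrib_left)

text \<open>Reparametrization by 2t multiplies a monomial of jet weight d by 2^d, while invariance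
  demands the factor 2^m; distinct powers of 2 differ.\<close>

lemma reparam_invariant_isobaric:
  assumes "reparam_invariant n \<kappa> m P" shows "isobaric m P"
proof -
  have scale: "psubst (\<lambda>(i, l). pconst (2 ^ l) * jvar i l) P = pconst (2 ^ m) * P"
  proof (rule peval_ext_finite)
    fix x :: "nat \<times> nat \<Rightarrow> complex" assume "finite {v. x v \<noteq> 0}"
    then obtain K where K: "\<And>i l. l > K \<Longrightarrow> x (i, l) = 0"
      using finite_support_bound by metis
    define h where "h i = jet_poly (\<lambda>l. x (i, l)) K" for i
    have hol: "h i holomorphic_on S" for i S
      unfolding h_def by (rule jet_poly_holomorphic) (rule K)
    have jet: "(deriv ^^ l) (h i) 0 = x (i, l)" for i l
      by (simp add: h_def higher_deriv_jet_poly[OF K])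
    have "range ((*) (2 :: complex)) = UNIV" by (rule surjI[of _ "\<lambda>t. t / 2"]) simp
    moreover have "range (\<lambda>t :: complex. t / 2) = UNIV" by (rule surjI[of _ "\<lambda>t. 2 * t"]) simp
    ultimately have "local_biholomorphism (\<lambda>t. 2 * t)"
      unfolding local_biholomorphism_def
      by (intro conjI exI[of _ UNIV] exI[of _ "\<lambda>t. t / 2"])
        (auto simp: homeomorphism_def intro!: continuous_intros holomorphic_intros)
    moreover have "h i analytic_on {0}" for i using hol analytic_at open_UNIV by blast
    ultimately have "peval (\<lambda>(i, l). (deriv ^^ l) (h i \<circ> (\<lambda>t. 2 * t)) 0) P =
        deriv (\<lambda>t. 2 * t) 0 ^ m * peval (\<lambda>(i, l). (deriv ^^ l) (h i) (2 * 0)) P"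
      using assms unfolding reparam_invariant_def by (blast dest: eventually_nhds_x_imp_x)
    moreover have "(deriv ^^ l) (h i \<circ> (\<lambda>t. 2 * t)) 0 = 2 ^ l * x (i, l)" for i l
      using higher_deriv_compose_linear[OF hol[of i UNIV] open_UNIV open_UNIV, of 0 2 l]
      by (simp add: comp_def jet)
    ultimately show "peval x (psubst (\<lambda>(i, l). pconst (2 ^ l) * jvar i l) P) = peval x (pconst (2 ^ m) * P)"
      by (simp add: peval_psubst jet case_prod_unfold)
  qed
  have pow: "a = b" if "(2 :: complex) ^ a = 2 ^ b" for a b
  proof -
    have "norm ((2 :: complex) ^ a) = norm ((2 :: complex) ^ b)" using that by simp
    then show ?thesis by (simp add: norm_power)
  qed
  have "2 ^ jet_weight k * Poly_Mapping.lookup P k = 2 ^ m * Poly_Mapping.lookup P k" for k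
    using arg_cong[OF scale, of "\<lambda>Q. Poly_Mapping.lookup Q k"]
    by (simp only: lookup_psubst_scale lookup_pconst_mult)
  then show ?thesis
    by (auto simp: isobaric_def in_keys_iff dest: pow)
qed

section \<open>The slice \<open>f\<^sub>1 = t\<close>, \<open>f\<^sub>i' = 0\<close>\<close>

text \<open>Polymorphic, so that it gives both the substitution defining \<open>slice\<close> and a
  point at which polynomials are evaluated.\<close>

definition slice_point :: "(nat \<times> nat \<Rightarrow> 'b::comm_ring_1) \<Rightarrow> nat \<times> nat \<Rightarrow> 'b" where
  "slice_point z = (\<lambda>(i, l). if i = 1 \<and> l = 1 then 1 else if i \<ge> 2 \<and> l \<ge> 2 then z (i, l) else 0)"

definition slice :: "jpoly \<Rightarrow> jpoly" where
  "slice P = psubst (slice_point pvar) P"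

lemma peval_slice: "peval z (slice P) = peval (slice_point z) P"
proof -
  have "(\<lambda>v. peval z (slice_point pvar v)) = slice_point z"
    by (auto simp: slice_point_def fun_eq_iff)
  then show ?thesis by (simp add: slice_def peval_psubst)
qed

lemma slice_in_poly_ring:
  assumes "P \<in> jet_ring n \<kappa>" shows "slice P \<in> poly_ring ({2..n} \<times> {2..\<kappa>})"
  unfolding slice_def
  by (rule psubst_in_poly_ring[OF assms[unfolded jet_ring_def]])
    (auto simp: slice_point_def intro!: poly_ring_pvar)

lemma peval_unipotent:
  assumes "unipotent_invariant P"
  shows "peval (\<lambda>(i, l). y (i, l) + (\<Sum>j\<in>{1..<i}. u i j * y (j, l))) P = peval y P"
proof -
  have "peval y P = peval y (psubst (\<lambda>(i, l). jvar i l + (\<Sum>j\<in>{1..<i}. pconst (u i j) * jvar j l)) P)"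
    using assms unfolding unipotent_invariant_def by metis
  then show ?thesis by (simp add: peval_psubst case_prod_unfold peval_sum)
qed

lemma UE_weight_slice:
  assumes P: "P \<in> UE_weight n \<kappa> m" and x: "finite {v. x v \<noteq> 0}" "x (1, 1) \<noteq> 0"
  obtains y where "peval x P = x (1, 1) ^ m * peval y (slice P)"
    "\<And>i l. l \<ge> 2 \<Longrightarrow> peval x (Lam i l) = x (1, 1) ^ (2 * l - 1) * y (i, l)"
proof -
  have inv: "reparam_invariant n \<kappa> m P" "unipotent_invariant P" "P \<in> jet_ring n \<kappa>"
    using P by (auto simp: UE_weight_def reparam_invariant_def)
  obtain y where y: "peval x P = x (1, 1) ^ m * peval y P" "y (1, 1) = 1"
    "\<And>l. l \<ge> 2 \<Longrightarrow> y (1, l) = 0"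
    "\<And>i l. l \<ge> 2 \<Longrightarrow> peval x (Lam i l) = x (1, 1) ^ (2 * l - 1) * y (i, l)"
    using reparam_normalization[OF inv(1) x] by metis
  \<comment> \<open>Subtracts \<open>y (i, 1)\<close> times row 1 from row \<open>i\<close>. The
    normalized row 1 is 1, 0, 0, and so on, so this clears order 1 and leaves the orders from 2 on,
    which the invariants \<open>Lam\<close> determine, unchanged.\<close>
  let ?u = "\<lambda>i j. if j = 1 then - y (i, 1) else 0"
  have "peval y P = peval (\<lambda>(i, l). y (i, l) + (\<Sum>j\<in>{1..<i}. ?u i j * y (j, l))) P"
    by (rule peval_unipotent[OF inv(2), symmetric])
  also have "\<dots> = peval (slice_point y) P"
  proof (rule peval_cong[OF inv(3)[unfolded jet_ring_def]], clarify)
    fix i l assume il: "i \<in> {1..n}" "l \<in> {1..\<kappa>}"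
    have "(\<Sum>j\<in>{1..<i}. ?u i j * y (j, l)) = (\<Sum>j\<in>{1..<i}. if j = 1 then - y (i, 1) * y (1, l) else 0)"
      by (intro sum.cong) auto
    also have "\<dots> = (if i \<ge> 2 then - y (i, 1) * y (1, l) else 0)"
      by auto
    finally show "y (i, l) + (\<Sum>j\<in>{1..<i}. ?u i j * y (j, l)) = slice_point y (i, l)"
      using il y(2) y(3)[of l]
      by (cases "l = 1"; cases "i = 1") (auto simp: slice_point_def)
  qed
  finally show ?thesis
    using y(1) by (intro that[of y] y(4)) (simp_all only: peval_slice)
qed

text \<open>The vector field that generates the addition of multiples of row \<open>i\<close> to row
  \<open>Suc i\<close>.\<close>

definition lower_row :: "nat set \<Rightarrow> nat \<Rightarrow> jpoly \<Rightarrow> jpoly" where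
  "lower_row \<Lambda> i Q = (\<Sum>l\<in>\<Lambda>. jvar i l * pderiv_var (Suc i, l) Q)"

lemma lower_row_slice:
  assumes P: "P \<in> jet_ring n \<kappa>" "unipotent_invariant P" and i: "i \<ge> 2"
  shows "lower_row {2..\<kappa>} i (slice P) = 0"
proof (cases "Suc i \<le> n")
  case False
  then show ?thesis
    unfolding lower_row_def using pderiv_var_not_in[OF slice_in_poly_ring[OF P(1)]] by simp
next
  case True
  let ?V = "{2..n} \<times> {2..\<kappa>}"
  show ?thesis
  proof (rule peval_eq_0_imp)
    fix z :: "nat \<times> nat \<Rightarrow> complex"
    \<comment> \<open>Adds \<open>u\<close> times row \<open>i\<close> to the next row. Since
      \<open>i\<close> is at least 2, row 1 is not involved and the slice is preserved, so the slice
      polynomial is constant in \<open>u\<close>; its derivative at \<open>u = 0\<close> is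
      \<open>lower_row\<close>.\<close>
    define Z where "Z u = (\<lambda>(a, l). z (a, l) + (if a = Suc i then u * z (i, l) else 0))" for u
    have const: "peval (Z u) (slice P) = peval z (slice P)" for u
    proof -
      have "slice_point (Z u) (a, l) = slice_point z (a, l)
          + (\<Sum>j\<in>{1..<a}. (if a = Suc i \<and> j = i then u else 0) * slice_point z (j, l))" for a l
      proof -
        have "(\<Sum>j\<in>{1..<a}. (if a = Suc i \<and> j = i then u else 0) * slice_point z (j, l))
            = (\<Sum>j\<in>{1..<a}. if j = i then (if a = Suc i then u * slice_point z (i, l) else 0) else 0)"
          by (intro sum.cong) auto
        also have "\<dots> = (if a = Suc i then u * slice_point z (i, l) else 0)"
          using i by auto
        finally show ?thesis using i by (auto simp: slice_point_def Z_def)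
      qed
      then have "slice_point (Z u) = (\<lambda>(a, l). slice_point z (a, l)
          + (\<Sum>j\<in>{1..<a}. (if a = Suc i \<and> j = i then u else 0) * slice_point z (j, l)))"
        by (auto simp: fun_eq_iff)
      then show ?thesis
        using peval_unipotent[OF P(2), of "slice_point z" "\<lambda>a j. if a = Suc i \<and> j = i then u else 0"]
        by (simp only: peval_slice)
    qed
    have "((\<lambda>u. peval (Z u) (slice P)) has_field_derivative
        (\<Sum>v\<in>?V. peval (Z 0) (pderiv_var v (slice P)) * (if fst v = Suc i then z (i, snd v) else 0))) (at 0)"
      by (rule peval_has_field_derivative[OF slice_in_poly_ring[OF P(1)]])
        (auto simp: Z_def intro!: derivative_eq_intros)
    moreover have "((\<lambda>u. peval (Z u) (slice P)) has_field_derivative 0) (at 0)"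
      by (simp add: const)
    ultimately have "(\<Sum>v\<in>?V. peval (Z 0) (pderiv_var v (slice P))
        * (if fst v = Suc i then z (i, snd v) else 0)) = 0"
      by (rule DERIV_unique)
    moreover have "Z 0 = z" by (auto simp: Z_def)
    moreover have "(\<Sum>v\<in>?V. peval z (pderiv_var v (slice P)) * (if fst v = Suc i then z (i, snd v) else 0))
        = (\<Sum>a\<in>{2..n}. \<Sum>l\<in>{2..\<kappa>}. peval z (pderiv_var (a, l) (slice P)) * (if a = Suc i then z (i, l) else 0))"
      by (simp add: sum.cartesian_product case_prod_unfold)
    moreover have "\<dots> = (\<Sum>a\<in>{2..n}. if a = Suc i then \<Sum>l\<in>{2..\<kappa>}. peval z (pderiv_var (a, l) (slice P)) * z (i, l) else 0)"
      by (intro sum.cong) auto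
    ultimately show "peval z (lower_row {2..\<kappa>} i (slice P)) = 0"
      using True i by (simp add: lower_row_def peval_sum mult.commute)
  qed
qed

section \<open>The initial invariants generate after inverting \<open>f\<^sub>1'\<close>\<close>

lemma pderiv_var_1 [simp]: "pderiv_var v 1 = 0"
  using pderiv_var_pconst[of v 1] by simp

lemma pderiv_var_commute:
  "pderiv_var v (pderiv_var w P) = pderiv_var w (pderiv_var v P)"
  using poly_ring_UNIV[of P] by (induction P rule: poly_ring_induct) (auto simp: algebra_simps)

text \<open>Commutator of a partial derivative with the vector field: the coefficients
  \<open>jvar i l\<close> are affected only by derivatives in row \<open>i\<close>, which leave a
  derivative in row \<open>Suc i\<close>.\<close>

lemma pderiv_var_lower_row:
  assumes "finite \<Lambda>"
  shows "pderiv_var v (lower_row \<Lambda> i Q) = lower_row \<Lambda> i (pderiv_var v Q)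
    + (if fst v = i \<and> snd v \<in> \<Lambda> then pderiv_var (Suc i, snd v) Q else 0)"
proof -
  have comm: "pderiv_var v (pderiv_var (Suc i, l) Q) = pderiv_var (Suc i, l) (pderiv_var v Q)" for l
    by (rule pderiv_var_commute)
  have "pderiv_var v (lower_row \<Lambda> i Q)
      = (\<Sum>l\<in>\<Lambda>. jvar i l * pderiv_var (Suc i, l) (pderiv_var v Q)
          + (if snd v = l then (if fst v = i then pderiv_var (Suc i, snd v) Q else 0) else 0))"
    unfolding lower_row_def pderiv_var_sum
    by (intro sum.cong refl) (auto simp: comm prod_eq_iff)
  then show ?thesis using assms by (simp add: lower_row_def sum.distrib)
qed

text \<open>Row 1 is fixed by the slice, so letter 0 stands for row 2. The orders \<open>c\<close>
  are separated from the row letters because the group moves only the latter.\<close>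

definition row_word :: "nat list \<Rightarrow> nat list \<Rightarrow> (nat \<times> nat) list" where
  "row_word w c = map2 (\<lambda>a l. (a + 2, l)) w c"

text \<open>Moving the vector field past all derivatives leaves one commutator for each position in
  row \<open>i + 2\<close>, which replaces the letter \<open>i\<close> by \<open>Suc i\<close>. The
  remaining term vanishes at 0, where the coefficients of the field are 0.\<close>

lemma taylor_coeff_lower_row:
  assumes "finite \<Lambda>" "length w = length c" "set c \<subseteq> \<Lambda>"
  shows "taylor_coeff (row_word w c) (lower_row \<Lambda> (i + 2) Q)
       = raise i (\<lambda>w. taylor_coeff (row_word w c) Q) w"
  using assms(2,3)
proof (induction w c arbitrary: Q rule: list_induct2)
  case Nil
  then show ?case by (simp add: row_word_def raise_def lower_row_def peval_sum)
next
  case (Cons a w l c)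
  then show ?case
    by (auto simp: row_word_def raise_Cons pderiv_var_lower_row[OF assms(1)])
qed

section \<open>Minors of the matrix of the invariants \<open>Lam\<close>\<close>

lemma sign_conjugate:
  assumes "finite S" "bij_betw b S T" "\<tau> permutes S"
  shows "sign (\<lambda>x. if x \<in> T then b (\<tau> (inv_into S b x)) else x) = sign \<tau>"
  using assms(3,1)
proof (induction rule: permutes_induct)
  case id
  have "(\<lambda>x. if x \<in> T then b (id (inv_into S b x)) else x) = id"
    using assms(2) by (auto simp: fun_eq_iff bij_betw_inv_into_right)
  then show ?case by simp
next
  case (swap a a' p)
  let ?c = "\<lambda>p x. if x \<in> T then b (p (inv_into S b x)) else x"
  have inj: "inj_on b S" "b ` S = T" using assms(2) by (auto simp: bij_betw_def)
  have eq: "?c (Transposition.transpose a a' \<circ> p) = Transposition.transpose (b a) (b a') \<circ> ?c p"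
  proof
    fix x
    show "?c (Transposition.transpose a a' \<circ> p) x = (Transposition.transpose (b a) (b a') \<circ> ?c p) x"
    proof (cases "x \<in> T")
      case True
      then have "p (inv_into S b x) \<in> S"
        using inj swap by (simp add: permutes_in_image inv_into_into)
      then show ?thesis
        using True swap inj_on_eq_iff[OF inj(1)] by (auto simp: Transposition.transpose_def)
    next
      case False
      then show ?thesis using swap inj by (auto simp: Transposition.transpose_def)
    qed
  qed
  have "?c p permutes T"
    by (rule permutes_bij_inv_into) (use swap assms in auto)
  moreover have "finite T" using assms bij_betw_finite by blast
  ultimately have perm: "permutation p" "permutation (?c p)"
    using swap assms(1) permutes_imp_permutation by blast+
  have "b a \<noteq> b a'" using inj swap by (auto simp: inj_on_def)
  then have "sign (Transposition.transpose (b a) (b a') \<circ> ?c p) = - sign (?c p)"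
    using perm by (subst sign_compose) (simp_all add: permutation_swap_id sign_swap_id)
  moreover have "sign (Transposition.transpose a a' \<circ> p) = - sign p"
    using perm swap by (subst sign_compose) (simp_all add: permutation_swap_id sign_swap_id)
  ultimately show ?case unfolding eq using swap by (simp add: comp_def)
qed

text \<open>\<open>Lam_det\<close> transposed, with its size shifted by one: rows are indexed by the
  entries of \<open>lams\<close>, so reordering \<open>lams\<close> permutes rows.\<close>

definition minor :: "nat \<Rightarrow> nat list \<Rightarrow> jpoly" where
  "minor p lams = Determinant.det (Matrix.mat p p (\<lambda>(s, i). Lam (i + 2) (lams ! s)))"

lemma minor_eq_Lam_det: "minor p lams = Lam_det (p + 1) lams"
proof -
  have eq: "Matrix.mat p p (\<lambda>(s, i). Lam (i + 2) (lams ! s))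
      = transpose_mat (Matrix.mat p p (\<lambda>(i, s). Lam (i + 2) (lams ! s)))"
    by (intro eq_matI) auto
  then show ?thesis
    unfolding minor_def Lam_det_def eq by (subst det_transpose[of _ p]) simp_all
qed

lemma minor_permute:
  assumes "\<sigma> permutes {..<p}" "length lams = p"
  shows "minor p (permute_list \<sigma> lams) = of_int (sign \<sigma>) * minor p lams"
proof -
  let ?M = "Matrix.mat p p (\<lambda>(s, i). Lam (i + 2) (lams ! s))"
  have \<sigma>: "\<sigma> permutes {0..<p}" using assms(1) by (simp add: atLeast0LessThan)
  have "Matrix.mat p p (\<lambda>(s, i). Lam (i + 2) (permute_list \<sigma> lams ! s))
      = Matrix.mat p p (\<lambda>(s, i). ?M $$ (\<sigma> s, i))"
    using assms permutes_in_image[OF assms(1)]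
    by (intro eq_matI) (auto simp: permute_list_nth)
  then show ?thesis
    unfolding minor_def using det_permute_rows[OF _ \<sigma>, of ?M] by simp
qed

text \<open>A tableau column yields orders in any sequence, possibly repeated, whereas the initial
  list has strictly increasing ones and is divided by powers of \<open>f1'\<close>. Repetitions give
  two equal rows, sorting costs a sign, and the power of \<open>f1'\<close> is multiplied back
  inside \<open>A\<close>.\<close>

lemma minor_in_subalgebra:
  assumes A: "subalgebra A" "f1' \<in> A" "initial_invariants n \<kappa> \<subseteq> A"
    and p: "p \<le> n - 1" "length lams = p" "set lams \<subseteq> {2..\<kappa>}"
  shows "minor p lams \<in> A"
proof (cases "distinct lams")
  case False
  then obtain i j where ij: "i \<noteq> j" "i < p" "j < p" "lams ! i = lams ! j"
    using p(2) by (auto simp: distinct_conv_nth)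
  have "minor p lams = 0"
    unfolding minor_def
    by (rule det_identical_rows[OF _ ij(1-3)]) (use ij in \<open>auto intro!: eq_vecI\<close>)
  then show ?thesis using subalgebra_closed(2)[OF A(1)] by simp
next
  case True
  have "minor p (sort lams) \<in> A"
  \<comment> \<open>The empty determinant is 1, and a zero minor has no quotient by a maximal power,
    so neither comes from the initial list.\<close>
  proof (cases "p = 0 \<or> minor p (sort lams) = 0")
    case True
    then have "minor p (sort lams) \<in> {0, 1}" by (auto simp: minor_def)
    then show ?thesis using subalgebra_closed(2,3)[OF A(1)] by auto
  next
    case False
    then obtain \<nu> Q where Q: "f1'_quotient \<nu> (minor p (sort lams)) Q"
      using f1'_quotient_exists by blast
    have "Q \<in> initial_invariants n \<kappa>"
      unfolding initial_invariants_def
    proof (intro CollectI exI conjI)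
      show "p + 1 \<in> {2..n}" using False p(1) by auto
      show "f1'_quotient \<nu> (Lam_det (p + 1) (sort lams)) Q" using Q by (simp add: minor_eq_Lam_det)
      show "sorted_wrt (<) (sort lams)" using True by (simp add: strict_sorted_iff)
    qed (use p in auto)
    then show ?thesis
      using Q A by (auto simp: f1'_quotient_def intro: subalgebra_closed[OF A(1)])
  qed
  moreover obtain \<sigma> where \<sigma>: "\<sigma> permutes {..<p}" "permute_list \<sigma> (sort lams) = lams"
    using mset_eq_permutation[of lams "sort lams"] p(2) by auto
  moreover have "(of_int k :: jpoly) \<in> A" for k
  proof -
    have "(of_int k :: jpoly) = pconst (of_int k)" by (simp add: pconst_def single_of_int)
    then show ?thesis using subalgebra_closed(1)[OF A(1)] by simp
  qed
  ultimately show ?thesis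
    using minor_permute[OF \<sigma>(1), of "sort lams"] p(2) by (auto intro: subalgebra_closed[OF A(1)])
qed

text \<open>Relabelling the positions in \<open>S\<close> by their letters \<open>b\<close> turns
  the alternating sum into the Leibniz formula, and conjugation by a relabelling preserves
  signs.\<close>

lemma alternating_sum_eq_minor:
  assumes "finite S" "bij_betw b S {..<p}"
  shows "alternating_sum {\<tau>. \<tau> permutes S} S (\<lambda>y q. Lam (b y + 2) (c ! q))
    = minor p (map (\<lambda>s. c ! inv_into S b s) [0..<p])"
proof -
  let ?e = "inv_into S b"
  let ?conj = "\<lambda>\<tau> x. if x \<in> {..<p} then b (\<tau> (?e x)) else x"
  have e: "bij_betw ?e {..<p} S" by (rule bij_betw_inv_into[OF assms(2)])
  have "minor p (map (\<lambda>s. c ! ?e s) [0..<p]) = (\<Sum>\<pi> | \<pi> permutes {..<p}.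
      of_int (sign \<pi>) * (\<Prod>s<p. Lam (\<pi> s + 2) (c ! ?e s)))"
  proof -
    have "(\<Prod>s = 0..<p. Matrix.mat p p (\<lambda>(s, i). Lam (i + 2) (map (\<lambda>s. c ! ?e s) [0..<p] ! s)) $$ (s, \<pi> s))
        = (\<Prod>s<p. Lam (\<pi> s + 2) (c ! ?e s))" if "\<pi> permutes {..<p}" for \<pi>
      unfolding atLeast0LessThan
      by (intro prod.cong refl) (use permutes_in_image[OF that] in auto)
    then show ?thesis
      unfolding minor_def by (subst det_def'[of _ p]) (auto simp: atLeast0LessThan intro!: sum.cong)
  qed
  also have "\<dots> = (\<Sum>\<tau> | \<tau> permutes S. of_int (sign (?conj \<tau>)) * (\<Prod>s<p. Lam (?conj \<tau> s + 2) (c ! ?e s)))"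
    by (rule sum.reindex_bij_betw[OF bij_betw_permutations[OF assms(2)], symmetric])
  also have "\<dots> = (\<Sum>\<tau> | \<tau> permutes S. of_int (sign \<tau>) * (\<Prod>q\<in>S. Lam (b (\<tau> q) + 2) (c ! q)))"
  proof (intro sum.cong refl)
    fix \<tau> assume "\<tau> \<in> {\<tau>. \<tau> permutes S}"
    then have "sign (?conj \<tau>) = sign \<tau>" using sign_conjugate[OF assms] by simp
    moreover have "(\<Prod>s<p. Lam (?conj \<tau> s + 2) (c ! ?e s)) = (\<Prod>s<p. Lam (b (\<tau> (?e s)) + 2) (c ! ?e s))"
      by (intro prod.cong) auto
    moreover have "\<dots> = (\<Prod>q\<in>S. Lam (b (\<tau> q) + 2) (c ! q))"
      by (rule prod.reindex_bij_betw[OF e])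
    ultimately show "of_int (sign (?conj \<tau>)) * (\<Prod>s<p. Lam (?conj \<tau> s + 2) (c ! ?e s))
        = of_int (sign \<tau>) * (\<Prod>q\<in>S. Lam (b (\<tau> q) + 2) (c ! q))" by simp
  qed
  finally show ?thesis by (simp add: alternating_sum_def)
qed

text \<open>For fixed orders \<open>c\<close> the Taylor coefficients of the slice are a tensor in
  the row letters, annihilated by all \<open>raise i\<close>. Substituting
  \<open>Lam (a + 2) (c ! q)\<close> for the letter \<open>a\<close> in position \<open>q\<close>
  turns the minors into the determinants of the initial list.\<close>

lemma slice_tensor_in_subalgebra:
  assumes A: "subalgebra A" "f1' \<in> A" "initial_invariants n \<kappa> \<subseteq> A"
    and P: "P \<in> jet_ring n \<kappa>" "unipotent_invariant P" and c: "set c \<subseteq> {2..\<kappa>}"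
  shows "(\<Sum>w | set w \<subseteq> {..<n - 1} \<and> length w = length c.
      pconst (taylor_coeff (row_word w c) (slice P)) * (\<Prod>q<length c. Lam (w ! q + 2) (c ! q))) \<in> A"
proof -
  \<comment> \<open>\<open>row_word\<close> cuts the longer list off, so words of the wrong length
    would still get a value; they are set to 0 to bound the support.\<close>
  define F where "F w = (if length w = length c then taylor_coeff (row_word w c) (slice P) else 0)" for w
  have "(\<Sum>w | set w \<subseteq> {..<n - 1} \<and> length w = length c.
      pconst (F w) * (\<Prod>q<length c. Lam (w ! q + 2) (c ! q))) \<in> A"
  proof (rule tensor_invariants_generated_by_minors[OF A(1)])
    fix S b p assume S: "S \<subseteq> {..<length c}" "bij_betw b S {..<p}" "p \<le> n - 1"
    have fin: "finite S" using S(1) finite_subset by blast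
    have "c ! inv_into S b s \<in> {2..\<kappa>}" if "s < p" for s
    proof -
      have "inv_into S b s \<in> S" using S(2) that by (intro inv_into_into) (auto simp: bij_betw_def)
      then show ?thesis using S(1) c by (meson lessThan_iff nth_mem subsetD)
    qed
    then have "minor p (map (\<lambda>s. c ! inv_into S b s) [0..<p]) \<in> A"
      by (intro minor_in_subalgebra[OF A S(3)]) auto
    then show "alternating_sum {\<tau>. \<tau> permutes S} S (\<lambda>y q. Lam (b y + 2) (c ! q)) \<in> A"
      by (simp only: alternating_sum_eq_minor[OF fin S(2)])
  next
    fix i and w :: "nat list" assume w: "length w = length c"
    have "raise i F w = raise i (\<lambda>w. taylor_coeff (row_word w c) (slice P)) w"
      by (rule raise_cong) (simp add: F_def w)
    also have "\<dots> = taylor_coeff (row_word w c) (lower_row {2..\<kappa>} (i + 2) (slice P))"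
      by (rule taylor_coeff_lower_row[symmetric]) (use w c in auto)
    also have "\<dots> = 0" by (simp add: lower_row_slice[OF P])
    finally show "raise i F w = 0" .
  next
    fix w assume "F w \<noteq> 0"
    then have len: "length w = length c" and "taylor_coeff (row_word w c) (slice P) \<noteq> 0"
      by (auto simp: F_def split: if_splits)
    then have "set (row_word w c) \<subseteq> {2..n} \<times> {2..\<kappa>}"
      using taylor_coeff_not_in[OF slice_in_poly_ring[OF P(1)]] by blast
    moreover have "a \<in> set w \<Longrightarrow> a + 2 \<in> fst ` set (row_word w c)" for a
      using len by (force simp: row_word_def set_zip in_set_conv_nth image_iff)
    ultimately show "length w = length c \<and> set w \<subseteq> {..<n - 1}"
      using len by fastforce
  qed
  moreover have "(\<Sum>w | set w \<subseteq> {..<n - 1} \<and> length w = length c.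
      pconst (F w) * (\<Prod>q<length c. Lam (w ! q + 2) (c ! q)))
    = (\<Sum>w | set w \<subseteq> {..<n - 1} \<and> length w = length c.
      pconst (taylor_coeff (row_word w c) (slice P)) * (\<Prod>q<length c. Lam (w ! q + 2) (c ! q)))"
    by (intro sum.cong) (auto simp: F_def)
  ultimately show ?thesis by simp
qed

section \<open>Clearing the denominators\<close>

lemma sum_row_words:
  "(\<Sum>vs | set vs \<subseteq> {2..n} \<times> {2..\<kappa>} \<and> length vs = e. g vs)
     = (\<Sum>c | set c \<subseteq> {2..\<kappa>} \<and> length c = e.
          \<Sum>w | set w \<subseteq> {..<n - 1} \<and> length w = e. g (row_word w c))"
proof -
  let ?C = "{c. set c \<subseteq> {2..\<kappa>} \<and> length c = e}" and ?W = "{w. set w \<subseteq> {..<n - 1} \<and> length w = e}"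
  have "(\<Sum>vs | set vs \<subseteq> {2..n} \<times> {2..\<kappa>} \<and> length vs = e. g vs)
      = (\<Sum>(c, w)\<in>?C \<times> ?W. g (row_word w c))"
  proof (rule sum.reindex_bij_witness[where i = "\<lambda>(c, w). row_word w c"
        and j = "\<lambda>vs. (map snd vs, map (\<lambda>v. fst v - 2) vs)"])
    fix vs assume vs: "vs \<in> {vs. set vs \<subseteq> {2..n} \<times> {2..\<kappa>} \<and> length vs = e}"
    have mem: "2 \<le> fst v \<and> fst v \<le> n \<and> snd v \<in> {2..\<kappa>}" if "v \<in> set vs" for v
    proof -
      have "v \<in> {2..n} \<times> {2..\<kappa>}" using vs that by blast
      then show ?thesis by (auto simp: mem_Times_iff)
    qed
    have fst: "Suc (Suc (fst (vs ! q) - 2)) = fst (vs ! q)" if "q < length vs" for q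
      using mem[OF nth_mem[OF that]] by arith
    show eq: "(case (map snd vs, map (\<lambda>v. fst v - 2) vs) of (c, w) \<Rightarrow> row_word w c) = vs"
      by (rule nth_equalityI) (auto simp: row_word_def fst prod_eq_iff)
    show "(map snd vs, map (\<lambda>v. fst v - 2) vs) \<in> ?C \<times> ?W"
      using vs mem by (fastforce simp: less_diff_conv2)
    show "(case (map snd vs, map (\<lambda>v. fst v - 2) vs) of (c, w) \<Rightarrow> g (row_word w c)) = g vs"
      using eq by simp
  next
    fix x assume "x \<in> ?C \<times> ?W"
    then obtain c w where x: "x = (c, w)" "set c \<subseteq> {2..\<kappa>}" "length c = e"
      "set w \<subseteq> {..<n - 1}" "length w = e" by auto
    show "(map snd (case x of (c, w) \<Rightarrow> row_word w c),
        map (\<lambda>v. fst v - 2) (case x of (c, w) \<Rightarrow> row_word w c)) = x"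
      using x by (auto simp: row_word_def intro!: nth_equalityI)
    have "a + 2 \<in> {2..n}" if "a < n - 1" for a using that by auto
    then show "(case x of (c, w) \<Rightarrow> row_word w c) \<in> {vs. set vs \<subseteq> {2..n} \<times> {2..\<kappa>} \<and> length vs = e}"
      using x by (force simp: row_word_def dest: set_zip_leftD set_zip_rightD)
  qed
  then show ?thesis by (simp add: sum.cartesian_product)
qed

lemma peval_prod_list: "peval x (prod_list ps) = prod_list (map (peval x) ps)"
  by (induction ps) auto

text \<open>Where \<open>f1'\<close> is nonzero, the slice coordinate \<open>y (i, l)\<close> is
  \<open>Lam i l\<close> divided by the power \<open>2 * l - 1\<close> of \<open>f1'\<close>.
  Inserting this in the Taylor expansion of the slice and clearing denominators leaves a combination
  of the tensors above.\<close>

lemma UE_weight_localization: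
  assumes A: "subalgebra A" "f1' \<in> A" "initial_invariants n \<kappa> \<subseteq> A" and P: "P \<in> UE_weight n \<kappa> m"
  shows "\<exists>N. f1' ^ N * P \<in> A"
proof -
  let ?V = "{2..n} \<times> {2..\<kappa>}" and ?S = "slice P"
  have P': "P \<in> jet_ring n \<kappa>" "unipotent_invariant P"
    using P by (auto simp: UE_weight_def reparam_invariant_def)
  obtain D where D: "\<And>k. k \<in> Poly_Mapping.keys ?S \<Longrightarrow> mdegree k \<le> D"
    using exists_mdegree_bound by metis
  \<comment> \<open>\<open>wt vs\<close> is the exponent of \<open>f1'\<close> in the denominator
    belonging to \<open>vs\<close>. With at most \<open>D\<close> factors, each of exponent below
    \<open>2 * \<kappa>\<close>, the common exponent \<open>N\<close> suffices.\<close>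
  define wt where "wt vs = (\<Sum>l\<leftarrow>map snd vs. 2 * l - 1)" for vs :: "(nat \<times> nat) list"
  define N where "N = D * (2 * \<kappa>)"
  have wt_le: "wt vs \<le> N" if "set vs \<subseteq> ?V" "length vs \<le> D" for vs
  proof -
    have "wt vs \<le> length vs * (2 * \<kappa>)"
      using that(1) by (induction vs) (auto simp: wt_def)
    also have "\<dots> \<le> N" unfolding N_def by (intro mult_right_mono that(2)) simp
    finally show ?thesis .
  qed
  define R where "R = f1' ^ m * (\<Sum>e\<le>D. pconst (1 / fact e) * (\<Sum>vs | set vs \<subseteq> ?V \<and> length vs = e.
      pconst (taylor_coeff vs ?S) * (f1' ^ (N - wt vs) * prod_list (map (\<lambda>v. Lam (fst v) (snd v)) vs))))"
  have "R \<in> A"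
  proof -
    have inner: "(\<Sum>w | set w \<subseteq> {..<n - 1} \<and> length w = e. pconst (taylor_coeff (row_word w c) ?S) *
        (f1' ^ (N - wt (row_word w c)) * prod_list (map (\<lambda>v. Lam (fst v) (snd v)) (row_word w c)))) \<in> A"
      if c: "set c \<subseteq> {2..\<kappa>}" "length c = e" for c e
    proof -
      \<comment> \<open>The denominator depends only on the orders \<open>c\<close>, hence factors
        out of the sum over the row words and leaves the invariant tensor.\<close>
      let ?k = "N - (\<Sum>l\<leftarrow>c. 2 * l - 1)"
      have "(\<Sum>w | set w \<subseteq> {..<n - 1} \<and> length w = e. pconst (taylor_coeff (row_word w c) ?S) *
          (f1' ^ (N - wt (row_word w c)) * prod_list (map (\<lambda>v. Lam (fst v) (snd v)) (row_word w c))))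
        = f1' ^ ?k * (\<Sum>w | set w \<subseteq> {..<n - 1} \<and> length w = length c.
          pconst (taylor_coeff (row_word w c) ?S) * (\<Prod>q<length c. Lam (w ! q + 2) (c ! q)))"
        unfolding sum_distrib_left
      proof (intro sum.cong)
        fix w assume "w \<in> {w. set w \<subseteq> {..<n - 1} \<and> length w = length c}"
        then have w: "length w = length c" by simp
        have "map snd (row_word w c) = c"
          by (rule nth_equalityI) (auto simp: row_word_def w)
        moreover have "prod_list (map (\<lambda>v. Lam (fst v) (snd v)) (row_word w c))
            = (\<Prod>q<length c. Lam (w ! q + 2) (c ! q))"
          unfolding prod.list_conv_set_nth
          by (rule prod.cong) (auto simp: row_word_def w)
        ultimately show "pconst (taylor_coeff (row_word w c) ?S) *
            (f1' ^ (N - wt (row_word w c)) * prod_list (map (\<lambda>v. Lam (fst v) (snd v)) (row_word w c)))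
          = f1' ^ ?k * (pconst (taylor_coeff (row_word w c) ?S) * (\<Prod>q<length c. Lam (w ! q + 2) (c ! q)))"
          by (simp only: wt_def) (rule mult.left_commute)
      qed (simp add: c)
      also have "\<dots> \<in> A"
        using slice_tensor_in_subalgebra[OF A P' c(1)]
        by (intro subalgebra_closed(5,8)[OF A(1)] A(2))
      finally show ?thesis .
    qed
    have "(\<Sum>vs | set vs \<subseteq> ?V \<and> length vs = e. pconst (taylor_coeff vs ?S) *
        (f1' ^ (N - wt vs) * prod_list (map (\<lambda>v. Lam (fst v) (snd v)) vs))) \<in> A" for e
      unfolding sum_row_words by (rule subalgebra_sum[OF A(1)]) (use inner in blast)
    then have "(\<Sum>e\<le>D. pconst (1 / fact e) * (\<Sum>vs | set vs \<subseteq> ?V \<and> length vs = e.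
        pconst (taylor_coeff vs ?S) *
        (f1' ^ (N - wt vs) * prod_list (map (\<lambda>v. Lam (fst v) (snd v)) vs)))) \<in> A"
      by (blast intro: subalgebra_sum[OF A(1)] subalgebra_closed(1,5)[OF A(1)])
    then show ?thesis
      unfolding R_def by (rule subalgebra_closed(5)[OF A(1) subalgebra_closed(8)[OF A(1,2)]])
  qed
  moreover have "f1' * (f1' ^ N * P) = f1' * R"
  proof (rule peval_ext_finite)
    fix x :: "nat \<times> nat \<Rightarrow> complex" assume fin: "finite {v. x v \<noteq> 0}"
    show "peval x (f1' * (f1' ^ N * P)) = peval x (f1' * R)"
    proof (cases "x (1, 1) = 0")
      case False
      let ?a = "x (1, 1)"
      obtain y where y: "peval x P = ?a ^ m * peval y ?S"
        "\<And>i l. l \<ge> 2 \<Longrightarrow> peval x (Lam i l) = ?a ^ (2 * l - 1) * y (i, l)"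
        using UE_weight_slice[OF P fin False] by metis
      have Lam: "prod_list (map (\<lambda>v. peval x (Lam (fst v) (snd v))) vs) = ?a ^ wt vs * prod_list (map y vs)"
        if "set vs \<subseteq> ?V" for vs
        using that by (induction vs) (auto simp: wt_def y(2) power_add mult_ac)
      have eq: "?a ^ N * prod_list (map y vs)
          = ?a ^ (N - wt vs) * prod_list (map (\<lambda>v. peval x (Lam (fst v) (snd v))) vs)"
        if "set vs \<subseteq> ?V" "length vs \<le> D" for vs
        using wt_le[OF that] by (simp add: Lam[OF that(1)] mult.assoc[symmetric] power_add[symmetric])
      have "?a ^ N * peval y ?S = (\<Sum>e\<le>D. (1 / fact e) * (\<Sum>vs | set vs \<subseteq> ?V \<and> length vs = e.
          taylor_coeff vs ?S * (?a ^ N * prod_list (map y vs))))"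
        by (subst taylor_expansion[OF _ slice_in_poly_ring[OF P'(1)] D])
          (simp_all add: peval_sum peval_prod_list comp_def sum_distrib_left mult_ac)
      also have "\<dots> = (\<Sum>e\<le>D. (1 / fact e) * (\<Sum>vs | set vs \<subseteq> ?V \<and> length vs = e.
          taylor_coeff vs ?S * (?a ^ (N - wt vs) * prod_list (map (\<lambda>v. peval x (Lam (fst v) (snd v))) vs))))"
        by (rule sum.cong[OF refl], rule arg_cong[where f = "(*) _"], rule sum.cong[OF refl]) (simp add: eq)
      finally have "?a ^ N * peval x P = peval x R"
        by (simp add: R_def y(1) peval_sum peval_prod_list comp_def mult.left_commute[of "?a ^ N"])
      then show ?thesis by simp
    qed simp
  qed
  ultimately show ?thesis using pvar_mult_cancel by metis
qed

section \<open>The bi-invariants form a graded algebra\<close>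

lemma UE_weight_pconst: "pconst c \<in> UE_weight n \<kappa> 0"
  by (simp add: UE_weight_def reparam_invariant_def unipotent_invariant_def jet_ring_def)

lemma UE_weight_0: "0 \<in> UE_weight n \<kappa> m"
  by (simp add: UE_weight_def reparam_invariant_def unipotent_invariant_def jet_ring_def)

lemma UE_weightI:
  assumes "P \<in> jet_ring n \<kappa>"
    and "\<And>f \<phi>. \<forall>i\<in>{1..n}. f i analytic_on {0} \<Longrightarrow> local_biholomorphism \<phi> \<Longrightarrow>
      \<forall>\<^sub>F t in nhds 0. peval (\<lambda>(i, l). (deriv ^^ l) (f i \<circ> \<phi>) t) P =
        deriv \<phi> t ^ m * peval (\<lambda>(i, l). (deriv ^^ l) (f i) (\<phi> t)) P"
    and "\<And>u. psubst (\<lambda>(i, l). jvar i l + (\<Sum>j\<in>{1..<i}. pconst (u i j) * jvar j l)) P = P"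
  shows "P \<in> UE_weight n \<kappa> m"
  using assms by (simp add: UE_weight_def reparam_invariant_def unipotent_invariant_def)

lemma UE_weightD:
  assumes "P \<in> UE_weight n \<kappa> m"
  shows "P \<in> jet_ring n \<kappa>"
    and "\<forall>i\<in>{1..n}. f i analytic_on {0} \<Longrightarrow> local_biholomorphism \<phi> \<Longrightarrow>
      \<forall>\<^sub>F t in nhds 0. peval (\<lambda>(i, l). (deriv ^^ l) (f i \<circ> \<phi>) t) P =
        deriv \<phi> t ^ m * peval (\<lambda>(i, l). (deriv ^^ l) (f i) (\<phi> t)) P"
    and "psubst (\<lambda>(i, l). jvar i l + (\<Sum>j\<in>{1..<i}. pconst (u i j) * jvar j l)) P = P"
  using assms by (simp_all add: UE_weight_def reparam_invariant_def unipotent_invariant_def)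

lemma UE_weight_add:
  assumes "P \<in> UE_weight n \<kappa> m" "Q \<in> UE_weight n \<kappa> m" shows "P + Q \<in> UE_weight n \<kappa> m"
proof (rule UE_weightI)
  show "P + Q \<in> jet_ring n \<kappa>"
    using assms[THEN UE_weightD(1)] by (simp add: jet_ring_def poly_ring_add)
next
  fix f :: "nat \<Rightarrow> complex \<Rightarrow> complex" and \<phi>
  assume H: "\<forall>i\<in>{1..n}. f i analytic_on {0}" "local_biholomorphism \<phi>"
  show "\<forall>\<^sub>F t in nhds 0. peval (\<lambda>(i, l). (deriv ^^ l) (f i \<circ> \<phi>) t) (P + Q) =
      deriv \<phi> t ^ m * peval (\<lambda>(i, l). (deriv ^^ l) (f i) (\<phi> t)) (P + Q)"
    using UE_weightD(2)[OF assms(1) H] UE_weightD(2)[OF assms(2) H]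
    by eventually_elim (simp add: distrib_left)
qed (simp add: UE_weightD(3)[OF assms(1)] UE_weightD(3)[OF assms(2)])

lemma UE_weight_mult:
  assumes "P \<in> UE_weight n \<kappa> a" "Q \<in> UE_weight n \<kappa> b" shows "P * Q \<in> UE_weight n \<kappa> (a + b)"
proof (rule UE_weightI)
  show "P * Q \<in> jet_ring n \<kappa>"
    using assms[THEN UE_weightD(1)] by (simp add: jet_ring_def poly_ring_mult)
next
  fix f :: "nat \<Rightarrow> complex \<Rightarrow> complex" and \<phi>
  assume H: "\<forall>i\<in>{1..n}. f i analytic_on {0}" "local_biholomorphism \<phi>"
  show "\<forall>\<^sub>F t in nhds 0. peval (\<lambda>(i, l). (deriv ^^ l) (f i \<circ> \<phi>) t) (P * Q) =
      deriv \<phi> t ^ (a + b) * peval (\<lambda>(i, l). (deriv ^^ l) (f i) (\<phi> t)) (P * Q)"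
    using UE_weightD(2)[OF assms(1) H] UE_weightD(2)[OF assms(2) H]
    by eventually_elim (simp add: power_add)
qed (simp add: UE_weightD(3)[OF assms(1)] UE_weightD(3)[OF assms(2)])

lemma UE_weight_sum: "(\<And>i. i \<in> I \<Longrightarrow> f i \<in> UE_weight n \<kappa> m) \<Longrightarrow> sum f I \<in> UE_weight n \<kappa> m"
  by (induction I rule: infinite_finite_induct) (auto intro: UE_weight_0 UE_weight_add)

lemma UE_weight_power: "P \<in> UE_weight n \<kappa> a \<Longrightarrow> P ^ k \<in> UE_weight n \<kappa> (a * k)"
  using UE_weight_pconst[of 1] by (induction k) (auto intro: UE_weight_mult)

lemma UE_weight_prod:
  "(\<And>i. i \<in> I \<Longrightarrow> f i \<in> UE_weight n \<kappa> (a i)) \<Longrightarrow> (\<Prod>i\<in>I. f i) \<in> UE_weight n \<kappa> (\<Sum>i\<in>I. a i)"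
  using UE_weight_pconst[of 1]
  by (induction I rule: infinite_finite_induct) (auto intro: UE_weight_mult)

lemma UE_weight_f1':
  assumes "n \<ge> 1" "\<kappa> \<ge> 1" shows "f1' \<in> UE_weight n \<kappa> 1"
proof -
  have "\<forall>\<^sub>F t in nhds 0. deriv (f 1 \<circ> \<phi>) t = deriv \<phi> t * deriv (f 1) (\<phi> t)"
    if f: "\<forall>i\<in>{1..n}. f i analytic_on {0}" and \<phi>: "local_biholomorphism \<phi>" for f \<phi>
  proof -
    have "f 1 analytic_on {0}" using f assms(1) by auto
    then obtain W where W: "open W" "0 \<in> W" "f 1 holomorphic_on W"
      by (auto simp: analytic_at)
    obtain U where U: "open U" "0 \<in> U" "\<phi> holomorphic_on U" "\<phi> 0 = 0"
      using \<phi> by (auto simp: local_biholomorphism_def)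
    have "open (U \<inter> \<phi> -` W)"
      using U W by (intro continuous_open_preimage holomorphic_on_imp_continuous_on)
    moreover have "deriv (f 1 \<circ> \<phi>) t = deriv \<phi> t * deriv (f 1) (\<phi> t)" if "t \<in> U \<inter> \<phi> -` W" for t
    proof -
      have "(f 1 \<circ> \<phi> has_field_derivative deriv (f 1) (\<phi> t) * deriv \<phi> t) (at t)"
        using that U W by (intro DERIV_chain holomorphic_derivI[of _ W] holomorphic_derivI[of _ U]) auto
      then show ?thesis by (simp add: DERIV_imp_deriv mult.commute)
    qed
    ultimately show ?thesis using U W by (auto simp: eventually_nhds intro!: exI[of _ "U \<inter> \<phi> -` W"])
  qed
  then show ?thesis
    using assms
    by (simp add: UE_weight_def reparam_invariant_def unipotent_invariant_def jet_ring_def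
        poly_ring_pvar One_nat_def)
qed

lemma UE_weight_subset_UE: "UE_weight n \<kappa> m \<subseteq> UE n \<kappa>"
proof
  fix P assume "P \<in> UE_weight n \<kappa> m"
  then show "P \<in> UE n \<kappa>"
    unfolding UE_def by (intro CollectI exI[of _ "{m}"] exI[of _ "\<lambda>_. P"]) auto
qed

lemma UE_add:
  assumes "P \<in> UE n \<kappa>" "Q \<in> UE n \<kappa>" shows "P + Q \<in> UE n \<kappa>"
proof -
  obtain W p where p: "P = (\<Sum>m\<in>W. p m)" "finite W" "\<forall>m\<in>W. p m \<in> UE_weight n \<kappa> m"
    using assms(1) by (auto simp: UE_def)
  obtain W' q where q: "Q = (\<Sum>m\<in>W'. q m)" "finite W'" "\<forall>m\<in>W'. q m \<in> UE_weight n \<kappa> m"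
    using assms(2) by (auto simp: UE_def)
  let ?p = "\<lambda>m. if m \<in> W then p m else 0" and ?q = "\<lambda>m. if m \<in> W' then q m else 0"
  have "P = (\<Sum>m\<in>W \<union> W'. ?p m)" "Q = (\<Sum>m\<in>W \<union> W'. ?q m)"
    unfolding p(1) q(1) by (rule sum.mono_neutral_cong_left; use p q in auto)+
  then have "P + Q = (\<Sum>m\<in>W \<union> W'. ?p m + ?q m)" by (simp add: sum.distrib)
  moreover have "?p m + ?q m \<in> UE_weight n \<kappa> m" for m
    using p q by (intro UE_weight_add) (auto intro: UE_weight_0)
  ultimately show ?thesis
    unfolding UE_def using p q by (intro CollectI exI[of _ "W \<union> W'"] exI[of _ "\<lambda>m. ?p m + ?q m"]) auto
qed

lemma UE_weight_monomial:
  assumes "of_weights n \<kappa> L ls" "m \<in> monomials (length L)"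
  shows "mpower ((!) L) m \<in> UE_weight n \<kappa> (monom_weight ls m)"
proof -
  have len: "length ls = length L" using assms(1) by (rule of_weights_length)
  have "mpower ((!) L) m = (\<Prod>j<length L. L ! j ^ Poly_Mapping.lookup m j)"
    by (rule mpower_superset) (use assms in \<open>auto simp: monomials_def\<close>)
  moreover have "(\<Prod>j<length L. L ! j ^ Poly_Mapping.lookup m j)
      \<in> UE_weight n \<kappa> (\<Sum>j<length L. ls ! j * Poly_Mapping.lookup m j)"
    by (intro UE_weight_prod UE_weight_power)
      (use assms in \<open>auto simp: of_weights_def list_all2_conv_all_nth\<close>)
  ultimately show ?thesis by (simp add: monom_weight_def len)
qed

lemma UE_weight_psubst_single:
  assumes "of_weights n \<kappa> L ls" "m \<in> monomials (length L)"
  shows "psubst ((!) L) (Poly_Mapping.single m c) \<in> UE_weight n \<kappa> (monom_weight ls m)"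
  using UE_weight_mult[OF UE_weight_pconst UE_weight_monomial[OF assms]] by (simp add: psubst_monomial)

lemma UE_zero: "0 \<in> UE n \<kappa>"
  using UE_weight_0 UE_weight_subset_UE by blast

lemma generated_algebra_subset_UE:
  assumes "of_weights n \<kappa> L ls" shows "generated_algebra L \<subseteq> UE n \<kappa>"
proof -
  have "psubst ((!) L) T \<in> UE n \<kappa>" if "T \<in> poly_ring {..<length L}" for T
  proof (induction T rule: cpoly_single_induct)
    case (single m c)
    then have "m \<in> monomials (length L)" using that by (auto simp: keys_in_monomials)
    then show ?case using UE_weight_psubst_single[OF assms] UE_weight_subset_UE by blast
  qed (simp_all add: UE_zero UE_add)
  then show ?thesis by (auto simp: generated_algebra_def)
qed

lemma UE_weight_psubst:
  assumes "of_weights n \<kappa> L ls"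
    and "Poly_Mapping.keys T \<subseteq> {b \<in> monomials (length L). monom_weight ls b = d}"
  shows "psubst ((!) L) T \<in> UE_weight n \<kappa> d"
proof (induction T rule: cpoly_single_induct)
  case (single b c)
  then show ?case using assms(2) UE_weight_psubst_single[OF assms(1), of b c] by auto
qed (simp_all add: UE_weight_0 UE_weight_add)

text \<open>The converse of the normal form: its coefficients may be chosen freely. The weight
  \<open>a\<close> of the power of \<open>f1'\<close> completes the weight \<open>m - a\<close> of
  the standard part.\<close>

lemma normal_sum_in_UE_weight:
  assumes "of_weights n \<kappa> L ls" "f1' \<in> UE_weight n \<kappa> 1" "Pt \<in> normal_families ls r Ss m"
  shows "normal_sum L m Pt \<in> UE_weight n \<kappa> m"
  unfolding normal_sum_def
proof (rule UE_weight_sum)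
  fix a assume a: "a \<in> {..m}"
  then have keys: "Poly_Mapping.keys (Pt a) \<subseteq> standard_monomials ls r Ss (m - a)"
    using assms(3) by (auto simp: normal_families_def)
  have "psubst ((!) L) (Pt a) \<in> UE_weight n \<kappa> (m - a)"
    by (rule UE_weight_psubst[OF assms(1)])
      (use keys of_weights_length[OF assms(1)] in \<open>auto simp: standard_monomials_def\<close>)
  then show "f1' ^ a * psubst ((!) L) (Pt a) \<in> UE_weight n \<kappa> m"
    using UE_weight_mult[OF UE_weight_power[OF assms(2), of a], of "psubst ((!) L) (Pt a)" "m - a"] a
    by simp
qed

section \<open>The run of the algorithm, and the conclusion\<close>

lemma algorithm_loop_mono:
  assumes "algorithm_loop n \<kappa> L L'" shows "set L \<subseteq> set L'"
proof -
  have "set L \<subseteq> set (fold append_new Rs L)" for Rs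
  proof (induction Rs arbitrary: L)
    case (Cons R Rs)
    have "set L \<subseteq> set (append_new R L)" by (auto simp: append_new_def)
    then show ?case using Cons[of "append_new R L"] by simp
  qed simp
  then show ?thesis using assms by (auto simp: algorithm_loop_def)
qed

text \<open>Loops only append, so the initial determinants are still in the list; this is how the
  history of the algorithm enters the proof that the list generates.\<close>

lemma obtained_by_algorithm_initial:
  assumes "obtained_by_algorithm n \<kappa> L" shows "initial_invariants n \<kappa> \<subseteq> set L"
proof -
  obtain L0 where L0: "set L0 = initial_invariants n \<kappa>" "(algorithm_loop n \<kappa>)\<^sup>*\<^sup>* L0 L"
    using assms by (auto simp: obtained_by_algorithm_def initial_list_def)
  from L0(2) have "set L0 \<subseteq> set L"
    by (induction rule: rtranclp_induct) (auto dest: algorithm_loop_mono)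
  then show ?thesis using L0(1) by simp
qed

theorem mainTheorem7:
  fixes n \<kappa> :: nat
    and L :: "jpoly list" and ls :: "nat list"
    and r :: "((nat \<Rightarrow>\<^sub>0 nat) \<times> (nat \<Rightarrow>\<^sub>0 nat)) set"
    and Ss :: "nat cpoly list"
  assumes "n \<ge> 1" and "\<kappa> \<ge> 1"
    and "obtained_by_algorithm n \<kappa> L"
    and "mutually_independent (f1' # L)"
    and "of_weights n \<kappa> L ls"
    and "monomial_order (length L) r"
    and "homogeneous_reduced_basis L ls r Ss"
    and "\<forall>S\<in>set Ss. \<exists>R\<in>poly_ring {..<Suc (length L)}.
           0 = psubst ((!) L) S - f1' * psubst ((!) (f1' # L)) R"
  shows "algorithm_terminates_at n \<kappa> L \<and>
    UE n \<kappa> = generated_algebra (f1' # L) \<and>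
    (\<forall>m. (\<forall>P\<in>UE_weight n \<kappa> m. \<exists>!Pt. Pt \<in> normal_families ls r Ss m \<and> P = normal_sum L m Pt) \<and>
         (\<forall>Pt\<in>normal_families ls r Ss m. normal_sum L m Pt \<in> UE_weight n \<kappa> m))"
proof -
  interpret closed_list L r Ss
    using assms by unfold_locales (auto simp: homogeneous_reduced_basis_def)
  have f1': "f1' \<in> UE_weight n \<kappa> 1" using assms by (intro UE_weight_f1')
  have initial: "initial_invariants n \<kappa> \<subseteq> alg"
    using obtained_by_algorithm_initial[OF assms(3)] L_in_alg by blast
  have weight_alg: "P \<in> alg" if "P \<in> UE_weight n \<kappa> m" for P m
    using UE_weight_localization[OF subalgebra_generated f1'_in_alg initial that]
      f1'_power_mult_in_alg by blast
  have iso: "list_all2 (\<lambda>P l. isobaric l P) L ls"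
    using assms(5) unfolding of_weights_def
    by (rule list_all2_mono) (auto simp: UE_weight_def intro: reparam_invariant_isobaric)
  have "algorithm_terminates_at n \<kappa> L"
    using algorithm_loop_possible[OF assms(5,7)] algorithm_loop_eq
    unfolding algorithm_terminates_at_def by metis
  moreover have "UE n \<kappa> = alg"
  proof
    show "UE n \<kappa> \<subseteq> alg"
      unfolding UE_def using weight_alg by (fast intro: subalgebra_sum[OF subalgebra_generated])
    have "of_weights n \<kappa> (f1' # L) (1 # ls)"
      using assms(5) f1' by (simp add: of_weights_def)
    then show "alg \<subseteq> UE n \<kappa>" by (rule generated_algebra_subset_UE)
  qed
  moreover have "\<exists>!Pt. Pt \<in> normal_families ls r Ss m \<and> P = normal_sum L m Pt"
    if P: "P \<in> UE_weight n \<kappa> m" for P m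
  proof -
    have "isobaric m P" using P by (auto simp: UE_weight_def intro: reparam_invariant_isobaric)
    then obtain Pt where "Pt \<in> normal_families ls r Ss m" "P = normal_sum L m Pt"
      using normal_sum_exists[OF iso weight_alg[OF P]] by blast
    then show ?thesis
      using normal_sum_unique[OF of_weights_length[OF assms(5)]] by (intro ex1I[of _ Pt]) auto
  qed
  moreover have "normal_sum L m Pt \<in> UE_weight n \<kappa> m" if "Pt \<in> normal_families ls r Ss m" for Pt m
    using normal_sum_in_UE_weight[OF assms(5) f1' that] .
  ultimately show ?thesis by blast
qed

end
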